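(* Let $X$ be an algebraically integrable complex planar polynomial vector field such that $X\neq c\,\frac{\partial}{\partial y}$ for all $c\in\mathbb{C}\setminus\{0\}$. For each $\delta\in\mathbb{Z}_{\ge 0}$, let $A_{\delta,0},A_{\delta,1},B_{\delta,0},B_{\delta,1}\in\mathbb{C}[X_0,X_1,Y_0,Y_1]$ be the output of the extension algorithm (recalled in the context) for the input $(\delta,\omega_X)$. Consider the planar vector fields $X_{10}^\delta$ and $X_{11}^\delta$ defined, respectively, by the differential $1$-forms $$\omega_{10}^\delta:=A_{\delta,0}(x,1,1,y)\,dx+B_{\delta,1}(x,1,1,y)\,dy,\qquad \omega_{11}^\delta:=A_{\delta,0}(x,1,y,1)\,dx+B_{\delta,0}(x,1,y,1)\,dy.$$ Let $\delta_1$ be the minimum nonnegative integer such that the origin $(0,0)$ is not a dicritical singularity of $X_{10}^{\delta_1}$. Then, for all $\delta>\delta_1$: (a) the origin $(0,0)$ is the unique dicritical singularity of $X_{11}^\delta$ in the line defined by $x=0$, and (b) the vector field $X_{10}^\delta$ has no dicritical singularity in the line defined by $x=0$.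
   Context: A complex planar polynomial vector field is $X=a(x,y)\frac{\partial}{\partial x}+b(x,y)\frac{\partial}{\partial y}$ with $a,b\in\mathbb{C}[x,y]$ coprime; it is also given by the $1$-form $\omega_X=b\,dx-a\,dy$, which we write $\omega_X=A\,dx+B\,dy$. It is algebraically integrable if there is $f\in\mathbb{C}(x,y)\setminus\mathbb{C}$ (a rational first integral) with $X(f)=a f_x+b f_y=0$. The ring $\mathbb{C}[X_0,X_1,Y_0,Y_1]$ is bigraded by $\deg X_0=\deg X_1=(1,0)$, $\deg Y_0=(0,1)$, $\deg Y_1=(-\delta,1)$. Extension algorithm. Input: $\delta\in\mathbb{Z}_{\ge 0}$ and $\omega=A\,dx+B\,dy$ with $A,B\in\mathbb{C}[x,y]$ coprime. (In each step $:=$ updates the polynomials.) (1) Write $A\left(\frac{X_1}{X_0},\frac{X_0^\delta Y_1}{Y_0}\right)=\frac{A_{\delta,1}}{X_0^{\alpha_1}Y_0^{\alpha_2}}$ and $B\left(\frac{X_1}{X_0},\frac{X_0^\delta Y_1}{Y_0}\right)=\frac{B_{\delta,1}}{X_0^{\beta_1}Y_0^{\beta_2}}$, where $\alpha_1,\alpha_2,\beta_1,\beta_2$ are integers and $A_{\delta,1},B_{\delta,1}$ are polynomials divisible neither by $X_0$ nor by $Y_0$; they are bigraded homogeneous of bidegrees $(\alpha_1,\alpha_2)$ and $(\beta_1,\beta_2)$. (If $A=0$, put $A_{\delta,1}=0$ and take $\alpha_1,\alpha_2$ so negative that $m_1,m_2\le 0$ below; if $B=0$, put $B_{\delta,1}=0$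 and take $\beta_1,\beta_2$ so negative that $m_1,m_2>0$ below.) (2) Let $m_1:=\alpha_1-\beta_1+1+\delta$. If $m_1>0$, then $B_{\delta,1}:=X_0^{m_1}B_{\delta,1}$; otherwise $A_{\delta,1}:=X_0^{-m_1}A_{\delta,1}$. (3) Let $m_2:=\alpha_2-\beta_2-1$. If $m_2>0$, then $B_{\delta,1}:=Y_0^{m_2}B_{\delta,1}$; otherwise $A_{\delta,1}:=Y_0^{-m_2}A_{\delta,1}$. (4) Let $e:=0$ if $Y_0$ divides $B_{\delta,1}$ and $e:=1$ otherwise; set $B_{\delta,1}:=Y_0^{e}B_{\delta,1}$, $A_{\delta,1}:=Y_0^{e}A_{\delta,1}$. (5) Let $e':=0$ if $X_0$ divides $\delta Y_1B_{\delta,1}-X_1A_{\delta,1}$ and $e':=1$ otherwise; set $A_{\delta,1}:=X_0^{e'}A_{\delta,1}$, $B_{\delta,1}:=X_0^{e'}B_{\delta,1}$. (6) Set $A_{\delta,0}:=\frac{\delta Y_1B_{\delta,1}-X_1A_{\delta,1}}{X_0}$ and $B_{\delta,0}:=\frac{-Y_1B_{\delta,1}}{Y_0}$. Output: $A_{\delta,0},A_{\delta,1},B_{\delta,0},B_{\delta,1}$. In evaluations, the arguments are in the order $(X_0,X_1,Y_0,Y_1)$. Dicritical singularities. For a planar vector field, these are the dicritical singularities of the foliation on $\mathbb{C}^2$ that it defines. Let $\mathcal{G}$ be a foliation with isolated singularities on a smooth surface, given near a point $p$, in local coordinates $(x,y)$ centred at $p$, by $\omega=P\,dx+Q\,dy$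 ($P,Q$ without common factor). Let $\omega_m=p_m\,dx+q_m\,dy$ be the first nonvanishing jet of $\omega$ ($p_m,q_m$ homogeneous of degree $m$). Then $p$ is a singularity iff $m\ge 1$. A singularity $p$ is terminal dicritical if $x p_m+y q_m$ is the zero polynomial. It is simple if $m=1$ and the matrix $\begin{pmatrix}\partial q_1/\partial x&\partial q_1/\partial y\\-\partial p_1/\partial x&-\partial p_1/\partial y\end{pmatrix}$ has eigenvalues $\lambda_1,\lambda_2$ such that either $\lambda_1\lambda_2\ne 0$ and $\lambda_1/\lambda_2$ is not a positive rational number, or $\lambda_1\lambda_2=0$ and $\lambda_1^2+\lambda_2^2\neq 0$. Nonsimple singularities are called ordinary. The strict transform of $\mathcal{G}$ under the blowup at $p$ is given by the pull-back of $\omega$ divided by the largest possible power of a local equation of the exceptional divisor. After finitely many blowups at ordinary singularities of (a neighbourhood of $p$ in) $\mathcal{G}$ and of its successive strict transforms one reaches a foliation without ordinary singularities; the set of blowup centres is the singular configuration $\mathcal{C}_{\mathcal{G}}$. A point $q$ is infinitely near $p$ if $q=p$ or $q$ lies on an exceptional divisor created by successively blowing up $p$ and points over $p$. An ordinary singularity $p\in\mathcal{C}_{\mathcal{G}}$ is a dicritical singularity of $\mathcal{G}$ if there is $q\in\mathcal{C}_{\mathcal{G}}$ infinitely near $p$ (possibly $q=p$) which is a terminal dicritical singularity of the strict transform of $\mathcal{G}$ on the surface containing $q$. *)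

theory Defs
  imports "HOL-Computational_Algebra.Computational_Algebra" "HOL-Computational_Algebra.Field_as_Ring"
    "Jordan_Normal_Form.Char_Poly"
begin

section \<open>Polynomials in two and in four variables\<close>

text \<open>
  \<open>\<complex>[x,y]\<close> is \<open>\<complex>[x][y]\<close>: the inner variable is \<open>x\<close>, the outer one is \<open>y\<close>, so the coefficient
  of \<open>x\<^sup>i y\<^sup>j\<close> in \<open>p\<close> is \<open>coeff (coeff p j) i\<close>. Likewise \<open>\<complex>[X\<^sub>0,X\<^sub>1,Y\<^sub>0,Y\<^sub>1]\<close> is
  \<open>\<complex>[X\<^sub>0][X\<^sub>1][Y\<^sub>0][Y\<^sub>1]\<close>.
\<close>

type_synonym poly2 = "complex poly poly"
type_synonym poly4 = "complex poly poly poly poly"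

definition const2 :: "complex \<Rightarrow> poly2" where "const2 c = [:[:c:]:]"
definition varx :: poly2 where "varx = [:[:0, 1:]:]"
definition vary :: poly2 where "vary = [:0, 1:]"

definition const4 :: "complex \<Rightarrow> poly4" where "const4 c = [:[:[:[:c:]:]:]:]"
definition X0 :: poly4 where "X0 = [:[:[:[:0, 1:]:]:]:]"
definition X1 :: poly4 where "X1 = [:[:[:0, 1:]:]:]"
definition Y0 :: poly4 where "Y0 = [:[:0, 1:]:]"
definition Y1 :: poly4 where "Y1 = [:0, 1:]"

text \<open>
  Evaluation at elements of a commutative ring, which is a \<open>\<complex>\<close>-algebra through \<open>h\<close>.
\<close>

definition eval2 :: "(complex \<Rightarrow> 'r::comm_ring_1) \<Rightarrow> poly2 \<Rightarrow> 'r \<Rightarrow> 'r \<Rightarrow> 'r" where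
  "eval2 h p x y = eval_poly (\<lambda>q. eval_poly h q x) p y"

definition eval4 :: "(complex \<Rightarrow> 'r::comm_ring_1) \<Rightarrow> poly4 \<Rightarrow> 'r \<Rightarrow> 'r \<Rightarrow> 'r \<Rightarrow> 'r \<Rightarrow> 'r" where
  "eval4 h p x0 x1 y0 y1 =
     eval_poly (\<lambda>q. eval_poly (\<lambda>r. eval_poly (\<lambda>s. eval_poly h s x0) r x1) q y0) p y1"

definition dx :: "poly2 \<Rightarrow> poly2" where "dx = map_poly pderiv"
definition dy :: "poly2 \<Rightarrow> poly2" where "dy = pderiv"


section \<open>Algebraic integrability\<close>

lemma dx_add: "dx (p + q) = dx p + dx q"
  unfolding dx_def by (intro poly_eqI) (simp add: coeff_map_poly pderiv_add)

lemma dx_mult: "dx (p * q) = dx p * q + p * dx q"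
proof -
  have sum: "pderiv (\<Sum>i\<in>A. f i) = (\<Sum>i\<in>A. pderiv (f i))" for f :: "nat \<Rightarrow> complex poly" and A
    by (induction A rule: infinite_finite_induct) (simp_all add: pderiv_add)
  have prod: "pderiv (a * b) = pderiv a * b + a * pderiv b" for a b :: "complex poly"
    by (simp add: pderiv_mult)
  show ?thesis
    unfolding dx_def
    by (intro poly_eqI)
       (simp add: coeff_map_poly coeff_mult sum prod sum.distrib)
qed

lemma dy_mult: "dy (p * q) = dy p * q + p * dy q"
  unfolding dy_def by (simp add: pderiv_mult)

lemma quotient_rule_welldef:
  fixes D :: "'a::idom \<Rightarrow> 'a"
  assumes D: "\<And>u v. D (u * v) = D u * v + u * D v"
    and eq: "p * q' = p' * q"
  shows "(D p * q - p * D q) * (q' * q') = (D p' * q' - p' * D q') * (q * q)"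
proof -
  have "D (p * q') = D (p' * q)" using eq by simp
  hence *: "D p * q' = D p' * q + p' * D q - p * D q'" by (simp add: D eq_diff_eq)
  have "(D p * q - p * D q) * (q' * q') = q * q' * (D p * q') - (p * q') * (q' * D q)"
    by (simp add: algebra_simps)
  also have "\<dots> = q * q' * (D p' * q + p' * D q - p * D q') - (p' * q) * (q' * D q)"
    unfolding * eq ..
  also have "\<dots> = q * q' * (D p' * q) - (p * q') * (q * D q')"
    by (simp add: algebra_simps)
  also have "\<dots> = (D p' * q' - p' * D q') * (q * q)"
    unfolding eq by (simp add: algebra_simps)
  finally show ?thesis .
qed

text \<open>
  The extension of a derivation of a domain to the field of fractions by the quotient rule. The
  definite description ranges over all representations as a fraction; for \<open>dx\<close> and \<open>dy\<close> it is
  justified by lemmas \<open>fract_dx_Fract\<close> and \<open>fract_dy_Fract\<close>.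
\<close>

definition fract_deriv :: "('a::idom \<Rightarrow> 'a) \<Rightarrow> 'a fract \<Rightarrow> 'a fract" where
  "fract_deriv D f = (THE g. \<forall>p q. q \<noteq> 0 \<longrightarrow> f = Fract p q \<longrightarrow> g = Fract (D p * q - p * D q) (q * q))"

lemma fract_deriv_Fract:
  assumes D: "\<And>u v. D (u * v) = D u * v + u * D v" and q: "q \<noteq> 0"
  shows "fract_deriv D (Fract p q) = Fract (D p * q - p * D q) (q * q)"
  unfolding fract_deriv_def
proof (rule the_equality, intro allI impI)
  fix p' q' assume q': "q' \<noteq> 0" and "Fract p q = Fract p' q'"
  hence "p * q' = p' * q" using q by (simp add: eq_fract)
  from quotient_rule_welldef[of D, OF D this]
  show "Fract (D p * q - p * D q) (q * q) = Fract (D p' * q' - p' * D q') (q' * q')"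
    using q q' by (simp add: eq_fract)
qed (use q in blast)

definition fract_dx :: "poly2 fract \<Rightarrow> poly2 fract" where "fract_dx = fract_deriv dx"
definition fract_dy :: "poly2 fract \<Rightarrow> poly2 fract" where "fract_dy = fract_deriv dy"

lemma fract_dx_Fract: "q \<noteq> 0 \<Longrightarrow> fract_dx (Fract p q) = Fract (dx p * q - p * dx q) (q * q)"
  unfolding fract_dx_def by (rule fract_deriv_Fract[OF dx_mult])

lemma fract_dy_Fract: "q \<noteq> 0 \<Longrightarrow> fract_dy (Fract p q) = Fract (dy p * q - p * dy q) (q * q)"
  unfolding fract_dy_def by (rule fract_deriv_Fract[OF dy_mult])

definition rational_first_integral :: "poly2 \<Rightarrow> poly2 \<Rightarrow> poly2 fract \<Rightarrow> bool" where
  "rational_first_integral a b f \<longleftrightarrow>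
     f \<notin> range (\<lambda>c. to_fract (const2 c)) \<and>
     to_fract a * fract_dx f + to_fract b * fract_dy f = 0"

definition algebraically_integrable :: "poly2 \<Rightarrow> poly2 \<Rightarrow> bool" where
  "algebraically_integrable a b \<longleftrightarrow> (\<exists>f. rational_first_integral a b f)"


section \<open>Differential forms and the extension algorithm\<close>

text \<open>A pair \<open>(P, Q)\<close> stands for the form \<open>P dx + Q dy\<close>.\<close>

type_synonym form = "poly2 \<times> poly2"

definition form_of_vf :: "poly2 \<Rightarrow> poly2 \<Rightarrow> form" where
  "form_of_vf a b = (b, - a)"

text \<open>
  \<open>homogenizes \<delta> A A' \<alpha>\<^sub>1 \<alpha>\<^sub>2\<close>: step 1 of the algorithm, for \<open>A \<noteq> 0\<close>. The equation
  \<open>A (X\<^sub>1/X\<^sub>0, X\<^sub>0\<^sup>\<delta> Y\<^sub>1/Y\<^sub>0) = A'/(X\<^sub>0\<^bsup>\<alpha>\<^sub>1\<^esup> Y\<^sub>0\<^bsup>\<alpha>\<^sub>2\<^esup>)\<close> is one in \<open>\<complex>(X\<^sub>0,X\<^sub>1,Y\<^sub>0,Y\<^sub>1)\<close>; the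
  exponents are integers, possibly negative.
\<close>

definition homogenizes :: "nat \<Rightarrow> poly2 \<Rightarrow> poly4 \<Rightarrow> int \<Rightarrow> int \<Rightarrow> bool" where
  "homogenizes \<delta> A A' \<alpha>\<^sub>1 \<alpha>\<^sub>2 \<longleftrightarrow>
     eval2 (\<lambda>c. to_fract (const4 c)) A
       (to_fract X1 / to_fract X0) (to_fract X0 ^ \<delta> * to_fract Y1 / to_fract Y0)
     = to_fract A' / (to_fract X0 powi \<alpha>\<^sub>1 * to_fract Y0 powi \<alpha>\<^sub>2)
     \<and> \<not> X0 dvd A' \<and> \<not> Y0 dvd A'"

text \<open>
  Steps 2 to 6; the primes count the updates of \<open>A\<^bsub>\<delta>,1\<^esub>\<close> and \<open>B\<^bsub>\<delta>,1\<^esub>\<close>. The two divisions at the end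
  are exact by the choice of \<open>e\<close> and \<open>e'\<close>.
\<close>

definition extension_steps ::
    "nat \<Rightarrow> int \<Rightarrow> int \<Rightarrow> poly4 \<Rightarrow> poly4 \<Rightarrow> poly4 \<times> poly4 \<times> poly4 \<times> poly4" where
  "extension_steps \<delta> m\<^sub>1 m\<^sub>2 A B =
    (let (A', B') = (if m\<^sub>1 > 0 then (A, X0 ^ nat m\<^sub>1 * B) else (X0 ^ nat (- m\<^sub>1) * A, B));
         (A'', B'') = (if m\<^sub>2 > 0 then (A', Y0 ^ nat m\<^sub>2 * B') else (Y0 ^ nat (- m\<^sub>2) * A', B'));
         e = (if Y0 dvd B'' then 0 else 1);
         A''' = Y0 ^ e * A''; B''' = Y0 ^ e * B'';
         e' = (if X0 dvd of_nat \<delta> * Y1 * B''' - X1 * A''' then 0 else 1);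
         A1 = X0 ^ e' * A'''; B1 = X0 ^ e' * B''';
         A0 = (of_nat \<delta> * Y1 * B1 - X1 * A1) div X0;
         B0 = (- Y1 * B1) div Y0
     in (A0, A1, B0, B1))"

text \<open>
  The output is listed as \<open>(A\<^bsub>\<delta>,0\<^esub>, A\<^bsub>\<delta>,1\<^esub>, B\<^bsub>\<delta>,0\<^esub>, B\<^bsub>\<delta>,1\<^esub>)\<close>. If \<open>A = 0\<close> or \<open>B = 0\<close>, the algorithm
  leaves the bidegree of the zero polynomial open up to the stated sign conditions on \<open>m\<^sub>1\<close>, \<open>m\<^sub>2\<close>.
\<close>

definition is_extension_output ::
    "nat \<Rightarrow> form \<Rightarrow> poly4 \<times> poly4 \<times> poly4 \<times> poly4 \<Rightarrow> bool" where
  "is_extension_output \<delta> \<omega> out \<longleftrightarrow>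
    (case \<omega> of (A, B) \<Rightarrow>
      \<exists>A' \<alpha>\<^sub>1 \<alpha>\<^sub>2 B' \<beta>\<^sub>1 \<beta>\<^sub>2 m\<^sub>1 m\<^sub>2.
        m\<^sub>1 = \<alpha>\<^sub>1 - \<beta>\<^sub>1 + 1 + int \<delta> \<and> m\<^sub>2 = \<alpha>\<^sub>2 - \<beta>\<^sub>2 - 1 \<and>
        (if A = 0 then A' = 0 \<and> m\<^sub>1 \<le> 0 \<and> m\<^sub>2 \<le> 0 else homogenizes \<delta> A A' \<alpha>\<^sub>1 \<alpha>\<^sub>2) \<and>
        (if B = 0 then B' = 0 \<and> m\<^sub>1 > 0 \<and> m\<^sub>2 > 0 else homogenizes \<delta> B B' \<beta>\<^sub>1 \<beta>\<^sub>2) \<and>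
        out = extension_steps \<delta> m\<^sub>1 m\<^sub>2 A' B')"

text \<open>Existence and uniqueness for coprime input is lemma \<open>is_extension_output_unique\<close> below.\<close>

definition extension :: "nat \<Rightarrow> form \<Rightarrow> poly4 \<times> poly4 \<times> poly4 \<times> poly4" where
  "extension \<delta> \<omega> = (THE out. is_extension_output \<delta> \<omega> out)"

text \<open>
  The coordinates are \<open>x = X\<^sub>0, y = Y\<^sub>1\<close> for \<open>\<omega>\<^bsub>10\<^esub>\<close> and \<open>x = X\<^sub>0, y = Y\<^sub>0\<close> for \<open>\<omega>\<^bsub>11\<^esub>\<close>. If the
  coefficients of \<open>\<omega>\<close> are coprime, then so are those of both forms, because the algorithm never
  leaves a common factor \<open>X\<^sub>0\<close> or \<open>Y\<^sub>0\<close>.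
\<close>

definition omega10 :: "nat \<Rightarrow> form \<Rightarrow> form" where
  "omega10 \<delta> \<omega> = (case extension \<delta> \<omega> of (A0, A1, B0, B1) \<Rightarrow>
     (eval4 const2 A0 varx 1 1 vary, eval4 const2 B1 varx 1 1 vary))"

definition omega11 :: "nat \<Rightarrow> form \<Rightarrow> form" where
  "omega11 \<delta> \<omega> = (case extension \<delta> \<omega> of (A0, A1, B0, B1) \<Rightarrow>
     (eval4 const2 A0 varx 1 vary 1, eval4 const2 B0 varx 1 vary 1))"


section \<open>Dicritical singularities\<close>

definition hom_part :: "nat \<Rightarrow> poly2 \<Rightarrow> poly2" where
  "hom_part m p = (\<Sum>j\<le>m. monom (monom (coeff (coeff p j) (m - j)) (m - j)) j)"

text \<open>
  In this group of definitions the form \<open>(P, Q)\<close> is given in local coordinates centred at the point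
  considered, and \<open>P\<close>, \<open>Q\<close> have no common factor.
\<close>

definition jet_order :: "form \<Rightarrow> nat" where
  "jet_order = (\<lambda>(P, Q). LEAST m. hom_part m P \<noteq> 0 \<or> hom_part m Q \<noteq> 0)"

definition first_jet :: "form \<Rightarrow> form" where
  "first_jet \<omega> = (hom_part (jet_order \<omega>) (fst \<omega>), hom_part (jet_order \<omega>) (snd \<omega>))"

definition singular :: "form \<Rightarrow> bool" where
  "singular \<omega> \<longleftrightarrow> jet_order \<omega> \<ge> 1"

definition terminal_dicritical :: "form \<Rightarrow> bool" where
  "terminal_dicritical \<omega> \<longleftrightarrow> singular \<omega> \<and>
     (case first_jet \<omega> of (p, q) \<Rightarrow> varx * p + vary * q = 0)"

text \<open>
  If the first jet has degree 1, the entries of the matrix are constant polynomials; they are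
  turned into numbers by evaluation at the origin.
\<close>

definition linear_part :: "form \<Rightarrow> complex mat" where
  "linear_part \<omega> = (case first_jet \<omega> of (p, q) \<Rightarrow>
     map_mat (\<lambda>r. eval2 id r 0 0)
       (mat_of_rows_list 2 [[dx q, dy q], [- dx p, - dy p]]))"

definition simple :: "form \<Rightarrow> bool" where
  "simple \<omega> \<longleftrightarrow> jet_order \<omega> = 1 \<and>
     (\<exists>\<mu>\<^sub>1 \<mu>\<^sub>2. char_poly (linear_part \<omega>) = [:- \<mu>\<^sub>1, 1:] * [:- \<mu>\<^sub>2, 1:] \<and>
        (\<mu>\<^sub>1 * \<mu>\<^sub>2 \<noteq> 0 \<and> \<not> (\<exists>r::rat. r > 0 \<and> \<mu>\<^sub>1 / \<mu>\<^sub>2 = of_rat r)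
         \<or> \<mu>\<^sub>1 * \<mu>\<^sub>2 = 0 \<and> \<mu>\<^sub>1\<^sup>2 + \<mu>\<^sub>2\<^sup>2 \<noteq> 0))"

definition ordinary :: "form \<Rightarrow> bool" where
  "ordinary \<omega> \<longleftrightarrow> singular \<omega> \<and> \<not> simple \<omega>"

text \<open>The pull-back of a form under the map \<open>(x, y) \<mapsto> (u (x, y), v (x, y))\<close>.\<close>

definition pullback :: "poly2 \<Rightarrow> poly2 \<Rightarrow> form \<Rightarrow> form" where
  "pullback u v = (\<lambda>(P, Q).
     (eval2 const2 P u v * dx u + eval2 const2 Q u v * dx v,
      eval2 const2 P u v * dy u + eval2 const2 Q u v * dy v))"

definition translate :: "complex \<times> complex \<Rightarrow> form \<Rightarrow> form" where
  "translate p = pullback (varx + const2 (fst p)) (vary + const2 (snd p))"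

definition divide_max_power :: "poly2 \<Rightarrow> form \<Rightarrow> form" where
  "divide_max_power E = (\<lambda>(P, Q).
     let k = (GREATEST k. E ^ k dvd P \<and> E ^ k dvd Q) in (P div E ^ k, Q div E ^ k))"

text \<open>
  The exceptional divisor of the blowup at the origin is the projective line of directions:
  \<open>Some t\<close> is the direction of \<open>y = t x\<close>, and \<open>None\<close> that of \<open>x = 0\<close>.
  \<open>strict_transform d \<omega>\<close> is the strict transform of \<open>\<omega>\<close> in coordinates centred at the point \<open>d\<close> of
  the exceptional divisor, which is \<open>x = 0\<close> in the first chart and \<open>y = 0\<close> in the second one.
\<close>

fun strict_transform :: "complex option \<Rightarrow> form \<Rightarrow> form" where
  "strict_transform (Some t) \<omega> =
     divide_max_power varx (pullback varx (varx * (vary + const2 t)) \<omega>)"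
| "strict_transform None \<omega> =
     divide_max_power vary (pullback (varx * vary) vary \<omega>)"

text \<open>
  A point infinitely near to points of \<open>\<complex>\<^sup>2\<close> is a pair \<open>(p, ds)\<close>: the point \<open>p\<close> of the plane above
  which it lies, and the list of points to be chosen successively on the exceptional divisors
  created by blowing up the preceding point (so that \<open>(p, [])\<close> is \<open>p\<close> itself).
  \<open>form_at \<omega> p ds\<close> is the strict transform of \<open>\<omega>\<close> in coordinates centred at this point.
\<close>

definition form_at :: "form \<Rightarrow> complex \<times> complex \<Rightarrow> complex option list \<Rightarrow> form" where
  "form_at \<omega> p ds = fold strict_transform ds (translate p \<omega>)"

text \<open>
  Only ordinary singularities are blown up, until none is left. So the centres are the ordinary
  points that can be reached through ordinary points.
\<close>

definition singular_configuration :: "form \<Rightarrow> ((complex \<times> complex) \<times> complex option list) set" where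
  "singular_configuration \<omega> = {(p, ds). \<forall>k\<le>length ds. ordinary (form_at \<omega> p (take k ds))}"

definition dicritical_singularity :: "form \<Rightarrow> complex \<times> complex \<Rightarrow> bool" where
  "dicritical_singularity \<omega> p \<longleftrightarrow>
     (p, []) \<in> singular_configuration \<omega> \<and>
     (\<exists>ds. (p, ds) \<in> singular_configuration \<omega> \<and> terminal_dicritical (form_at \<omega> p ds))"


section \<open>The output of the extension algorithm is well defined\<close>

lemma comm_ring_hom_eval_poly:
  assumes "comm_ring_hom h" shows "comm_ring_hom (\<lambda>p. eval_poly h p x)"
proof -
  interpret comm_ring_hom h by fact
  interpret m: map_poly_comm_ring_hom h ..
  show ?thesis unfolding eval_poly_def
    by standard (simp_all add: hom_distribs)
qed

lemma comm_ring_hom_eval2: "comm_ring_hom h \<Longrightarrow> comm_ring_hom (\<lambda>p. eval2 h p x y)"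
  unfolding eval2_def by (intro comm_ring_hom_eval_poly)

lemma comm_ring_hom_eval4: "comm_ring_hom h \<Longrightarrow> comm_ring_hom (\<lambda>p. eval4 h p x0 x1 y0 y1)"
  unfolding eval4_def by (intro comm_ring_hom_eval_poly)

lemma comm_ring_hom_const2: "comm_ring_hom const2"
  by standard (simp_all add: const2_def one_pCons)

lemma comm_ring_hom_const4: "comm_ring_hom const4"
  by standard (simp_all add: const4_def one_pCons)

lemma prime_X0: "prime_elem X0"
  unfolding X0_def by (simp add: prime_elem_const_poly_iff prime_elem_linear_field_poly)

lemma prime_var: "prime_elem ([:0, 1:] :: 'a::idom poly)"
  unfolding prime_elem_def
  by (auto simp: poly_eq_0_iff_dvd[of _ 0, simplified, symmetric] is_unit_poly_iff)

lemma prime_Y0: "prime_elem Y0"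
  unfolding Y0_def by (simp add: prime_elem_const_poly_iff prime_var)

lemma not_X0_dvd_Y0: "\<not> X0 dvd Y0"
proof
  assume "X0 dvd Y0"
  hence "[:[:[:0, 1:]:]:] dvd ([:0, 1:] :: complex poly poly poly)"
    unfolding X0_def Y0_def const_poly_dvd .
  hence "[:[:0, 1:]:] dvd coeff ([:0, 1:] :: complex poly poly poly) 1"
    using const_poly_dvd_iff by blast
  moreover have "coeff ([:0, 1:] :: complex poly poly poly) 1 = 1" by simp
  ultimately have "[:[:0, 1:]:] dvd (1 :: complex poly poly)" by argo
  thus False by (simp add: is_unit_const_poly_iff is_unit_poly_iff)
qed

lemma not_Y0_dvd_X0: "\<not> Y0 dvd X0"
  unfolding X0_def Y0_def
  by (simp add: const_poly_dvd poly_eq_0_iff_dvd[of _ 0, simplified, symmetric])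

definition clears :: "poly4 fract \<Rightarrow> poly2 \<Rightarrow> bool" where
  "clears F A \<longleftrightarrow> (\<exists>N M G. F * to_fract X0 ^ N * to_fract Y0 ^ M = to_fract G \<and>
     eval4 const2 G 1 varx 1 vary = A)"

lemma to_fract_power [simp]: "to_fract (x ^ n) = to_fract x ^ n"
  by (induction n) simp_all

lemma const2_0_1: "const2 0 = 0" "const2 1 = 1"
  by (simp_all add: const2_def one_pCons)

lemma eval4_simps [simp]:
  "eval4 const2 X0 x0 x1 y0 y1 = x0" "eval4 const2 X1 x0 x1 y0 y1 = x1"
  "eval4 const2 Y0 x0 x1 y0 y1 = y0" "eval4 const2 Y1 x0 x1 y0 y1 = y1"
  by (simp_all add: eval4_def X0_def X1_def Y0_def Y1_def eval_poly_def map_poly_pCons const2_0_1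
        map_poly_1)

lemma eval4_const4 [simp]: "eval4 const2 (const4 c) x0 x1 y0 y1 = const2 c"
proof (cases "c = 0")
  case False
  thus ?thesis
    by (simp add: eval4_def const4_def eval_poly_def map_poly_pCons const2_0_1)
qed (simp add: eval4_def const4_def eval_poly_def const2_0_1)

lemma clears_add:
  assumes "clears F A" "clears F' A'" shows "clears (F + F') (A + A')"
proof -
  interpret comm_ring_hom "\<lambda>G. eval4 const2 G 1 varx 1 vary"
    by (intro comm_ring_hom_eval4 comm_ring_hom_const2)
  from assms obtain N M G N' M' G' where
    1: "F * to_fract X0 ^ N * to_fract Y0 ^ M = to_fract G" "eval4 const2 G 1 varx 1 vary = A" and
    2: "F' * to_fract X0 ^ N' * to_fract Y0 ^ M' = to_fract G'" "eval4 const2 G' 1 varx 1 vary = A'"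
    unfolding clears_def by blast
  have "(F + F') * to_fract X0 ^ (N + N') * to_fract Y0 ^ (M + M')
      = (F * to_fract X0 ^ N * to_fract Y0 ^ M) * (to_fract X0 ^ N' * to_fract Y0 ^ M') +
        (F' * to_fract X0 ^ N' * to_fract Y0 ^ M') * (to_fract X0 ^ N * to_fract Y0 ^ M)"
    by (simp add: power_add algebra_simps)
  also have "\<dots> = to_fract (G * (X0 ^ N' * Y0 ^ M') + G' * (X0 ^ N * Y0 ^ M))"
    unfolding 1 2 by simp
  finally show ?thesis unfolding clears_def using 1 2
    by (intro exI[of _ "N + N'"] exI[of _ "M + M'"] exI[of _ "G * (X0 ^ N' * Y0 ^ M') + G' * (X0 ^ N * Y0 ^ M)"])
       (simp add: hom_distribs)
qed

lemma clears_mult: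
  assumes "clears F A" "clears F' A'" shows "clears (F * F') (A * A')"
proof -
  interpret comm_ring_hom "\<lambda>G. eval4 const2 G 1 varx 1 vary"
    by (intro comm_ring_hom_eval4 comm_ring_hom_const2)
  from assms obtain N M G N' M' G' where
    1: "F * to_fract X0 ^ N * to_fract Y0 ^ M = to_fract G" "eval4 const2 G 1 varx 1 vary = A" and
    2: "F' * to_fract X0 ^ N' * to_fract Y0 ^ M' = to_fract G'" "eval4 const2 G' 1 varx 1 vary = A'"
    unfolding clears_def by blast
  have "(F * F') * to_fract X0 ^ (N + N') * to_fract Y0 ^ (M + M')
      = (F * to_fract X0 ^ N * to_fract Y0 ^ M) * (F' * to_fract X0 ^ N' * to_fract Y0 ^ M')"
    by (simp add: power_add algebra_simps)
  also have "\<dots> = to_fract (G * G')"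
    unfolding 1 2 by simp
  finally show ?thesis unfolding clears_def using 1 2
    by (intro exI[of _ "N + N'"] exI[of _ "M + M'"] exI[of _ "G * G'"])
       (simp add: hom_distribs)
qed

lemma X0_Y0_nonzero [simp]: "X0 \<noteq> 0" "Y0 \<noteq> 0"
  by (auto simp: X0_def Y0_def)

lemma clears_const: "clears (to_fract (const4 c)) (const2 c)"
  unfolding clears_def by (intro exI[of _ 0] exI[of _ "const4 c"]) simp

lemma clears_x: "clears (to_fract X1 / to_fract X0) varx"
  unfolding clears_def by (rule exI[of _ 1], rule exI[of _ 0], rule exI[of _ X1]) simp

lemma clears_y: "clears (to_fract X0 ^ \<delta> * to_fract Y1 / to_fract Y0) vary"
proof -
  interpret comm_ring_hom "\<lambda>G. eval4 const2 G 1 varx 1 vary"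
    by (intro comm_ring_hom_eval4 comm_ring_hom_const2)
  show ?thesis unfolding clears_def
    by (rule exI[of _ 0], rule exI[of _ 1], rule exI[of _ "X0 ^ \<delta> * Y1"])
       (simp add: hom_distribs)
qed

lemma eval_poly_pCons':
  assumes "comm_ring_hom h"
  shows "eval_poly h (pCons a p) x = h a + x * eval_poly h p x"
proof -
  interpret comm_ring_hom h by fact
  show ?thesis by (simp add: eval_poly_def Polynomial.map_poly_pCons[where f = h, OF hom_zero])
qed

lemma clears_eval2:
  "clears (eval2 (\<lambda>c. to_fract (const4 c)) A
     (to_fract X1 / to_fract X0) (to_fract X0 ^ \<delta> * to_fract Y1 / to_fract Y0)) A"
proof -
  interpret comm_ring_hom const4 by (rule comm_ring_hom_const4)
  have h: "comm_ring_hom (\<lambda>c. to_fract (const4 c))"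
    by standard (simp_all add: hom_distribs)
  define u where "u = to_fract X1 / to_fract X0"
  define v where "v = to_fract X0 ^ \<delta> * to_fract Y1 / to_fract Y0"
  note pC = eval_poly_pCons'[OF h] eval_poly_pCons'[OF comm_ring_hom_eval_poly[OF h]]
  have inner: "clears (eval_poly (\<lambda>c. to_fract (const4 c)) q u) [:q:]" for q
  proof (induction q)
    case 0
    show ?case using clears_const[of 0] by (simp add: eval_poly_def const2_def const4_def)
  next
    case (pCons c q)
    have "[:pCons c q:] = const2 c + varx * [:q:]"
      by (simp add: const2_def varx_def)
    with clears_add[OF clears_const clears_mult[OF clears_x pCons.IH]] show ?case
      by (simp add: pC u_def)
  qed
  show ?thesis unfolding eval2_def u_def[symmetric] v_def[symmetric]
  proof (induction A)
    case 0
    show ?case using clears_const[of 0] by (simp add: eval_poly_def const2_def const4_def)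
  next
    case (pCons q A)
    have "[:q:] + vary * A = pCons q A" by (simp add: vary_def)
    with clears_add[OF inner clears_mult[OF clears_y pCons.IH[unfolded v_def]], of q \<delta>]
    show ?case by (simp only: pC v_def)
  qed
qed

lemma homogenizes_exists:
  assumes "A \<noteq> 0"
  shows "\<exists>A' \<alpha>\<^sub>1 \<alpha>\<^sub>2. homogenizes \<delta> A A' \<alpha>\<^sub>1 \<alpha>\<^sub>2"
proof -
  interpret comm_ring_hom "\<lambda>G. eval4 const2 G 1 varx 1 vary"
    by (intro comm_ring_hom_eval4 comm_ring_hom_const2)
  define F where "F = eval2 (\<lambda>c. to_fract (const4 c)) A
     (to_fract X1 / to_fract X0) (to_fract X0 ^ \<delta> * to_fract Y1 / to_fract Y0)"
  obtain N M G where G: "F * to_fract X0 ^ N * to_fract Y0 ^ M = to_fract G"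
      "eval4 const2 G 1 varx 1 vary = A"
    using clears_eval2[of A \<delta>] unfolding clears_def F_def by blast
  have "G \<noteq> 0" using G(2) assms hom_zero by auto
  moreover have "\<not> is_unit X0" "\<not> is_unit Y0"
    using prime_X0 prime_Y0 by (auto simp: prime_elem_def)
  ultimately obtain G1 where G1: "G = X0 ^ multiplicity X0 G * G1" "\<not> X0 dvd G1"
    using multiplicity_decompose'[of G X0] by blast
  have "G1 \<noteq> 0" using G1(2) by auto
  then obtain G2 where G2: "G1 = Y0 ^ multiplicity Y0 G1 * G2" "\<not> Y0 dvd G2"
    using multiplicity_decompose'[of G1 Y0] \<open>\<not> is_unit Y0\<close> by blast
  define k l where "k = multiplicity X0 G" and "l = multiplicity Y0 G1"
  have X: "\<not> X0 dvd G2" using G1(2) G2(1) by (metis dvd_mult)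
  have "F * to_fract X0 ^ N * to_fract Y0 ^ M = to_fract X0 ^ k * to_fract Y0 ^ l * to_fract G2"
    using G(1) G1(1)[folded k_def] G2(1)[folded l_def]
    by (metis to_fract_mult to_fract_power mult.assoc)
  hence "F = to_fract G2 / (to_fract X0 powi (int N - int k) * to_fract Y0 powi (int M - int l))"
    by (simp add: power_int_diff divide_simps mult_ac)
  thus ?thesis unfolding homogenizes_def F_def[symmetric] using X G2(2) by blast
qed

lemma not_dvd_power_mult:
  assumes "prime_elem (p :: poly4)" "\<not> p dvd q" "prime_elem q" "\<not> p dvd A" "i < j"
    "p ^ i * q ^ k * A' = p ^ j * q ^ l * A"
  shows "p dvd A'"
proof -
  obtain d where d: "j = i + Suc d" using \<open>i < j\<close> by (metis add_Suc_right less_iff_Suc_add)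
  have "p ^ i * (q ^ k * A') = p ^ i * (p ^ Suc d * q ^ l * A)"
    using assms(6) unfolding d by (simp add: power_add mult_ac)
  hence "q ^ k * A' = p ^ Suc d * q ^ l * A"
    using assms(1) by (auto simp: prime_elem_def)
  hence "p dvd q ^ k * A'" by (simp add: mult_ac)
  thus ?thesis
    using assms(1,2) prime_elem_dvd_power by (auto simp: prime_elem_dvd_mult_iff)
qed

lemma homogenizes_unique:
  assumes "homogenizes \<delta> A A' \<alpha>\<^sub>1 \<alpha>\<^sub>2" "homogenizes \<delta> A A'' \<beta>\<^sub>1 \<beta>\<^sub>2"
  shows "A' = A'' \<and> \<alpha>\<^sub>1 = \<beta>\<^sub>1 \<and> \<alpha>\<^sub>2 = \<beta>\<^sub>2"
proof -
  define N where "N = max \<bar>\<alpha>\<^sub>1\<bar> \<bar>\<beta>\<^sub>1\<bar>"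
  define M where "M = max \<bar>\<alpha>\<^sub>2\<bar> \<bar>\<beta>\<^sub>2\<bar>"
  have nn: "N + \<alpha>\<^sub>1 \<ge> 0" "N + \<beta>\<^sub>1 \<ge> 0" "M + \<alpha>\<^sub>2 \<ge> 0" "M + \<beta>\<^sub>2 \<ge> 0"
    unfolding N_def M_def by auto
  have pw: "x ^ nat k = x powi k" if "k \<ge> 0" for x :: "poly4 fract" and k
    using that by (simp add: power_int_def)
  have "to_fract A' / (to_fract X0 powi \<alpha>\<^sub>1 * to_fract Y0 powi \<alpha>\<^sub>2)
      = to_fract A'' / (to_fract X0 powi \<beta>\<^sub>1 * to_fract Y0 powi \<beta>\<^sub>2)"
    using assms unfolding homogenizes_def by argo
  hence "to_fract (X0 ^ nat (N + \<beta>\<^sub>1) * Y0 ^ nat (M + \<beta>\<^sub>2) * A')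
       = to_fract (X0 ^ nat (N + \<alpha>\<^sub>1) * Y0 ^ nat (M + \<alpha>\<^sub>2) * A'')"
    by (simp add: pw nn power_int_add divide_simps mult_ac)
  hence eq: "X0 ^ nat (N + \<beta>\<^sub>1) * Y0 ^ nat (M + \<beta>\<^sub>2) * A'
       = X0 ^ nat (N + \<alpha>\<^sub>1) * Y0 ^ nat (M + \<alpha>\<^sub>2) * A''"
    by (simp only: to_fract_eq_iff)
  hence eq': "Y0 ^ nat (M + \<beta>\<^sub>2) * X0 ^ nat (N + \<beta>\<^sub>1) * A'
       = Y0 ^ nat (M + \<alpha>\<^sub>2) * X0 ^ nat (N + \<alpha>\<^sub>1) * A''"
    by (simp add: mult_ac)
  have nd: "\<not> X0 dvd A'" "\<not> Y0 dvd A'" "\<not> X0 dvd A''" "\<not> Y0 dvd A''"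
    using assms unfolding homogenizes_def by auto
  note X = not_dvd_power_mult[OF prime_X0 not_X0_dvd_Y0 prime_Y0]
  note Y = not_dvd_power_mult[OF prime_Y0 not_Y0_dvd_X0 prime_X0]
  have "\<not> nat (N + \<beta>\<^sub>1) < nat (N + \<alpha>\<^sub>1)" "\<not> nat (N + \<alpha>\<^sub>1) < nat (N + \<beta>\<^sub>1)"
       "\<not> nat (M + \<beta>\<^sub>2) < nat (M + \<alpha>\<^sub>2)" "\<not> nat (M + \<alpha>\<^sub>2) < nat (M + \<beta>\<^sub>2)"
    using X[OF nd(3) _ eq] X[OF nd(1) _ eq[symmetric]] Y[OF nd(4) _ eq'] Y[OF nd(2) _ eq'[symmetric]]
      nd by blast+
  hence *: "\<alpha>\<^sub>1 = \<beta>\<^sub>1" "\<alpha>\<^sub>2 = \<beta>\<^sub>2" using nn by linarith+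
  with eq show ?thesis by simp
qed

lemma is_extension_outputI:
  assumes "if A = 0 then A' = 0 \<and> \<alpha>\<^sub>1 - \<beta>\<^sub>1 + 1 + int \<delta> \<le> 0 \<and> \<alpha>\<^sub>2 - \<beta>\<^sub>2 - 1 \<le> 0
           else homogenizes \<delta> A A' \<alpha>\<^sub>1 \<alpha>\<^sub>2"
    and "if B = 0 then B' = 0 \<and> \<alpha>\<^sub>1 - \<beta>\<^sub>1 + 1 + int \<delta> > 0 \<and> \<alpha>\<^sub>2 - \<beta>\<^sub>2 - 1 > 0
           else homogenizes \<delta> B B' \<beta>\<^sub>1 \<beta>\<^sub>2"
  shows "is_extension_output \<delta> (A, B)
           (extension_steps \<delta> (\<alpha>\<^sub>1 - \<beta>\<^sub>1 + 1 + int \<delta>) (\<alpha>\<^sub>2 - \<beta>\<^sub>2 - 1) A' B')"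
  unfolding is_extension_output_def prod.case using assms by blast

lemma is_extension_output_unique:
  assumes "coprime A B"
  shows "\<exists>!out. is_extension_output \<delta> (A, B) out"
proof -
  have nz: "A \<noteq> 0 \<or> B \<noteq> 0" using assms by auto
  have A0: "extension_steps \<delta> m m' 0 C = extension_steps \<delta> 0 0 0 C" if "m \<le> 0" "m' \<le> 0" for m m' C
    using that by (simp add: extension_steps_def)
  have B0: "extension_steps \<delta> m m' C 0 = extension_steps \<delta> 1 1 C 0" if "m > 0" "m' > 0" for m m' C
    using that by (simp add: extension_steps_def)
  consider "A = 0" "B \<noteq> 0" | "A \<noteq> 0" "B = 0" | "A \<noteq> 0" "B \<noteq> 0" using nz by blast
  thus ?thesis
  proof cases
    case 1
    obtain B' \<beta>\<^sub>1 \<beta>\<^sub>2 where B': "homogenizes \<delta> B B' \<beta>\<^sub>1 \<beta>\<^sub>2" using homogenizes_exists[OF 1(2)] by blast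
    show ?thesis
    proof (rule ex1I[of _ "extension_steps \<delta> 0 0 0 B'"])
      show "is_extension_output \<delta> (A, B) (extension_steps \<delta> 0 0 0 B')"
        using is_extension_outputI[of A 0 "\<beta>\<^sub>1 - 1 - int \<delta>" \<beta>\<^sub>1 \<delta> "\<beta>\<^sub>2 + 1" \<beta>\<^sub>2 B B'] B' 1 by simp
    next
      fix out assume "is_extension_output \<delta> (A, B) out"
      then obtain B'' \<gamma>\<^sub>1 \<gamma>\<^sub>2 \<alpha>\<^sub>1 \<alpha>\<^sub>2 where o: "homogenizes \<delta> B B'' \<gamma>\<^sub>1 \<gamma>\<^sub>2"
          "\<alpha>\<^sub>1 - \<gamma>\<^sub>1 + 1 + int \<delta> \<le> 0" "\<alpha>\<^sub>2 - \<gamma>\<^sub>2 - 1 \<le> 0"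
          "out = extension_steps \<delta> (\<alpha>\<^sub>1 - \<gamma>\<^sub>1 + 1 + int \<delta>) (\<alpha>\<^sub>2 - \<gamma>\<^sub>2 - 1) 0 B''"
        unfolding is_extension_output_def using 1 by force
      have "B'' = B'" using homogenizes_unique[OF o(1) B'] by blast
      thus "out = extension_steps \<delta> 0 0 0 B'" using o A0[OF o(2,3)] by simp
    qed
  next
    case 2
    obtain A' \<alpha>\<^sub>1 \<alpha>\<^sub>2 where A': "homogenizes \<delta> A A' \<alpha>\<^sub>1 \<alpha>\<^sub>2" using homogenizes_exists[OF 2(1)] by blast
    show ?thesis
    proof (rule ex1I[of _ "extension_steps \<delta> 1 1 A' 0"])
      show "is_extension_output \<delta> (A, B) (extension_steps \<delta> 1 1 A' 0)"
        using is_extension_outputI[of A A' \<alpha>\<^sub>1 "\<alpha>\<^sub>1 + int \<delta>" \<delta> \<alpha>\<^sub>2 "\<alpha>\<^sub>2 - 2" B 0] A' 2 by simp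
    next
      fix out assume "is_extension_output \<delta> (A, B) out"
      then obtain A'' \<gamma>\<^sub>1 \<gamma>\<^sub>2 \<beta>\<^sub>1 \<beta>\<^sub>2 where o: "homogenizes \<delta> A A'' \<gamma>\<^sub>1 \<gamma>\<^sub>2"
          "\<gamma>\<^sub>1 - \<beta>\<^sub>1 + 1 + int \<delta> > 0" "\<gamma>\<^sub>2 - \<beta>\<^sub>2 - 1 > 0"
          "out = extension_steps \<delta> (\<gamma>\<^sub>1 - \<beta>\<^sub>1 + 1 + int \<delta>) (\<gamma>\<^sub>2 - \<beta>\<^sub>2 - 1) A'' 0"
        unfolding is_extension_output_def using 2 by force
      have "A'' = A'" using homogenizes_unique[OF o(1) A'] by blast
      thus "out = extension_steps \<delta> 1 1 A' 0" using o B0[OF o(2,3)] by simp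
    qed
  next
    case 3
    obtain A' \<alpha>\<^sub>1 \<alpha>\<^sub>2 where A': "homogenizes \<delta> A A' \<alpha>\<^sub>1 \<alpha>\<^sub>2" using homogenizes_exists[OF 3(1)] by blast
    obtain B' \<beta>\<^sub>1 \<beta>\<^sub>2 where B': "homogenizes \<delta> B B' \<beta>\<^sub>1 \<beta>\<^sub>2" using homogenizes_exists[OF 3(2)] by blast
    show ?thesis
    proof (rule ex1I[of _ "extension_steps \<delta> (\<alpha>\<^sub>1 - \<beta>\<^sub>1 + 1 + int \<delta>) (\<alpha>\<^sub>2 - \<beta>\<^sub>2 - 1) A' B'"])
      show "is_extension_output \<delta> (A, B)
              (extension_steps \<delta> (\<alpha>\<^sub>1 - \<beta>\<^sub>1 + 1 + int \<delta>) (\<alpha>\<^sub>2 - \<beta>\<^sub>2 - 1) A' B')"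
        using A' B' 3 by (intro is_extension_outputI) simp_all
    next
      fix out assume "is_extension_output \<delta> (A, B) out"
      with 3 obtain A'' \<gamma>\<^sub>1 \<gamma>\<^sub>2 B'' \<epsilon>\<^sub>1 \<epsilon>\<^sub>2 where o: "homogenizes \<delta> A A'' \<gamma>\<^sub>1 \<gamma>\<^sub>2" "homogenizes \<delta> B B'' \<epsilon>\<^sub>1 \<epsilon>\<^sub>2"
          "out = extension_steps \<delta> (\<gamma>\<^sub>1 - \<epsilon>\<^sub>1 + 1 + int \<delta>) (\<gamma>\<^sub>2 - \<epsilon>\<^sub>2 - 1) A'' B''"
        unfolding is_extension_output_def by auto
      thus "out = extension_steps \<delta> (\<alpha>\<^sub>1 - \<beta>\<^sub>1 + 1 + int \<delta>) (\<alpha>\<^sub>2 - \<beta>\<^sub>2 - 1) A' B'"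
        using homogenizes_unique[OF o(1) A'] homogenizes_unique[OF o(2) B'] by simp
    qed
  qed
qed

lemma is_extension_output_extension:
  "coprime A B \<Longrightarrow> is_extension_output \<delta> (A, B) (extension \<delta> (A, B))"
  unfolding extension_def by (rule theI') (rule is_extension_output_unique)

end

theory Submission
  imports Defs
begin

text \<open>
  Let \<open>f = g/h\<close> be a rational first integral with coprime \<open>g\<close>, \<open>h\<close>. A point is a dicritical
  singularity if and only if \<open>f\<close> is indeterminate there, that is \<open>g = h = 0\<close>. In one direction, a
  function defined at a point stays defined after blowups, and it is constant on the exceptional
  divisors, which is impossible at a terminal dicritical point. In the other direction, an
  indeterminacy point is neither nonsingular (the ideal \<open>(g, h)\<close> is invariant under the vector field)
  nor simple (restriction to the two formal separatrices shows that the cofactor of \<open>g\<close> and \<open>h\<close> takes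
  the value \<open>m \<mu> = n \<nu>\<close> for the two eigenvalues and some \<open>m, n \<ge> 1\<close>); if it is not terminal
  dicritical, then there is an indeterminacy point over it where the colength of the ideal is smaller.

  In the charts at infinity \<open>f\<close> is \<open>f (1/x, x\<^sup>\<delta> y)\<close> and \<open>f (1/x, x\<^sup>\<delta> / y)\<close>, so that passing from \<open>\<delta>\<close>
  to \<open>\<delta> + 1\<close> blows up the origin of the first one. For large \<open>\<delta>\<close> the origin is no indeterminacy point.
  Once this holds, \<open>f\<close> is defined and constant on the line \<open>x = 0\<close> of the following first charts. As
  \<open>f\<close> depends on \<open>y\<close>, its restriction to nearby vertical lines has positive degree, so it is
  indeterminate at the remaining point of the line, the origin of the second chart.
\<close>

subsection \<open>Substitution\<close>

text \<open>Neither local rings nor formal power series occur. The colength at the origin is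
  measured by polynomials modulo the ideal and modulo order \<open>N\<close>; a formal separatrix is
  replaced by a polynomial curve that is invariant modulo s^N. This suffices because the ideal of a
  coprime pair contains a nonzero polynomial r(x) in x alone and a nonzero s(y) in y alone. These
  two bound the colength, bound the order to which g and h can both vanish along a curve (hence the
  \<open>N\<close> to which the curve is computed), and show that a common factor created by a
  blowup can only be a power of the exceptional divisor. The definition of a dicritical singularity
  wants ordinary points all the way up to a terminal dicritical one. Hence one follows a chain of
  indeterminacy points: each is ordinary, and the colength bounds the length of the chain. The
  excluded fields are those with a = 0. Otherwise the coefficient of dy is nonzero, and a first
  integral independent of y would be constant.\<close>

definition subst2 :: "poly2 \<Rightarrow> poly2 \<Rightarrow> poly2 \<Rightarrow> poly2" where
  "subst2 u v p = eval2 const2 p u v"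

text \<open>Used to check identities between homomorphisms and derivations on the constants and the
  two variables, without nested coefficients.\<close>

lemma poly2_induct [case_names const varx vary add mult]:
  assumes "\<And>c. P (const2 c)" "P varx" "P vary"
    and "\<And>p q. P p \<Longrightarrow> P q \<Longrightarrow> P (p + q)" "\<And>p q. P p \<Longrightarrow> P q \<Longrightarrow> P (p * q)"
  shows "P p"
proof -
  have inner: "P [:q:]" for q
  proof (induction q)
    case 0
    show ?case using assms(1)[of 0] by (simp add: const2_def)
  next
    case (pCons c q)
    have "[:pCons c q:] = const2 c + varx * [:q:]" by (simp add: const2_def varx_def)
    thus ?case using assms pCons.IH by metis
  qed
  show ?thesis
  proof (induction p)
    case 0
    show ?case using inner[of 0] by simp
  next
    case (pCons q p)
    have "pCons q p = [:q:] + vary * p" by (simp add: vary_def)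
    thus ?case using assms inner pCons.IH by metis
  qed
qed

lemma eval_poly_const:
  assumes "comm_ring_hom h" shows "eval_poly h [:c:] x = h c"
proof -
  interpret comm_ring_hom h by fact
  show ?thesis by (cases "c = 0") (simp_all add: eval_poly_def map_poly_pCons)
qed

lemma eval2_const2:
  assumes "comm_ring_hom h" shows "eval2 h (const2 c) x y = h c"
  using assms by (simp add: eval2_def const2_def eval_poly_const comm_ring_hom_eval_poly)

lemma eval2_varx:
  assumes "comm_ring_hom h" shows "eval2 h varx x y = x"
proof -
  interpret comm_ring_hom h by fact
  show ?thesis using assms
    by (simp add: eval2_def varx_def eval_poly_const comm_ring_hom_eval_poly eval_poly_pCons')
       (simp add: eval_poly_def)
qed

lemma eval2_vary:
  assumes "comm_ring_hom h" shows "eval2 h vary x y = y"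
proof -
  interpret comm_ring_hom h by fact
  interpret e: comm_ring_hom "\<lambda>q. eval_poly h q x" using assms by (rule comm_ring_hom_eval_poly)
  show ?thesis
    by (simp add: eval2_def vary_def eval_poly_const comm_ring_hom_eval_poly eval_poly_pCons'[OF e.comm_ring_hom_axioms])
qed

lemma eval2_comp:
  assumes "comm_ring_hom h" "comm_ring_hom k" "\<And>c. k (h c) = h' c" "comm_ring_hom h'"
  shows "k (eval2 h p x y) = eval2 h' p (k x) (k y)"
proof -
  interpret k: comm_ring_hom k by fact
  interpret e: comm_ring_hom "\<lambda>p. eval2 h p x y" using assms by (intro comm_ring_hom_eval2)
  interpret e': comm_ring_hom "\<lambda>p. eval2 h' p (k x) (k y)" using assms by (intro comm_ring_hom_eval2)
  show ?thesis
    by (induction p rule: poly2_induct)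
       (simp_all add: e.hom_add e.hom_mult e'.hom_add e'.hom_mult k.hom_add k.hom_mult
          eval2_const2 eval2_varx eval2_vary assms)
qed

lemma comm_ring_hom_subst2: "comm_ring_hom (subst2 u v)"
  unfolding subst2_def[abs_def] by (intro comm_ring_hom_eval2 comm_ring_hom_const2)

interpretation subst2: comm_ring_hom "subst2 u v" for u v
  by (rule comm_ring_hom_subst2)

interpretation const2: comm_ring_hom const2
  by (rule comm_ring_hom_const2)

lemma subst2_const2 [simp]: "subst2 u v (const2 c) = const2 c"
  and subst2_varx [simp]: "subst2 u v varx = u"
  and subst2_vary [simp]: "subst2 u v vary = v"
  by (simp_all add: subst2_def eval2_const2 eval2_varx eval2_vary comm_ring_hom_const2)

lemmas subst2_hom = subst2.hom_add subst2.hom_mult subst2.hom_minus subst2.hom_uminus subst2.hom_power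

lemma subst2_subst2: "subst2 c d (subst2 a b p) = subst2 (subst2 c d a) (subst2 c d b) p"
  by (induction p rule: poly2_induct) (simp_all add: subst2_hom)

lemma subst2_id [simp]: "subst2 varx vary p = p"
  by (induction p rule: poly2_induct) (simp_all add: subst2_hom)

lemma eval2_subst2:
  assumes "comm_ring_hom h"
  shows "eval2 h (subst2 u v p) x y = eval2 h p (eval2 h u x y) (eval2 h v x y)"
proof -
  interpret e: comm_ring_hom "\<lambda>p. eval2 h p x y" using assms by (intro comm_ring_hom_eval2)
  interpret e': comm_ring_hom "\<lambda>p. eval2 h p (eval2 h u x y) (eval2 h v x y)"
    using assms by (intro comm_ring_hom_eval2)
  show ?thesis
    by (induction p rule: poly2_induct)
       (simp_all add: subst2_hom e.hom_add e.hom_mult e'.hom_add e'.hom_mult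
          eval2_const2 eval2_varx eval2_vary assms)
qed

lemma dx_simps [simp]: "dx (const2 c) = 0" "dx varx = 1" "dx vary = 0"
  by (auto intro!: poly_eqI simp: dx_def coeff_map_poly const2_def varx_def vary_def coeff_pCons pderiv_pCons
        split: nat.splits)

lemma dy_simps [simp]: "dy (const2 c) = 0" "dy varx = 0" "dy vary = 1"
  by (simp_all add: dy_def const2_def varx_def vary_def pderiv_pCons one_pCons)

lemma dy_add: "dy (p + q) = dy p + dy q"
  by (simp add: dy_def pderiv_add)

text \<open>The target ring is arbitrary because the rule is needed for substitutions in
  \<open>poly2\<close>, along polynomial curves, and for rational functions.\<close>

lemma chain_rule_general:
  fixes h :: "complex \<Rightarrow> 'r::comm_ring_1" and D :: "'r \<Rightarrow> 'r"
  assumes h: "comm_ring_hom h" and c: "\<And>c. D (h c) = 0"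
    and a: "\<And>p q. D (p + q) = D p + D q" and m: "\<And>p q. D (p * q) = D p * q + p * D q"
  shows "D (eval2 h p u v) = eval2 h (dx p) u v * D u + eval2 h (dy p) u v * D v"
proof -
  interpret e: comm_ring_hom "\<lambda>p. eval2 h p u v" using h by (intro comm_ring_hom_eval2)
  show ?thesis
    by (induction p rule: poly2_induct)
       (simp_all add: e.hom_add e.hom_mult a m c dx_add dx_mult dy_add dy_mult
          eval2_const2 eval2_varx eval2_vary h algebra_simps)
qed

lemma dx_subst2: "dx (subst2 u v p) = subst2 u v (dx p) * dx u + subst2 u v (dy p) * dx v"
  unfolding subst2_def
  by (rule chain_rule_general) (simp_all add: comm_ring_hom_const2 dx_add dx_mult)

lemma dy_subst2: "dy (subst2 u v p) = subst2 u v (dx p) * dy u + subst2 u v (dy p) * dy v"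
  unfolding subst2_def
  by (rule chain_rule_general) (simp_all add: comm_ring_hom_const2 dy_add dy_mult)

subsection \<open>Orders of vanishing\<close>

definition at0 :: "poly2 \<Rightarrow> complex" where
  "at0 p = coeff (coeff p 0) 0"

lemma comm_ring_hom_at0: "comm_ring_hom at0"
  by standard (simp_all add: at0_def coeff_mult)

interpretation at0: comm_ring_hom at0 by (rule comm_ring_hom_at0)

lemma at0_simps [simp]: "at0 varx = 0" "at0 vary = 0" "at0 (const2 c) = c"
  by (simp_all add: at0_def varx_def vary_def const2_def)

lemma at0_subst2: "at0 u = 0 \<Longrightarrow> at0 v = 0 \<Longrightarrow> at0 (subst2 u v p) = at0 p"
  by (induction p rule: poly2_induct) (simp_all add: subst2_hom at0.hom_add at0.hom_mult)

text \<open>Restriction to the line x = 0, as a polynomial in y. After a blowup this line is the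
  exceptional divisor.\<close>

definition restr :: "poly2 \<Rightarrow> complex poly" where
  "restr = map_poly (\<lambda>q. coeff q 0)"

lemma coeff_restr: "coeff (restr p) j = coeff (coeff p j) 0"
  by (simp add: restr_def coeff_map_poly)

interpretation restr: comm_ring_hom restr
  by standard (auto intro!: poly_eqI simp: coeff_restr coeff_mult coeff_sum)

lemma at0_restr: "at0 p = poly (restr p) 0"
  by (simp add: at0_def coeff_restr poly_0_coeff_0)

lemma varx_power: "varx ^ n = [:monom 1 n:]"
  by (induction n) (simp_all add: varx_def one_pCons monom_Suc)

lemma coeff_varx_power_mult: "coeff (coeff (varx ^ n * p) j) i = (if n \<le> i then coeff (coeff p j) (i - n) else 0)"
  by (simp add: varx_power coeff_monom_mult)

lemma varx_power_dvd_iff: "varx ^ n dvd p \<longleftrightarrow> (\<forall>j. \<forall>i<n. coeff (coeff p j) i = 0)"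
  by (simp add: varx_power const_poly_dvd_iff monom_1_dvd_iff')

lemma varx_dvd_iff: "varx dvd p \<longleftrightarrow> restr p = 0"
  using varx_power_dvd_iff[of 1 p] by (auto simp: poly_eq_iff coeff_restr)

lemma restr_simps [simp]: "restr varx = 0" "restr vary = [:0, 1:]" "restr (const2 c) = [:c:]"
  by (auto intro!: poly_eqI simp: coeff_restr varx_def vary_def const2_def coeff_pCons split: nat.splits)

lemma varx_nonzero [simp]: "varx \<noteq> 0" and vary_nonzero [simp]: "vary \<noteq> 0"
  by (simp_all add: varx_def vary_def)

lemma pderiv_restr: "restr (dy p) = pderiv (restr p)"
  by (rule poly_eqI) (simp add: coeff_restr dy_def coeff_pderiv coeff_mult of_nat_poly)

text \<open>Membership in the \<open>N\<close>-th power of the maximal ideal of the origin.\<close>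

definition ord_ge :: "nat \<Rightarrow> poly2 \<Rightarrow> bool" where
  "ord_ge N p \<longleftrightarrow> (\<forall>i j. i + j < N \<longrightarrow> coeff (coeff p j) i = 0)"

lemma ord_ge_0 [simp]: "ord_ge 0 p" "ord_ge N 0"
  by (simp_all add: ord_ge_def)

lemma ord_ge_varx_power: "varx ^ N dvd p \<Longrightarrow> ord_ge N p"
  by (auto simp: ord_ge_def varx_power_dvd_iff)

subsection \<open>Blowing up\<close>

definition blow :: "poly2 \<Rightarrow> poly2" where
  "blow = subst2 varx (varx * vary)"

interpretation blow: comm_ring_hom blow
  unfolding blow_def by (rule comm_ring_hom_subst2)

lemma coeff_vary_mult: "coeff (vary * p) j = (case j of 0 \<Rightarrow> 0 | Suc j \<Rightarrow> coeff p j)"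
  by (simp add: vary_def coeff_pCons split: nat.splits)

text \<open>The monomial x^i y^j becomes x^(i + j) y^j, so total degree turns into degree in x.
  Hence orders at the origin become divisibility by powers of x.\<close>

lemma coeff_blow: "coeff (blow p) j = monom 1 j * coeff p j"
proof (induction p arbitrary: j)
  case 0
  show ?case by simp
next
  case (pCons q p)
  have 1: "subst2 u v [:q:] = eval_poly const2 q u" for u v q
    by (simp add: subst2_def eval2_def eval_poly_const comm_ring_hom_eval_poly comm_ring_hom_const2)
  have 2: "eval_poly const2 q varx = [:q:]" for q
    using 1[of varx vary q] by simp
  have "pCons q p = [:q:] + vary * p" by (simp add: vary_def)
  hence "blow (pCons q p) = [:q:] + varx * (vary * blow p)"
    by (simp add: blow.hom_add blow.hom_mult) (simp add: blow_def 1 2)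
  thus ?case
    by (simp add: coeff_pCons coeff_vary_mult pCons.IH varx_def monom_Suc monom_0 one_pCons split: nat.splits)
qed

lemma coeff_coeff_blow: "coeff (coeff (blow p) j) i = (if j \<le> i then coeff (coeff p j) (i - j) else 0)"
  by (simp add: coeff_blow coeff_monom_mult)

lemma blow_eq_0_iff [simp]: "blow p = 0 \<longleftrightarrow> p = 0"
  unfolding poly_eq_iff[of "blow p"] poly_eq_iff[of p] by (simp add: coeff_blow)

lemma varx_power_dvd_blow_iff: "varx ^ N dvd blow p \<longleftrightarrow> ord_ge N p"
proof
  assume "varx ^ N dvd blow p"
  hence *: "coeff (coeff (blow p) j) i = 0" if "i < N" for i j
    using that by (simp add: varx_power_dvd_iff)
  show "ord_ge N p" unfolding ord_ge_def
  proof (intro allI impI)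
    fix i j assume "i + j < N"
    thus "coeff (coeff p j) i = 0" using *[of "i + j" j] by (simp add: coeff_coeff_blow)
  qed
qed (auto simp: varx_power_dvd_iff ord_ge_def coeff_coeff_blow)

definition shifty :: "complex \<Rightarrow> poly2 \<Rightarrow> poly2" where
  "shifty t = subst2 varx (vary + const2 t)"

interpretation shifty: comm_ring_hom "shifty t" for t
  unfolding shifty_def by (rule comm_ring_hom_subst2)

lemma shifty_shifty: "shifty s (shifty t p) = shifty (s + t) p"
  by (simp add: shifty_def subst2_subst2 subst2_hom const2.hom_add algebra_simps)

lemma shifty_0 [simp]: "shifty 0 p = p"
  by (simp add: shifty_def)

lemma shifty_eq_0_iff [simp]: "shifty t p = 0 \<longleftrightarrow> p = 0"
  using shifty_shifty[of "-t" t p] by auto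

lemma shifty_simps [simp]: "shifty t varx = varx" "shifty t vary = vary + const2 t" "shifty t (const2 c) = const2 c"
  by (simp_all add: shifty_def)

lemma restr_shifty: "restr (shifty t p) = pcompose (restr p) [:t, 1:]"
  by (induction p rule: poly2_induct)
     (simp_all add: shifty.hom_add shifty.hom_mult restr.hom_add restr.hom_mult pcompose_add pcompose_mult pcompose_pCons)

definition blowt :: "complex \<Rightarrow> poly2 \<Rightarrow> poly2" where
  "blowt t = subst2 varx (varx * (vary + const2 t))"

lemma blowt_shifty: "blowt t p = shifty t (blow p)"
  by (simp add: blowt_def shifty_def blow_def subst2_subst2 subst2_hom)

interpretation blowt: comm_ring_hom "blowt t" for t
  unfolding blowt_def by (rule comm_ring_hom_subst2)

lemma blowt_simps [simp]: "blowt t varx = varx" "blowt t vary = varx * (vary + const2 t)"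
  "blowt t (const2 c) = const2 c" "blowt t p = 0 \<longleftrightarrow> p = 0"
  by (simp_all add: blowt_def) (simp add: blowt_shifty flip: blowt_def)

text \<open>The second chart of a blowup is the first one conjugated by this exchange
  (\<open>subst2_chart_None\<close>), so only the first chart has to be studied.\<close>

definition swp :: "poly2 \<Rightarrow> poly2" where "swp = subst2 vary varx"

interpretation swp: comm_ring_hom swp
  unfolding swp_def by (rule comm_ring_hom_subst2)

lemma swp_swp [simp]: "swp (swp p) = p"
  by (simp add: swp_def subst2_subst2)

lemma swp_simps [simp]: "swp varx = vary" "swp vary = varx" "swp (const2 c) = const2 c"
  by (simp_all add: swp_def)

lemma swp_eq_0_iff [simp]: "swp p = 0 \<longleftrightarrow> p = 0"
  by (metis swp_swp swp.hom_zero)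

lemma dx_swp: "dx (swp p) = swp (dy p)" and dy_swp: "dy (swp p) = swp (dx p)"
  by (simp_all add: swp_def dx_subst2 dy_subst2)

lemma varx_mult: "varx * p = map_poly (\<lambda>q. pCons 0 q) p"
  by (rule poly_eqI) (simp add: varx_def coeff_map_poly)

lemma coeff_swp: "coeff (coeff (swp p) j) i = coeff (coeff p i) j"
proof (induction p arbitrary: i j)
  case 0
  show ?case by simp
next
  case (pCons q p)
  have 1: "coeff (coeff (swp [:q:]) j) i = coeff (coeff [:q:] i) j" for i j
  proof (induction q arbitrary: i j)
    case 0
    show ?case by simp
  next
    case (pCons c q)
    have "[:pCons c q:] = const2 c + varx * [:q:]" by (simp add: const2_def varx_def)
    hence "swp [:pCons c q:] = const2 c + vary * swp [:q:]" by (simp only: swp.hom_add swp.hom_mult swp_simps)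
    thus ?case using pCons.IH by (simp add: coeff_vary_mult const2_def coeff_pCons split: nat.splits)
  qed
  have "pCons q p = [:q:] + vary * p" by (simp add: vary_def)
  hence "swp (pCons q p) = swp [:q:] + varx * swp p" by (simp add: swp.hom_add swp.hom_mult)
  thus ?case using pCons.IH 1
    by (simp add: varx_mult coeff_map_poly) (simp add: coeff_pCons split: nat.splits)
qed

lemma ord_ge_swp: "ord_ge N (swp p) \<longleftrightarrow> ord_ge N p"
  by (auto simp: ord_ge_def coeff_swp add.commute)

lemma at0_swp [simp]: "at0 (swp p) = at0 p"
  by (simp add: at0_def coeff_swp)

lemma swp_dvd_iff: "swp p dvd swp q \<longleftrightarrow> p dvd q"
  by (metis dvd_def swp.hom_mult swp_swp)

lemma swp_coprime: "coprime (swp p) (swp q) \<longleftrightarrow> coprime p q"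
proof -
  have *: "coprime (swp p) (swp q)" if c: "coprime p q" for p q
  proof (rule coprimeI)
    fix d assume "d dvd swp p" "d dvd swp q"
    hence "swp d dvd p" "swp d dvd q" by (metis swp_dvd_iff swp_swp)+
    hence "is_unit (swp d)" using c coprime_common_divisor by blast
    thus "is_unit d" by (metis swp_dvd_iff swp.hom_one)
  qed
  show ?thesis using *[of p q] *[of "swp p" "swp q"] by auto
qed

subsection \<open>Coprime pairs and their ideals\<close>

definition idl :: "poly2 \<Rightarrow> poly2 \<Rightarrow> poly2 set" where
  "idl g h = {p. \<exists>U V. p = U * g + V * h}"

lemma idlI: "U * g + V * h \<in> idl g h"
  by (auto simp: idl_def)

lemma idl_gens [simp]: "g \<in> idl g h" "h \<in> idl g h"
  using idlI[of 1 g 0 h] idlI[of 0 g 1 h] by auto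

lemma idl_0 [simp]: "0 \<in> idl g h"
  using idlI[of 0 g 0 h] by simp

lemma idl_add: "p \<in> idl g h \<Longrightarrow> q \<in> idl g h \<Longrightarrow> p + q \<in> idl g h"
  unfolding idl_def by clarify (metis (no_types, opaque_lifting) add.assoc add.left_commute distrib_right)

lemma idl_mult: "p \<in> idl g h \<Longrightarrow> c * p \<in> idl g h"
  unfolding idl_def by clarify (metis (no_types, opaque_lifting) distrib_left mult.assoc)

lemma idl_diff: "p \<in> idl g h \<Longrightarrow> q \<in> idl g h \<Longrightarrow> p - q \<in> idl g h"
  using idl_add[of p g h "(-1) * q"] idl_mult[of q g h "-1"] by simp

lemma idl_sum: "(\<And>i. i \<in> I \<Longrightarrow> f i \<in> idl g h) \<Longrightarrow> sum f I \<in> idl g h"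
  by (induction I rule: infinite_finite_induct) (auto intro: idl_add)

lemma swp_idl: "p \<in> idl g h \<Longrightarrow> swp p \<in> idl (swp g) (swp h)"
  using idlI[of "swp _" "swp g" "swp _" "swp h"] by (auto simp: idl_def swp.hom_add swp.hom_mult)

text \<open>An ideal element d of least degree in y acts as a gcd over the field of fractions in x:
  by pseudo-division it divides g and h up to factors free of y. Since g and h are coprime, d
  divides the product of these factors, so it is free of y itself.\<close>

lemma coprime_eliminate_y:
  assumes "coprime g (h :: poly2)"
  obtains r where "r \<noteq> 0" "[:r:] \<in> idl g h"
proof -
  have "\<exists>p. p \<in> idl g h \<and> p \<noteq> 0"
    using assms idl_gens by (metis coprime_0_left_iff not_is_unit_0)
  then obtain d where d: "d \<in> idl g h" "d \<noteq> 0"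
    and min: "\<And>p. p \<in> idl g h \<Longrightarrow> p \<noteq> 0 \<Longrightarrow> degree d \<le> degree p"
    using ex_has_least_nat[of "\<lambda>p. p \<in> idl g h \<and> p \<noteq> 0" _ degree] by blast
  have dvd: "\<exists>c. c \<noteq> 0 \<and> d dvd [:c:] * p" if p: "p \<in> idl g h" for p
  proof -
    obtain q r where qr: "pseudo_divmod p d = (q, r)" by force
    define c where "c = coeff d (degree d) ^ (Suc (degree p) - degree d)"
    have "c \<noteq> 0" using d by (simp add: c_def)
    have *: "Polynomial.smult c p = d * q + r" "r = 0 \<or> degree r < degree d"
      using pseudo_divmod[OF d(2) qr] by (simp_all add: c_def)
    have "r = [:c:] * p - q * d" using *(1) by (simp add: algebra_simps)
    hence "r \<in> idl g h" using idl_diff[OF idl_mult[OF p] idl_mult[OF d(1)]] by metis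
    with min *(2) have "r = 0" by fastforce
    with * \<open>c \<noteq> 0\<close> show ?thesis by (intro exI[of _ c]) simp
  qed
  obtain c c' where c: "c \<noteq> 0" "d dvd [:c:] * g" "c' \<noteq> 0" "d dvd [:c':] * h"
    using dvd[of g] dvd[of h] by auto
  have "d dvd [:c * c':] * g" "d dvd [:c * c':] * h"
    using dvd_mult[OF c(2), of "[:c':]"] dvd_mult[OF c(4), of "[:c:]"] by (simp_all add: mult_ac)
  hence "d dvd gcd ([:c * c':] * g) ([:c * c':] * h)" by (rule gcd_greatest)
  moreover have "gcd g h = 1" using assms by simp
  ultimately have "d dvd normalize [:c * c':]" by (simp only: gcd_mult_left mult_1_right)
  hence "d dvd [:c * c':]" by simp
  hence "degree d \<le> degree [:c * c':]" by (rule dvd_imp_degree_le) (use c in simp)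
  then obtain r where "d = [:r:]" by (auto elim: degree_eq_zeroE)
  with d that show thesis by auto
qed

lemma coprime_eliminate_x:
  assumes "coprime g (h :: poly2)"
  obtains s where "s \<noteq> 0" "swp [:s:] \<in> idl g h"
proof -
  obtain s where "s \<noteq> 0" "[:s:] \<in> idl (swp g) (swp h)"
    using assms coprime_eliminate_y[of "swp g" "swp h"] by (auto simp: swp_coprime)
  with swp_idl[of "[:s:]" "swp g" "swp h"] that show thesis by auto
qed

lemma eval2_const_y:
  assumes "comm_ring_hom h" shows "eval2 h [:q:] x y = eval_poly h q x"
  using assms by (simp add: eval2_def eval_poly_const comm_ring_hom_eval_poly)

lemma subst2_const_y: "subst2 varx v [:q:] = [:q:]"
proof -
  have "subst2 u v [:q:] = eval_poly const2 q u" for u v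
    by (simp add: subst2_def eval2_const_y comm_ring_hom_const2)
  thus ?thesis by (metis subst2_id)
qed

lemma comm_ring_hom_pconst: "comm_ring_hom (\<lambda>c::complex. [:c:])"
  by standard (simp_all add: one_pCons)

lemma eval_poly_pconst: "eval_poly (\<lambda>c::complex. [:c:]) q z = pcompose q z"
  by (induction q)
     (simp_all add: eval_poly_pCons'[OF comm_ring_hom_pconst] pcompose_pCons, simp add: eval_poly_def)

lemma pcompose_pconst: "pcompose q [:c:] = [:poly q c:]"
  by (induction q) (simp_all add: pcompose_pCons mult.commute)

lemma eval2_pconst_subst2_swp:
  "eval2 (\<lambda>c. [:c:]) (subst2 u v (swp [:s:])) x y = pcompose s (eval2 (\<lambda>c. [:c:]) v x y)"
  by (simp add: swp_def subst2_subst2 eval2_subst2 eval2_const_y comm_ring_hom_pconst eval_poly_pconst)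

text \<open>A common factor d divides the transforms of all ideal elements. It divides r(x), so it
  depends on x only. It divides s(x (y + t)), so at a root c of d the polynomial s(c (y + t))
  vanishes, which forces c = 0. But then x would divide both g' and h'.\<close>

lemma coprime_blowt:
  assumes "coprime g h" and g: "blowt t g = varx ^ m * g'" and h: "blowt t h = varx ^ m * h'"
    and nd: "\<not> (varx dvd g' \<and> varx dvd h')"
  shows "coprime g' h'"
proof (rule coprimeI)
  fix d assume d: "d dvd g'" "d dvd h'"
  have dvd: "d dvd blowt t p" if "p \<in> idl g h" for p
    using that d g h by (auto simp: idl_def blowt.hom_add blowt.hom_mult)
  obtain r where r: "r \<noteq> 0" "[:r:] \<in> idl g h" using coprime_eliminate_y[OF assms(1)] .
  obtain s where s: "s \<noteq> 0" "swp [:s:] \<in> idl g h" using coprime_eliminate_x[OF assms(1)] .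
  have "d dvd [:r:]" using dvd[OF r(2)] by (simp add: blowt_def subst2_const_y)
  hence "degree d \<le> degree [:r:]" by (rule dvd_imp_degree_le) (use r in simp)
  then obtain d0 where d0: "d = [:d0:]" by (auto elim: degree_eq_zeroE)
  have "d0 \<noteq> 0" using \<open>d dvd [:r:]\<close> r d0 by auto
  have "poly d0 c \<noteq> 0" for c
  proof
    assume c: "poly d0 c = 0"
    let ?e = "\<lambda>p. eval2 (\<lambda>c. [:c:]) p [:c:] [:0, 1:]"
    interpret e: comm_ring_hom ?e by (intro comm_ring_hom_eval2 comm_ring_hom_pconst)
    have "?e d = [:poly d0 c:]"
      by (simp add: d0 eval2_const_y comm_ring_hom_pconst eval_poly_pconst pcompose_pconst)
    hence "?e (blowt t (swp [:s:])) = 0"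
      using dvd[OF s(2)] c by (auto simp: e.hom_mult elim!: dvdE)
    hence "pcompose s (?e (varx * (vary + const2 t))) = 0"
      by (simp add: blowt_def eval2_pconst_subst2_swp)
    hence "pcompose s [:c * t, c:] = 0"
      by (simp add: e.hom_mult e.hom_add eval2_varx eval2_vary eval2_const2 comm_ring_hom_pconst mult.commute)
    hence "c = 0" using s pcompose_eq_0[of s "[:c * t, c:]"] by (cases "c = 0") auto
    hence "[:0, 1:] dvd d0" using c by (simp add: poly_eq_0_iff_dvd)
    hence "varx dvd d" by (simp add: d0 varx_def const_poly_dvd)
    thus False using d nd dvd_trans by blast
  qed
  hence "degree d0 = 0"
    by (metis constant_degree fundamental_theorem_of_algebra)
  thus "is_unit d" using d0 \<open>d0 \<noteq> 0\<close> by (auto elim!: degree_eq_zeroE simp: is_unit_const_poly_iff)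
qed

subsection \<open>Colength\<close>

text \<open>More unknowns than equations, by elimination with a pivot. Indexed families allow
  repeated vectors.\<close>

lemma linear_dependence:
  fixes f :: "'i \<Rightarrow> 'k \<Rightarrow> 'a::field"
  assumes "finite K" "finite I" "card I > card K"
  shows "\<exists>c. (\<exists>i\<in>I. c i \<noteq> 0) \<and> (\<forall>k\<in>K. (\<Sum>i\<in>I. c i * f i k) = 0)"
  using assms
proof (induction K arbitrary: I f rule: finite_induct)
  case empty
  then obtain i where "i \<in> I" by (metis all_not_in_conv card.empty not_less_zero)
  thus ?case by (intro exI[of _ "\<lambda>_. 1"]) auto
next
  case (insert k K)
  show ?case
  proof (cases "\<exists>i\<in>I. f i k \<noteq> 0")
    case False
    moreover have "\<exists>c. (\<exists>i\<in>I. c i \<noteq> 0) \<and> (\<forall>k\<in>K. (\<Sum>i\<in>I. c i * f i k) = 0)"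
      by (rule insert.IH) (use insert in auto)
    then obtain c where "\<exists>i\<in>I. c i \<noteq> 0" "\<forall>k\<in>K. (\<Sum>i\<in>I. c i * f i k) = 0" by blast
    ultimately show ?thesis by (intro exI[of _ c]) auto
  next
    case True
    then obtain p where p: "p \<in> I" "f p k \<noteq> 0" by blast
    define f' where "f' i j = f i j - f i k / f p k * f p j" for i j
    have "\<exists>c. (\<exists>i\<in>I - {p}. c i \<noteq> 0) \<and> (\<forall>j\<in>K. (\<Sum>i\<in>I - {p}. c i * f' i j) = 0)"
      by (rule insert.IH) (use insert p in auto)
    then obtain c where c: "\<exists>i\<in>I - {p}. c i \<noteq> 0" "\<forall>j\<in>K. (\<Sum>i\<in>I - {p}. c i * f' i j) = 0" by blast
    define c' where "c' = c(p := - (\<Sum>i\<in>I - {p}. c i * f i k / f p k))"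
    have sum: "(\<Sum>i\<in>I. c' i * f i j) = (\<Sum>i\<in>I - {p}. c i * f' i j)" for j
    proof -
      have "(\<Sum>i\<in>I. c' i * f i j) = c' p * f p j + (\<Sum>i\<in>I - {p}. c' i * f i j)"
        using p insert by (simp add: sum.remove)
      also have "(\<Sum>i\<in>I - {p}. c' i * f i j) = (\<Sum>i\<in>I - {p}. c i * f i j)"
        by (intro sum.cong) (auto simp: c'_def)
      also have "c' p * f p j = - (\<Sum>i\<in>I - {p}. c i * (f i k / f p k * f p j))"
        by (simp add: c'_def sum_distrib_left mult_ac)
      finally show ?thesis by (simp add: f'_def algebra_simps sum_subtractf)
    qed
    have "(\<Sum>i\<in>I. c' i * f i j) = 0" if "j \<in> insert k K" for j
      using that c p by (auto simp: sum) (simp add: f'_def)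
    moreover have "\<exists>i\<in>I. c' i \<noteq> 0" using c by (auto simp: c'_def)
    ultimately show ?thesis by blast
  qed
qed

text \<open>
  There are \<open>n\<close> elements that are linearly independent modulo \<open>(g, h) + \<mm>\<^sup>N\<close>, where \<open>\<mm>\<close> is
  the maximal ideal of the origin: the colength of \<open>(g, h)\<close> at the origin is at least \<open>n\<close>.
\<close>

definition colength_ge :: "nat \<Rightarrow> poly2 \<Rightarrow> poly2 \<Rightarrow> bool" where
  "colength_ge n g h \<longleftrightarrow> (\<exists>ps N. \<forall>c.
     (\<exists>p\<in>idl g h. \<exists>e. ord_ge N e \<and> (\<Sum>i<n. const2 (c i) * ps i) = p + e) \<longrightarrow> (\<forall>i<n. c i = 0))"

lemma colength_ge_0 [simp]: "colength_ge 0 g h"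
  by (simp add: colength_ge_def)

lemma colength_ge_cong: "idl g h = idl g' h' \<Longrightarrow> colength_ge n g h = colength_ge n g' h'"
  by (simp add: colength_ge_def)

lemma colength_ge_swp:
  assumes "colength_ge n g h" shows "colength_ge n (swp g) (swp h)"
proof -
  obtain ps N where *: "\<And>c. (\<exists>p\<in>idl g h. \<exists>e. ord_ge N e \<and> (\<Sum>i<n. const2 (c i) * ps i) = p + e)
      \<Longrightarrow> (\<forall>i<n. c i = 0)"
    using assms unfolding colength_ge_def by blast
  show ?thesis unfolding colength_ge_def
  proof (intro exI[of _ "\<lambda>i. swp (ps i)"] exI[of _ N] allI impI, elim bexE exE conjE)
    fix c p e i assume a: "p \<in> idl (swp g) (swp h)" "ord_ge N e"
      "(\<Sum>i<n. const2 (c i) * swp (ps i)) = p + e" and "i < n"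
    have "(\<Sum>i<n. const2 (c i) * ps i) = swp (\<Sum>i<n. const2 (c i) * swp (ps i))"
      by (simp add: swp.hom_sum swp.hom_mult)
    also have "\<dots> = swp p + swp e" using a by (simp add: swp.hom_add)
    finally have "(\<Sum>i<n. const2 (c i) * ps i) = swp p + swp e" .
    moreover have "swp p \<in> idl g h" using swp_idl[OF a(1)] by simp
    ultimately show "c i = 0" using *[of c] a(2) \<open>i < n\<close> ord_ge_swp by blast
  qed
qed

text \<open>Division by r(x) and s(y) reduces every polynomial to the monomials x^i y^j with i <
  \<open>a\<close> and j < \<open>b\<close>. So among \<open>a * b + 1\<close> polynomials some
  nontrivial combination lies in the ideal itself, whatever \<open>N\<close> is.\<close>

lemma colength_bounded:
  assumes "coprime g (h :: poly2)"
  obtains n where "\<not> colength_ge n g h"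
proof -
  obtain r where r: "r \<noteq> 0" "[:r:] \<in> idl g h" using coprime_eliminate_y[OF assms] .
  obtain s where s: "s \<noteq> 0" "swp [:s:] \<in> idl g h" using coprime_eliminate_x[OF assms] .
  define a b where "a = degree r" and "b = degree s"
  have mod: "\<exists>p'. p - p' \<in> idl g h \<and> (\<forall>i j. i \<ge> a \<or> j \<ge> b \<longrightarrow> coeff (coeff p' j) i = 0)" for p
  proof -
    have high: "coeff (q mod u) i = 0" if "u \<noteq> 0" "i \<ge> degree u" for q u :: "complex poly" and i
      using that degree_mod_less[OF that(1), of q] by (auto intro: coeff_eq_0)
    have dm: "p = [:u:] * map_poly (\<lambda>q. q div u) p + map_poly (\<lambda>q. q mod u) p" for p :: poly2 and u
      by (rule poly_eqI) (simp add: coeff_map_poly)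
    define p1 where "p1 = map_poly (\<lambda>q. q mod r) p"
    define p2 where "p2 = map_poly (\<lambda>q. q mod s) (swp p1)"
    have "p - p1 = map_poly (\<lambda>q. q div r) p * [:r:]"
      using dm[of p r] by (simp add: p1_def algebra_simps)
    hence 1: "p - p1 \<in> idl g h" using idl_mult[OF r(2)] by metis
    have "swp p1 - p2 = map_poly (\<lambda>q. q div s) (swp p1) * [:s:]"
      using dm[of "swp p1" s] by (simp add: p2_def algebra_simps)
    hence "p1 - swp p2 = swp (map_poly (\<lambda>q. q div s) (swp p1)) * swp [:s:]"
      by (metis swp.hom_minus swp.hom_mult swp_swp)
    hence 2: "p1 - swp p2 \<in> idl g h" using idl_mult[OF s(2)] by metis
    have 3: "coeff (coeff (swp p2) j) i = 0" if "i \<ge> a \<or> j \<ge> b" for i j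
    proof (cases "j \<ge> b")
      case True
      thus ?thesis using s high by (simp add: coeff_swp p2_def coeff_map_poly b_def)
    next
      case False
      hence "i \<ge> a" using that by simp
      hence "coeff (swp p1) i = 0"
        using r high by (intro poly_eqI) (simp add: coeff_swp p1_def coeff_map_poly a_def)
      thus ?thesis by (simp add: coeff_swp p2_def coeff_map_poly)
    qed
    show ?thesis using idl_add[OF 1 2] 3 by (intro exI[of _ "swp p2"]) auto
  qed
  have "\<not> colength_ge (Suc (a * b)) g h"
  proof
    assume "colength_ge (Suc (a * b)) g h"
    then obtain ps N where *: "\<And>c. (\<exists>p\<in>idl g h. \<exists>e. ord_ge N e \<and> (\<Sum>i<Suc (a * b). const2 (c i) * ps i) = p + e)
        \<Longrightarrow> (\<forall>i<Suc (a * b). c i = 0)"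
      unfolding colength_ge_def by blast
    define rem where "rem i = (SOME p'. ps i - p' \<in> idl g h \<and>
        (\<forall>k j. k \<ge> a \<or> j \<ge> b \<longrightarrow> coeff (coeff p' j) k = 0))" for i
    have rem: "ps i - rem i \<in> idl g h" "k \<ge> a \<or> j \<ge> b \<Longrightarrow> coeff (coeff (rem i) j) k = 0" for i k j
      using someI_ex[OF mod[of "ps i"]] unfolding rem_def by blast+
    obtain c where c: "\<exists>i\<in>{..<Suc (a * b)}. c i \<noteq> 0"
      "\<forall>k\<in>{..<a} \<times> {..<b}. (\<Sum>i<Suc (a * b). c i * (case k of (k, j) \<Rightarrow> coeff (coeff (rem i) j) k)) = 0"
      using linear_dependence[of "{..<a} \<times> {..<b}" "{..<Suc (a * b)}"
          "\<lambda>i (k, j). coeff (coeff (rem i) j) k"] by auto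
    have "coeff (coeff (\<Sum>i<Suc (a * b). const2 (c i) * rem i) j) k = 0" for j k
    proof -
      have "coeff (coeff (\<Sum>i<Suc (a * b). const2 (c i) * rem i) j) k
          = (\<Sum>i<Suc (a * b). c i * coeff (coeff (rem i) j) k)"
        by (simp only: coeff_sum) (simp add: const2_def)
      also have "\<dots> = 0"
      proof (cases "k < a \<and> j < b")
        case True
        thus ?thesis using c(2)[rule_format, of "(k, j)"] by simp
      next
        case False
        hence "coeff (coeff (rem i) j) k = 0" for i by (intro rem(2)) auto
        thus ?thesis by (simp del: sum.lessThan_Suc)
      qed
      finally show ?thesis .
    qed
    hence "(\<Sum>i<Suc (a * b). const2 (c i) * rem i) = 0" by (intro poly_eqI) (simp del: sum.lessThan_Suc)
    hence "(\<Sum>i<Suc (a * b). const2 (c i) * ps i) = (\<Sum>i<Suc (a * b). const2 (c i) * (ps i - rem i)) + 0"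
      by (simp add: right_diff_distrib sum_subtractf del: sum.lessThan_Suc)
    moreover have "(\<Sum>i<Suc (a * b). const2 (c i) * (ps i - rem i)) \<in> idl g h"
      by (intro idl_sum idl_mult rem)
    ultimately have "\<forall>i<Suc (a * b). c i = 0" using *[of c] ord_ge_0(2) by blast
    thus False using c(1) by blast
  qed
  thus thesis using that by blast
qed

text \<open>The section of \<open>restr\<close> whose values are free of x.\<close>

definition emb :: "complex poly \<Rightarrow> poly2" where
  "emb = map_poly (\<lambda>c. [:c:])"

lemma coeff_emb: "coeff (emb q) j = [:coeff q j:]"
  by (simp add: emb_def coeff_map_poly)

lemma restr_emb [simp]: "restr (emb q) = q"
  by (rule poly_eqI) (simp add: coeff_restr coeff_emb)

lemma shifty_emb: "shifty t (emb q) = emb (pcompose q [:t, 1:])"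
proof -
  have 0: "emb 0 = 0" by (rule poly_eqI) (simp add: coeff_emb)
  have pC: "emb (pCons c q) = const2 c + vary * emb q" for c q
    by (rule poly_eqI) (simp add: coeff_emb const2_def coeff_vary_mult coeff_pCons split: nat.splits)
  have add: "emb (p + q) = emb p + emb q" for p q
    by (rule poly_eqI) (simp add: coeff_emb)
  have sm: "emb (Polynomial.smult c q) = const2 c * emb q" for c q
    by (rule poly_eqI) (simp add: coeff_emb const2_def)
  show ?thesis
    by (induction q)
       (simp_all add: 0 pC shifty.hom_add shifty.hom_mult pcompose_pCons add sm algebra_simps)
qed

text \<open>For j at most m, x^m y^j is the transform of x^(m - j) y^j under \<open>blow\<close>;
  the shift by \<open>t\<close> preserves the degree bound.\<close>

lemma blowt_onto_low_degree:
  assumes "degree q \<le> m" obtains p where "blowt t p = varx ^ m * emb q"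
proof -
  define q' where "q' = pcompose q [:-t, 1:]"
  have q': "coeff q' j = 0" if "j > m" for j
    using that assms by (intro coeff_eq_0) (simp add: q'_def degree_pcompose)
  have "pcompose q' [:t, 1:] = q"
    by (simp add: q'_def pcompose_assoc[symmetric] pcompose_pCons pcompose_idR)
  hence q: "emb q = shifty t (emb q')" by (simp add: shifty_emb)
  define p where "p = (\<Sum>j\<le>m. monom (monom (coeff q' j) (m - j)) j)"
  have cp: "coeff p j = (if j \<le> m then monom (coeff q' j) (m - j) else 0)" for j
    by (simp add: p_def coeff_sum)
  have "blow p = varx ^ m * emb q'"
    by (rule poly_eqI) (auto simp: coeff_blow cp varx_power coeff_emb mult_monom q' monom_0 smult_monom)
  hence "blowt t p = varx ^ m * emb q"
    by (simp add: blowt_shifty q shifty.hom_mult shifty.hom_power)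
  thus thesis using that by blast
qed

text \<open>
  Modulo \<open>x\<close> and \<open>g'\<close> every polynomial is congruent to one in \<open>y\<close> of degree at most \<open>m\<close>, and
  \<open>x\<^sup>m\<close> times such a polynomial is the transform of a polynomial under the blowup.
\<close>

lemma blowt_almost_onto:
  assumes "restr g' \<noteq> 0" "degree (restr g') \<le> m"
  shows "\<exists>q e. \<exists>j\<in>idl g' h'. varx ^ m * p = blowt t q + varx ^ m * j + varx ^ (m + N) * e"
proof (induction N)
  case 0
  show ?case by (rule exI[of _ 0], rule exI[of _ p], rule bexI[of _ 0]) simp_all
next
  case (Suc N)
  then obtain q e j where IH: "j \<in> idl g' h'" "varx ^ m * p = blowt t q + varx ^ m * j + varx ^ (m + N) * e"
    by blast
  define s where "s = restr e div restr g'"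
  define \<rho> where "\<rho> = restr e mod restr g'"
  have "restr e = s * restr g' + \<rho>" by (simp add: s_def \<rho>_def)
  hence "restr (e - emb s * g' - emb \<rho>) = 0" by (simp add: restr.hom_minus restr.hom_mult)
  then obtain e' where "e - emb s * g' - emb \<rho> = varx * e'" by (auto simp: varx_dvd_iff[symmetric])
  hence e': "e = emb s * g' + emb \<rho> + varx * e'" by (simp add: algebra_simps)
  have "degree \<rho> \<le> m"
    using assms degree_mod_less[of "restr g'" "restr e"] unfolding \<rho>_def by auto
  then obtain q' where q': "blowt t q' = varx ^ m * emb \<rho>" by (rule blowt_onto_low_degree)
  have "varx ^ m * p = blowt t (q + varx ^ N * q') + varx ^ m * (j + (varx ^ N * emb s) * g') + varx ^ (m + Suc N) * e'"
    unfolding IH(2) e'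
    by (simp add: blowt.hom_add blowt.hom_mult blowt.hom_power q' power_add algebra_simps)
  moreover have "j + (varx ^ N * emb s) * g' \<in> idl g' h'"
    by (intro idl_add idl_mult IH idl_gens)
  ultimately show ?case by blast
qed

text \<open>By \<open>blowt_almost_onto\<close>, each independent element upstairs, times x^m, is
  essentially the transform of some \<open>q i\<close>. A relation between the \<open>q i\<close>
  modulo the ideal transforms into one that can be divided by x^m, and so is trivial. The colength
  downstairs exceeds n because the constant 1 can be added to the family: g, h and all
  \<open>q i\<close> vanish at the origin, as m is positive.\<close>

lemma colength_blowt:
  assumes g: "blowt t g = varx ^ m * g'" and h: "blowt t h = varx ^ m * h'"
    and "restr g' \<noteq> 0" "degree (restr g') \<le> m" "m > 0"
    and "colength_ge n g' h'"
  shows "colength_ge (Suc n) g h"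
proof -
  have at: "at0 (blowt t p) = at0 p" for p
    unfolding blowt_def by (rule at0_subst2) (simp_all add: at0.hom_mult)
  have at': "at0 p = 0" if "blowt t p = varx ^ m * q" for p q
    using \<open>m > 0\<close> at[of p] unfolding that by (simp add: at0.hom_mult at0.hom_power zero_power)
  obtain ps N where *: "\<And>c. (\<exists>p\<in>idl g' h'. \<exists>e. ord_ge N e \<and> (\<Sum>i<n. const2 (c i) * ps i) = p + e)
      \<Longrightarrow> (\<forall>i<n. c i = 0)"
    using assms unfolding colength_ge_def by blast
  have "\<forall>i. \<exists>q e j. j\<in>idl g' h' \<and> varx ^ m * ps i = blowt t q + varx ^ m * j + varx ^ (m + N) * e"
    using blowt_almost_onto[OF assms(3,4)] by blast
  then obtain q e j where q: "\<And>i. j i \<in> idl g' h'"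
      "\<And>i. varx ^ m * ps i = blowt t (q i) + varx ^ m * j i + varx ^ (m + N) * e i"
    by metis
  have q0: "at0 (q i) = 0" for i
  proof (rule at')
    show "blowt t (q i) = varx ^ m * (ps i - j i - varx ^ N * e i)"
      using q(2)[of i] by (simp add: algebra_simps power_add)
  qed
  define ps' where "ps' i = (if i < n then q i else 1)" for i
  show ?thesis unfolding colength_ge_def
  \<comment> \<open>An error of order m + N transforms into a multiple of x^(m + N); after the
    division by x^m a factor x^N remains.\<close>
  proof (intro exI[of _ ps'] exI[of _ "m + N"] allI impI, elim bexE exE conjE)
    fix c p f k
    assume p: "p \<in> idl g h" and f: "ord_ge (m + N) f" and k: "k < Suc n"
      and eq: "(\<Sum>i<Suc n. const2 (c i) * ps' i) = p + f"
    have eq': "(\<Sum>i<n. const2 (c i) * q i) + const2 (c n) = p + f"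
      using eq by (simp add: ps'_def)
    have "at0 p = 0" using p at'[OF g] at'[OF h] by (auto simp: idl_def at0.hom_add at0.hom_mult)
    moreover have "at0 f = 0" using f \<open>m > 0\<close> by (auto simp: ord_ge_def at0_def)
    ultimately have cn: "c n = 0"
      using arg_cong[OF eq', of at0] by (simp add: at0.hom_add at0.hom_mult at0.hom_sum q0)
    obtain p' where p': "p' \<in> idl g' h'" "blowt t p = varx ^ m * p'"
    proof -
      obtain U V where "p = U * g + V * h" using p by (auto simp: idl_def)
      hence "blowt t p = varx ^ m * (blowt t U * g' + blowt t V * h')"
        by (simp add: blowt.hom_add blowt.hom_mult g h algebra_simps)
      thus thesis using that idlI by blast
    qed
    have "varx ^ (m + N) dvd blow f" using f by (simp add: varx_power_dvd_blow_iff)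
    then obtain f' where "blow f = varx ^ (m + N) * f'" ..
    hence f': "blowt t f = varx ^ (m + N) * shifty t f'"
      by (simp add: blowt_shifty shifty.hom_mult shifty.hom_power)
    have qi: "blowt t (q i) = varx ^ m * (ps i - j i - varx ^ N * e i)" for i
      using q(2)[of i] by (simp add: algebra_simps power_add)
    have "varx ^ m * (\<Sum>i<n. const2 (c i) * (ps i - j i - varx ^ N * e i)) = blowt t (\<Sum>i<n. const2 (c i) * q i)"
      by (simp add: blowt.hom_sum blowt.hom_mult qi sum_distrib_left mult_ac)
    also have "\<dots> = blowt t (p + f)" using eq' cn by (simp add: const2.hom_zero)
    also have "\<dots> = varx ^ m * (p' + varx ^ N * shifty t f')"
      by (simp add: blowt.hom_add p' f' algebra_simps power_add)
    finally have "(\<Sum>i<n. const2 (c i) * (ps i - j i - varx ^ N * e i)) = p' + varx ^ N * shifty t f'"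
      by simp
    hence "(\<Sum>i<n. const2 (c i) * ps i) = (p' + (\<Sum>i<n. const2 (c i) * j i))
        + varx ^ N * (shifty t f' + (\<Sum>i<n. const2 (c i) * e i))"
      by (simp add: algebra_simps sum_subtractf sum.distrib sum_distrib_left)
    moreover have "p' + (\<Sum>i<n. const2 (c i) * j i) \<in> idl g' h'"
      by (intro idl_add idl_sum idl_mult p' q)
    moreover have "ord_ge N (varx ^ N * (shifty t f' + (\<Sum>i<n. const2 (c i) * e i)))"
      by (intro ord_ge_varx_power) simp
    ultimately have "\<forall>i<n. c i = 0" using *[of c] by blast
    with cn k show "c k = 0" by (metis less_Suc_eq)
  qed
qed

subsection \<open>First integrals\<close>

text \<open>The numerators of the partial derivatives of g/h over the denominator h^2.\<close>

definition wronx :: "poly2 \<Rightarrow> poly2 \<Rightarrow> poly2" where "wronx g h = h * dx g - g * dx h"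
definition wrony :: "poly2 \<Rightarrow> poly2 \<Rightarrow> poly2" where "wrony g h = h * dy g - g * dy h"

text \<open>The fraction \<open>g/h\<close> is constant along the leaves of \<open>P dx + Q dy\<close>.\<close>

definition first_integral :: "form \<Rightarrow> poly2 \<Rightarrow> poly2 \<Rightarrow> bool" where
  "first_integral \<omega> g h \<longleftrightarrow> snd \<omega> * wronx g h = fst \<omega> * wrony g h"

definition nonconstant :: "poly2 \<Rightarrow> poly2 \<Rightarrow> bool" where
  "nonconstant g h \<longleftrightarrow> wronx g h \<noteq> 0 \<or> wrony g h \<noteq> 0"

lemma pullback_eq:
  "pullback u v (P, Q) = (subst2 u v P * dx u + subst2 u v Q * dx v, subst2 u v P * dy u + subst2 u v Q * dy v)"
  by (simp add: pullback_def subst2_def)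

lemma wron_subst2:
  "wronx (subst2 u v g) (subst2 u v h) = subst2 u v (wronx g h) * dx u + subst2 u v (wrony g h) * dx v"
  "wrony (subst2 u v g) (subst2 u v h) = subst2 u v (wronx g h) * dy u + subst2 u v (wrony g h) * dy v"
  by (simp_all add: wronx_def wrony_def dx_subst2 dy_subst2 subst2_hom algebra_simps)

text \<open>The condition says that the wedge product of \<omega> with h dg - g dh vanishes. A
  pull-back multiplies this product by the Jacobian determinant of the map.\<close>

lemma first_integral_pullback:
  assumes "first_integral \<omega> g h"
  shows "first_integral (pullback u v \<omega>) (subst2 u v g) (subst2 u v h)"
proof -
  obtain P Q where \<omega>: "\<omega> = (P, Q)" by force
  have "subst2 u v (Q * wronx g h) = subst2 u v (P * wrony g h)"
    using assms by (simp add: first_integral_def \<omega>)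
  hence *: "subst2 u v Q * subst2 u v (wronx g h) = subst2 u v P * subst2 u v (wrony g h)"
    by (simp add: subst2_hom)
  define p q a b where "p = subst2 u v P" and "q = subst2 u v Q"
    and "a = subst2 u v (wronx g h)" and "b = subst2 u v (wrony g h)"
  have "(p * dy u + q * dy v) * (a * dx u + b * dx v) - (p * dx u + q * dx v) * (a * dy u + b * dy v)
      = (q * a - p * b) * (dx u * dy v - dy u * dx v)" by (simp add: algebra_simps)
  thus ?thesis using *
    by (simp add: first_integral_def \<omega> pullback_eq wron_subst2 p_def q_def a_def b_def)
qed

lemma wron_scale: "wronx (c * g) (c * h) = c ^ 2 * wronx g h" "wrony (c * g) (c * h) = c ^ 2 * wrony g h"
  by (simp_all add: wronx_def wrony_def dx_mult dy_mult power2_eq_square algebra_simps)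

lemma first_integral_scale: "c \<noteq> 0 \<Longrightarrow> first_integral \<omega> (c * g) (c * h) \<longleftrightarrow> first_integral \<omega> g h"
  by (simp add: first_integral_def wron_scale mult.left_commute)

lemma first_integral_scale_form: "c \<noteq> 0 \<Longrightarrow> first_integral (c * P, c * Q) g h \<longleftrightarrow> first_integral (P, Q) g h"
  by (simp add: first_integral_def mult.assoc)

lemma wron_linear:
  "wronx (const2 a * g + const2 b * h) (const2 c * g + const2 d * h) = const2 (a * d - b * c) * wronx g h"
  "wrony (const2 a * g + const2 b * h) (const2 c * g + const2 d * h) = const2 (a * d - b * c) * wrony g h"
  by (simp_all add: wronx_def wrony_def dx_mult dy_mult dx_add dy_add const2.hom_minus const2.hom_mult
        algebra_simps)

text \<open>With this, linear combinations of g and h can be made to vanish at a point or along the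
  exceptional divisor.\<close>

lemma first_integral_linear:
  "first_integral \<omega> g h \<Longrightarrow> first_integral \<omega> (const2 a * g + const2 b * h) (const2 c * g + const2 d * h)"
  by (simp add: first_integral_def wron_linear mult.left_commute)

lemma first_integral_commute: "first_integral \<omega> h g \<longleftrightarrow> first_integral \<omega> g h"
proof -
  have "wronx h g = - wronx g h" "wrony h g = - wrony g h" by (simp_all add: wronx_def wrony_def)
  thus ?thesis by (simp add: first_integral_def)
qed

lemma first_integral_swp:
  assumes "first_integral (P, Q) g h" shows "first_integral (swp Q, swp P) (swp g) (swp h)"
proof -
  have "wronx (swp g) (swp h) = swp (wrony g h)" "wrony (swp g) (swp h) = swp (wronx g h)"
    by (simp_all add: wronx_def wrony_def dx_swp dy_swp swp.hom_minus swp.hom_mult)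
  moreover have "swp (Q * wronx g h) = swp (P * wrony g h)"
    using assms by (simp add: first_integral_def)
  ultimately show ?thesis by (simp add: first_integral_def swp.hom_mult)
qed

subsection \<open>Strict transforms\<close>

text \<open>The bound \<open>b\<close> ensures that the \<open>GREATEST\<close> in the definition is
  attained.\<close>

lemma divide_max_power:
  assumes E: "E \<noteq> 0" and bound: "\<And>k. E ^ k dvd P \<Longrightarrow> E ^ k dvd Q \<Longrightarrow> k \<le> b"
  obtains k P' Q' where "divide_max_power E (P, Q) = (P', Q')" "P = E ^ k * P'" "Q = E ^ k * Q'"
    "\<not> (E dvd P' \<and> E dvd Q')"
proof -
  define k where "k = (GREATEST k. E ^ k dvd P \<and> E ^ k dvd Q)"
  have k: "E ^ k dvd P \<and> E ^ k dvd Q" unfolding k_def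
    by (rule GreatestI_nat[of _ 0 b]) (use bound in auto)
  have max: "j \<le> k" if "E ^ j dvd P \<and> E ^ j dvd Q" for j unfolding k_def
    by (rule Greatest_le_nat[of _ _ b]) (use bound that in auto)
  from k obtain P' Q' where PQ: "P = E ^ k * P'" "Q = E ^ k * Q'" by (auto elim!: dvdE)
  have nd: "\<not> (E dvd P' \<and> E dvd Q')"
  proof
    assume "E dvd P' \<and> E dvd Q'"
    hence "E ^ Suc k dvd P \<and> E ^ Suc k dvd Q" by (auto simp: PQ mult.commute intro: mult_dvd_mono)
    from max[OF this] show False by simp
  qed

  have "divide_max_power E (P, Q) = (P div E ^ k, Q div E ^ k)"
    by (simp add: divide_max_power_def k_def Let_def)
  also have "\<dots> = (P', Q')" using E by (simp add: PQ)
  finally show thesis using that PQ nd by blast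
qed

lemma divide_max_power_varx:
  assumes "P \<noteq> 0 \<or> Q \<noteq> 0"
  obtains k P' Q' where "divide_max_power varx (P, Q) = (P', Q')" "P = varx ^ k * P'" "Q = varx ^ k * Q'"
    "\<not> (varx dvd P' \<and> varx dvd Q')"
proof -
  obtain R where R: "R \<noteq> 0" "R = P \<or> R = Q" using assms by auto
  then obtain i j where ij: "coeff (coeff R j) i \<noteq> 0" by (metis leading_coeff_0_iff)
  have "k \<le> i" if "varx ^ k dvd P" "varx ^ k dvd Q" for k
    using that R ij not_le by (auto simp: varx_power_dvd_iff)
  from divide_max_power[OF varx_nonzero this] that show thesis by blast
qed

lemma varx_decompose:
  assumes "p \<noteq> 0 \<or> q \<noteq> 0"
  obtains m p' q' where "p = varx ^ m * p'" "q = varx ^ m * q'" "restr p' \<noteq> 0 \<or> restr q' \<noteq> 0"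
  using divide_max_power_varx[OF assms] unfolding varx_dvd_iff by metis

lemma divide_max_power_vary:
  assumes "P \<noteq> 0 \<or> Q \<noteq> 0"
  obtains k P' Q' where "divide_max_power vary (P, Q) = (P', Q')" "P = vary ^ k * P'" "Q = vary ^ k * Q'"
    "\<not> (vary dvd P' \<and> vary dvd Q')"
proof -
  obtain R where R: "R \<noteq> 0" "R = P \<or> R = Q" using assms by auto
  hence "swp R \<noteq> 0" by simp
  then obtain i j where ij: "coeff (coeff (swp R) j) i \<noteq> 0" by (metis leading_coeff_0_iff)
  have "k \<le> i" if "vary ^ k dvd P" "vary ^ k dvd Q" for k
  proof -
    have "swp (vary ^ k) dvd swp R" using that R swp_dvd_iff by blast
    thus ?thesis using ij not_le by (auto simp: varx_power_dvd_iff swp.hom_power)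
  qed
  from divide_max_power[OF vary_nonzero this] that show thesis by blast
qed

fun chart_x :: "complex option \<Rightarrow> poly2" where
  "chart_x (Some t) = varx" | "chart_x None = varx * vary"
fun chart_y :: "complex option \<Rightarrow> poly2" where
  "chart_y (Some t) = varx * (vary + const2 t)" | "chart_y None = vary"
fun exc_eq :: "complex option \<Rightarrow> poly2" where
  "exc_eq (Some t) = varx" | "exc_eq None = vary"

lemma subst2_chart_None: "subst2 (varx * vary) vary p = swp (blowt 0 (swp p))"
  by (simp add: swp_def blowt_def subst2_subst2 subst2_hom const2.hom_zero mult.commute)

lemma subst2_chart_eq_0 [simp]: "subst2 (chart_x d) (chart_y d) p = 0 \<longleftrightarrow> p = 0"
  by (cases d) (simp_all add: subst2_chart_None flip: blowt_def)

lemma at0_subst2_chart [simp]: "at0 (subst2 (chart_x d) (chart_y d) p) = at0 p"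
  by (rule at0_subst2; cases d) (simp_all add: at0.hom_mult)

lemma pullback_chart_nonzero:
  assumes "\<omega> \<noteq> (0, 0)" shows "pullback (chart_x d) (chart_y d) \<omega> \<noteq> (0, 0)"
proof
  assume 0: "pullback (chart_x d) (chart_y d) \<omega> = (0, 0)"
  obtain P Q where \<omega>: "\<omega> = (P, Q)" by force
  let ?s = "subst2 (chart_x d) (chart_y d)"
  have "?s P = 0 \<and> ?s Q = 0"
  proof (cases d)
    case None
    thus ?thesis using 0 by (auto simp: \<omega> pullback_eq dx_mult dy_mult)
  next
    case (Some t)
    thus ?thesis using 0 by (auto simp: \<omega> pullback_eq dx_mult dy_mult dx_add dy_add)
  qed
  hence "P = 0 \<and> Q = 0" by (simp only: subst2_chart_eq_0)
  thus False using assms \<omega> by simp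
qed

lemma strict_transform:
  assumes "\<omega> \<noteq> (0, 0)"
  obtains k P Q where "strict_transform d \<omega> = (P, Q)"
    "pullback (chart_x d) (chart_y d) \<omega> = (exc_eq d ^ k * P, exc_eq d ^ k * Q)" "(P, Q) \<noteq> (0, 0)"
proof -
  obtain P Q where PQ: "pullback (chart_x d) (chart_y d) \<omega> = (P, Q)" by force
  hence nz: "P \<noteq> 0 \<or> Q \<noteq> 0" using pullback_chart_nonzero[OF assms, of d] by auto
  show thesis
  proof (cases d)
    case None
    with divide_max_power_vary[OF nz] obtain k P' Q'
      where "divide_max_power vary (P, Q) = (P', Q')" "P = vary ^ k * P'" "Q = vary ^ k * Q'" by metis
    with None PQ nz that[of P' Q' k] show thesis by auto
  next
    case (Some t)
    with divide_max_power_varx[OF nz] obtain k P' Q'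
      where "divide_max_power varx (P, Q) = (P', Q')" "P = varx ^ k * P'" "Q = varx ^ k * Q'" by metis
    with Some PQ nz that[of P' Q' k] show thesis by auto
  qed
qed

lemma exc_eq_nonzero [simp]: "exc_eq d \<noteq> 0"
  by (cases d) simp_all

lemma strict_transform_nonzero: "\<omega> \<noteq> (0, 0) \<Longrightarrow> strict_transform d \<omega> \<noteq> (0, 0)"
  using strict_transform by metis

lemma first_integral_strict_transform:
  assumes "\<omega> \<noteq> (0, 0)" "first_integral \<omega> g h"
  shows "first_integral (strict_transform d \<omega>) (subst2 (chart_x d) (chart_y d) g) (subst2 (chart_x d) (chart_y d) h)"
proof -
  obtain k P Q where "strict_transform d \<omega> = (P, Q)"
      "pullback (chart_x d) (chart_y d) \<omega> = (exc_eq d ^ k * P, exc_eq d ^ k * Q)"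
    using strict_transform[OF assms(1)] by metis
  thus ?thesis using first_integral_pullback[OF assms(2), of "chart_x d" "chart_y d"]
    by (simp add: first_integral_scale_form)
qed

lemma nonconstant_chart:
  assumes "nonconstant g h"
  shows "nonconstant (subst2 (chart_x d) (chart_y d) g) (subst2 (chart_x d) (chart_y d) h)"
proof -
  have "(wronx g h, wrony g h) \<noteq> (0, 0)" using assms by (auto simp: nonconstant_def)
  \<comment> \<open>The pair of Wronskians is itself treated as a form: by
    \<open>wron_subst2\<close> its pull-back is the pair belonging to the transformed g and
    h.\<close>
  from pullback_chart_nonzero[OF this, of d] show ?thesis
    by (auto simp: nonconstant_def pullback_eq wron_subst2)
qed

subsection \<open>Jets\<close>

lemma coeff_hom_part: "coeff (coeff (hom_part m p) j) i = (if i + j = m then coeff (coeff p j) i else 0)"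
proof -
  have "coeff (hom_part m p) j = (if j \<le> m then monom (coeff (coeff p j) (m - j)) (m - j) else 0)"
    by (simp add: hom_part_def coeff_sum)
  thus ?thesis by auto
qed

lemma hom_part_eq_0_iff: "hom_part m p = 0 \<longleftrightarrow> (\<forall>i j. i + j = m \<longrightarrow> coeff (coeff p j) i = 0)"
proof
  assume "hom_part m p = 0"
  thus "\<forall>i j. i + j = m \<longrightarrow> coeff (coeff p j) i = 0" by (metis coeff_hom_part coeff_0)
next
  assume "\<forall>i j. i + j = m \<longrightarrow> coeff (coeff p j) i = 0"
  thus "hom_part m p = 0" by (intro poly_eqI) (simp add: coeff_hom_part)
qed

lemma ord_ge_iff_hom_part: "ord_ge N p \<longleftrightarrow> (\<forall>m<N. hom_part m p = 0)"
  by (auto simp: ord_ge_def hom_part_eq_0_iff)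

lemma jet_order_props:
  assumes "(P, Q) \<noteq> (0, 0)"
  shows "ord_ge (jet_order (P, Q)) P" "ord_ge (jet_order (P, Q)) Q"
    "hom_part (jet_order (P, Q)) P \<noteq> 0 \<or> hom_part (jet_order (P, Q)) Q \<noteq> 0"
proof -
  have "\<exists>m. hom_part m p \<noteq> 0" if "p \<noteq> 0" for p
    using that leading_coeff_0_iff unfolding hom_part_eq_0_iff by metis
  hence ex: "\<exists>m. hom_part m P \<noteq> 0 \<or> hom_part m Q \<noteq> 0" using assms by auto
  have j: "jet_order (P, Q) = (LEAST m. hom_part m P \<noteq> 0 \<or> hom_part m Q \<noteq> 0)"
    by (simp add: jet_order_def)
  show "hom_part (jet_order (P, Q)) P \<noteq> 0 \<or> hom_part (jet_order (P, Q)) Q \<noteq> 0"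
    using LeastI_ex[OF ex] unfolding j .
  show "ord_ge (jet_order (P, Q)) P" "ord_ge (jet_order (P, Q)) Q"
    unfolding ord_ge_iff_hom_part j using not_less_Least by blast+
qed

text \<open>The terms of degree m yield x^m times a polynomial in y, and those of higher degree keep
  an extra factor x. So the jet can be read off on the exceptional divisor.\<close>

lemma blow_hom_part:
  assumes "blow p = varx ^ m * p'" shows "blow (hom_part m p) = varx ^ m * emb (restr p')"
proof (intro poly_eqI)
  fix i j
  have "coeff (coeff (blow p) j) i = coeff (coeff (varx ^ m * p') j) i" for i j using assms by simp
  from this[of j m] show "coeff (coeff (blow (hom_part m p)) j) i = coeff (coeff (varx ^ m * emb (restr p')) j) i"
    by (auto simp: coeff_coeff_blow coeff_hom_part coeff_varx_power_mult coeff_emb coeff_restr coeff_pCons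
        split: nat.splits)
qed

lemma emb_eq_0_iff [simp]: "emb q = 0 \<longleftrightarrow> q = 0"
  by (metis restr_emb restr.hom_zero coeff_emb coeff_0 poly_eqI pCons_0_0)

text \<open>The polynomial x p + y q formed from the first jet transforms into a power of x times
  the restriction of P' + y Q'. This sum is also the first coefficient of the pulled-back form after
  division by x^\<open>jet_order\<close>, while the second one is x Q'.\<close>

lemma jet_order_blow:
  assumes "(P, Q) \<noteq> (0, 0)"
  obtains P' Q' where "blow P = varx ^ jet_order (P, Q) * P'" "blow Q = varx ^ jet_order (P, Q) * Q'"
    "restr P' \<noteq> 0 \<or> restr Q' \<noteq> 0"
    "terminal_dicritical (P, Q) \<longleftrightarrow> singular (P, Q) \<and> restr (P' + vary * Q') = 0"
proof -
  define \<nu> where "\<nu> = jet_order (P, Q)"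
  note props = jet_order_props[OF assms, folded \<nu>_def]
  obtain P' Q' where PQ: "blow P = varx ^ \<nu> * P'" "blow Q = varx ^ \<nu> * Q'"
    using props(1,2) by (auto simp: varx_power_dvd_blow_iff[symmetric] elim!: dvdE)
  note hp = blow_hom_part[OF PQ(1)] blow_hom_part[OF PQ(2)]
  have nz: "hom_part \<nu> P = 0 \<longleftrightarrow> restr P' = 0" "hom_part \<nu> Q = 0 \<longleftrightarrow> restr Q' = 0"
    using hp by (metis blow_eq_0_iff mult_eq_0_iff power_eq_0_iff varx_nonzero emb_eq_0_iff)+
  have "varx * hom_part \<nu> P + vary * hom_part \<nu> Q = 0
      \<longleftrightarrow> blow (varx * hom_part \<nu> P + vary * hom_part \<nu> Q) = 0" by simp
  also have "blow (varx * hom_part \<nu> P + vary * hom_part \<nu> Q)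
      = varx ^ Suc \<nu> * (emb (restr P') + vary * emb (restr Q'))"
    by (simp add: blow.hom_add blow.hom_mult hp algebra_simps) (simp add: blow_def algebra_simps)
  also have "\<dots> = 0 \<longleftrightarrow> emb (restr P') + vary * emb (restr Q') = 0" by simp
  also have "emb (restr P') + vary * emb (restr Q') = emb (restr (P' + vary * Q'))"
    by (intro poly_eqI) (simp add: restr.hom_add restr.hom_mult coeff_emb coeff_vary_mult coeff_pCons
        split: nat.splits)
  also have "\<dots> = 0 \<longleftrightarrow> restr (P' + vary * Q') = 0" by simp
  finally have "terminal_dicritical (P, Q) \<longleftrightarrow> singular (P, Q) \<and> restr (P' + vary * Q') = 0"
    by (simp add: terminal_dicritical_def first_jet_def \<nu>_def)
  thus thesis using that PQ nz props(3) unfolding \<nu>_def by blast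
qed

lemma restr_blow: "restr (blow p) = [:at0 p:]"
  by (rule poly_eqI) (auto simp: coeff_restr coeff_coeff_blow at0_def coeff_pCons split: nat.splits)

lemma pullback_blow: "pullback varx (varx * vary) (P, Q) = (blow P + vary * blow Q, varx * blow Q)"
  by (simp add: pullback_eq blow_def dx_mult dy_mult mult.commute)

lemma wronx_varx_power:
  "wronx (varx ^ Suc m * g) h = varx ^ m * (of_nat (Suc m) * (h * g) + varx * wronx g h)"
proof -
  have p: "dx (varx ^ Suc m) = of_nat (Suc m) * varx ^ m" for m
    by (induction m) (simp_all add: dx_mult algebra_simps)
  show ?thesis unfolding wronx_def dx_mult[of "varx ^ Suc m"] p by (simp add: algebra_simps)
qed

lemma wrony_varx_power: "wrony (varx ^ m * g) h = varx ^ m * wrony g h"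
proof -
  have "dy (varx ^ m) = 0" by (induction m) (simp_all add: dy_mult flip: dx_simps(1), simp add: dy_def)
  thus ?thesis by (simp add: wrony_def dy_mult algebra_simps)
qed

text \<open>
  At a terminal dicritical point \<open>x\<close> divides the first coefficient of the blown-up form once more
  than the second one, while \<open>g/h\<close>, if defined there, is constant on the exceptional divisor.
\<close>

lemma not_terminal_dicritical_aux:
  assumes fi: "first_integral (P, Q) g h" and nz: "(P, Q) \<noteq> (0, 0)"
    and g: "g \<noteq> 0" "at0 g = 0" and h: "at0 h \<noteq> 0"
  shows "\<not> terminal_dicritical (P, Q)"
proof
  assume td: "terminal_dicritical (P, Q)"
  define \<nu> where "\<nu> = jet_order (P, Q)"
  obtain P' Q' where PQ: "blow P = varx ^ \<nu> * P'" "blow Q = varx ^ \<nu> * Q'"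
    "restr P' \<noteq> 0 \<or> restr Q' \<noteq> 0" "restr (P' + vary * Q') = 0"
    using jet_order_blow[OF nz] td unfolding \<nu>_def by metis
  then obtain R where R: "P' + vary * Q' = varx * R" by (auto simp: varx_dvd_iff[symmetric])
  have Q'0: "restr Q' \<noteq> 0" using PQ(3,4) by (auto simp: restr.hom_add restr.hom_mult)
  obtain m g' where m: "blow g = varx ^ m * g'" "restr g' \<noteq> 0"
    using varx_decompose[of "blow g" "blow g"] g by (metis blow_eq_0_iff)
  have "m \<noteq> 0"
  proof
    assume "m = 0"
    thus False using m restr_blow[of g] g by simp
  qed
  then obtain k where k: "m = Suc k" by (cases m) auto
  have "pullback varx (varx * vary) (P, Q) = (varx ^ Suc \<nu> * R, varx ^ Suc \<nu> * Q')"
  proof -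
    have "varx ^ \<nu> * P' + vary * (varx ^ \<nu> * Q') = varx ^ \<nu> * (P' + vary * Q')"
      by (simp add: algebra_simps)
    thus ?thesis unfolding R by (simp add: pullback_blow PQ(1,2) mult_ac)
  qed
  hence "first_integral (R, Q') (blow g) (blow h)"
    using first_integral_pullback[OF fi, of varx "varx * vary"] unfolding blow_def[symmetric]
    by (simp add: first_integral_scale_form del: power_Suc)
  hence "Q' * wronx (varx ^ Suc k * g') (blow h) = R * wrony (varx ^ Suc k * g') (blow h)"
    by (simp add: first_integral_def m k)
  hence "varx ^ k * (Q' * (of_nat (Suc k) * (blow h * g') + varx * wronx g' (blow h)))
      = varx ^ k * (R * varx * wrony g' (blow h))"
    unfolding wronx_varx_power wrony_varx_power by (simp add: mult_ac)
  hence "Q' * (of_nat (Suc k) * (blow h * g') + varx * wronx g' (blow h)) = R * varx * wrony g' (blow h)"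
    by simp
  \<comment> \<open>On x = 0 only the term from the derivative of the factor x^(k + 1) survives, and
    none of its factors vanishes identically.\<close>
  hence "restr (Q' * (of_nat (Suc k) * (blow h * g') + varx * wronx g' (blow h))) = restr (R * varx * wrony g' (blow h))"
    by simp
  hence "restr Q' * (of_nat (Suc k) * ([:at0 h:] * restr g')) = 0"
    unfolding restr.hom_mult restr.hom_add restr.hom_of_nat restr_blow by simp
  thus False using Q'0 m h by (simp del: of_nat_Suc)
qed

lemma not_terminal_dicritical:
  assumes fi: "first_integral \<omega> g h" and nz: "\<omega> \<noteq> (0, 0)" and "nonconstant g h"
    and "at0 g \<noteq> 0 \<or> at0 h \<noteq> 0"
  shows "\<not> terminal_dicritical \<omega>"
proof -
  obtain P Q where \<omega>: "\<omega> = (P, Q)" by force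
  have *: "\<not> terminal_dicritical \<omega>" if fi: "first_integral \<omega> g h" and nc: "nonconstant g h" and h: "at0 h \<noteq> 0" for g h
  proof -
    \<comment> \<open>Subtracting the value of g/h at the origin makes the numerator vanish
      there.\<close>
    define c where "c = at0 g / at0 h"
    define g1 where "g1 = const2 1 * g + const2 (- c) * h"
    have "first_integral \<omega> g1 (const2 0 * g + const2 1 * h)"
      unfolding g1_def by (rule first_integral_linear[OF fi])
    hence fi1: "first_integral \<omega> g1 h" by (simp add: const2.hom_zero const2.hom_one)
    have "g1 \<noteq> 0"
    proof
      assume "g1 = 0"
      hence "g = const2 c * h" by (simp add: g1_def const2.hom_one const2.hom_uminus)
      thus False using nc by (simp add: nonconstant_def wronx_def wrony_def dx_mult dy_mult)
    qed
    moreover have "at0 g1 = 0"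
      using h by (simp add: g1_def c_def at0.hom_add at0.hom_mult)
    ultimately show ?thesis
      using not_terminal_dicritical_aux[of P Q g1 h] fi1 nz h \<omega> by blast
  qed
  show ?thesis
  proof (cases "at0 h = 0")
    case True
    have "nonconstant h g" using assms(3) by (auto simp: nonconstant_def wronx_def wrony_def)
    thus ?thesis using *[of h g] assms True first_integral_commute by blast
  qed (use * assms in blast)
qed

lemma fold_strict_transform_not_terminal:
  assumes "first_integral \<omega> g h" "\<omega> \<noteq> (0, 0)" "nonconstant g h" "at0 g \<noteq> 0 \<or> at0 h \<noteq> 0"
  shows "\<not> terminal_dicritical (fold strict_transform ds \<omega>)"
  using assms
proof (induction ds arbitrary: \<omega> g h)
  case Nil
  thus ?case using not_terminal_dicritical by simp
next
  case (Cons d ds)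
  have "at0 (subst2 (chart_x d) (chart_y d) g) \<noteq> 0 \<or> at0 (subst2 (chart_x d) (chart_y d) h) \<noteq> 0"
    using Cons.prems(4) by simp
  from Cons.IH[OF first_integral_strict_transform[OF Cons.prems(2,1)]
      strict_transform_nonzero[OF Cons.prems(2)] nonconstant_chart[OF Cons.prems(3)] this]
  show ?case by simp
qed

subsection \<open>Indeterminacy points are singular\<close>

text \<open>For the vector field X = Q d/dx - P d/dy the hypothesis reads h X(g) = g X(h), so g
  divides X(g) by coprimality. Vanishing at the origin excludes g = 0 and h = 0, since then the
  other polynomial would be a unit.\<close>

lemma cofactor:
  assumes "coprime g (h :: poly2)" "first_integral (P, Q) g h" "at0 g = 0" "at0 h = 0"
  obtains k where "Q * dx g - P * dy g = k * g" "Q * dx h - P * dy h = k * h"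
proof -
  have nz: "g \<noteq> 0" "h \<noteq> 0"
    using assms by (metis at0.hom_zero at0.hom_one coprime_0_left_iff coprime_0_right_iff at0.hom_mult dvdE mult_zero_left zero_neq_one)+
  have *: "h * (Q * dx g - P * dy g) = g * (Q * dx h - P * dy h)"
    using assms(2) by (simp add: first_integral_def wronx_def wrony_def algebra_simps)
  have "g dvd h * (Q * dx g - P * dy g)" unfolding * by simp
  hence "g dvd Q * dx g - P * dy g" using assms(1) by (simp add: coprime_dvd_mult_right_iff)
  then obtain k where k: "Q * dx g - P * dy g = k * g" by (metis dvdE mult.commute)
  have "g * (Q * dx h - P * dy h) = g * (k * h)" using *[symmetric] unfolding k by (simp only: mult_ac)
  hence "Q * dx h - P * dy h = k * h" using mult_left_cancel[OF nz(1)] by blast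
  with that k show thesis by blast
qed

lemma at0_idl: "at0 g = 0 \<Longrightarrow> at0 h = 0 \<Longrightarrow> p \<in> idl g h \<Longrightarrow> at0 p = 0"
  by (auto simp: idl_def at0.hom_add at0.hom_mult)

text \<open>X maps the ideal into itself. If Q does not vanish at the origin, X sends x^(n + 1) F
  with F(0) nonzero to x^n F' with F'(0) nonzero. Starting from r(x) = x^k q(x) one reaches an ideal
  element that is nonzero at the origin, where g and h vanish.\<close>

lemma indeterminate_imp_at0_eq_0:
  assumes "coprime g (h :: poly2)" "first_integral (P, Q) g h" "at0 g = 0" "at0 h = 0"
  shows "at0 Q = 0"
proof (rule ccontr)
  assume Q: "at0 Q \<noteq> 0"
  obtain k where k: "Q * dx g - P * dy g = k * g" "Q * dx h - P * dy h = k * h"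
    using cofactor[OF assms] .
  define X where "X p = Q * dx p - P * dy p" for p
  have X_mult: "X (p * q) = X p * q + p * X q" and X_add: "X (p + q) = X p + X q" for p q
    by (simp_all add: X_def dx_mult dy_mult dx_add dy_add algebra_simps)
  have Xx: "X varx = Q" by (simp add: X_def)
  have X_idl: "X p \<in> idl g h" if p: "p \<in> idl g h" for p
  proof -
    obtain U V where "p = U * g + V * h" using p by (auto simp: idl_def)
    hence "X p = (X U + U * k) * g + (X V + V * k) * h"
      using k by (simp add: X_mult X_add algebra_simps flip: X_def)
    thus ?thesis using idlI by metis
  qed
  have no: "varx ^ n * F \<notin> idl g h" if "at0 F \<noteq> 0" for n F
    using that
  proof (induction n arbitrary: F)
    case 0
    thus ?case using at0_idl[OF assms(3,4)] by auto
  next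
    case (Suc n)
    have p: "X (varx ^ Suc n) = of_nat (Suc n) * varx ^ n * Q" for n
    proof (induction n)
      case (Suc n)
      thus ?case unfolding X_mult[of _ "varx ^ Suc n"] power_Suc[of _ "Suc n"] Xx by (simp add: algebra_simps)
    qed (simp add: Xx)
    have "X (varx ^ Suc n * F) = varx ^ n * (of_nat (Suc n) * Q * F + varx * X F)"
      unfolding X_mult[of "varx ^ Suc n"] p by (simp add: algebra_simps)
    moreover have "at0 (of_nat (Suc n) * Q * F + varx * X F) \<noteq> 0"
      using Q Suc.prems by (simp add: at0.hom_add at0.hom_mult at0.hom_of_nat del: of_nat_Suc)
    ultimately show ?case using Suc.IH X_idl by metis
  qed
  obtain r where r: "r \<noteq> 0" "[:r:] \<in> idl g h" using coprime_eliminate_y[OF assms(1)] .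
  obtain q where q: "r = [:-0, 1:] ^ order 0 r * q" "\<not> [:-0, 1:] dvd q" using order_decomp[OF r(1)] by blast
  have "[:r:] = varx ^ order 0 r * [:q:]" by (subst q(1)) (simp add: varx_power monom_altdef)
  moreover have "at0 [:q:] \<noteq> 0" using q(2) poly_eq_0_iff_dvd[of q 0] by (simp add: at0_def poly_0_coeff_0)
  ultimately show False using no r(2) by metis
qed

lemma indeterminate_imp_singular:
  assumes "\<omega> \<noteq> (0, 0)" "coprime g (h :: poly2)" "first_integral \<omega> g h" "at0 g = 0" "at0 h = 0"
  shows "singular \<omega>"
proof (rule ccontr)
  obtain P Q where \<omega>: "\<omega> = (P, Q)" by force
  assume "\<not> singular \<omega>"
  hence "jet_order (P, Q) = 0" by (simp add: singular_def \<omega>)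
  hence "at0 P \<noteq> 0 \<or> at0 Q \<noteq> 0"
    using jet_order_props(3)[of P Q] assms(1) by (auto simp: \<omega> hom_part_eq_0_iff at0_def)
  moreover have "at0 Q = 0" using indeterminate_imp_at0_eq_0 assms \<omega> by blast
  moreover have "at0 (swp P) = 0"
    using indeterminate_imp_at0_eq_0[of "swp g" "swp h" "swp Q" "swp P"] assms first_integral_swp \<omega>
    by (simp add: swp_coprime)
  ultimately show False by simp
qed

subsection \<open>Indeterminacy points are not simple\<close>

text \<open>
  The vectors \<open>v\<close>, \<open>w\<close> form an eigenbasis of the linear part of \<open>Q \<partial>/\<partial>x - P \<partial>/\<partial>y\<close>. The purpose is to
  find a curve \<open>\<gamma>(s) = s v + \<phi>(s) w\<close> that is invariant modulo \<open>s\<^sup>N\<close>; its defect measures the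
  deviation from invariance.
\<close>

locale eigenbasis =
  fixes P Q :: poly2 and v1 v2 w1 w2 \<mu> \<mu>' :: complex
  assumes PQ0: "at0 P = 0" "at0 Q = 0"
    and v: "at0 (dx Q) * v1 + at0 (dy Q) * v2 = \<mu> * v1" "- at0 (dx P) * v1 - at0 (dy P) * v2 = \<mu> * v2"
    and w: "at0 (dx Q) * w1 + at0 (dy Q) * w2 = \<mu>' * w1" "- at0 (dx P) * w1 - at0 (dy P) * w2 = \<mu>' * w2"
    and det1: "v1 * w2 - v2 * w1 = 1"
begin

definition \<gamma>1 :: "complex poly \<Rightarrow> complex poly" where
  "\<gamma>1 \<phi> = [:0, v1:] + Polynomial.smult w1 \<phi>"
definition \<gamma>2 :: "complex poly \<Rightarrow> complex poly" where
  "\<gamma>2 \<phi> = [:0, v2:] + Polynomial.smult w2 \<phi>"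
definition ev :: "complex poly \<Rightarrow> poly2 \<Rightarrow> complex poly" where
  "ev \<phi> p = eval2 (\<lambda>c. [:c:]) p (\<gamma>1 \<phi>) (\<gamma>2 \<phi>)"

text \<open>The components of the vector field along the curve with respect to the basis \<open>v\<close>, \<open>w\<close>.\<close>

definition \<alpha> :: "complex poly \<Rightarrow> complex poly" where
  "\<alpha> \<phi> = Polynomial.smult w2 (ev \<phi> Q) + Polynomial.smult w1 (ev \<phi> P)"
definition \<beta> :: "complex poly \<Rightarrow> complex poly" where
  "\<beta> \<phi> = - Polynomial.smult v1 (ev \<phi> P) - Polynomial.smult v2 (ev \<phi> Q)"
definition defect :: "complex poly \<Rightarrow> complex poly" where
  "defect \<phi> = \<beta> \<phi> - pderiv \<phi> * \<alpha> \<phi>"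

interpretation ev: comm_ring_hom "ev \<phi>" for \<phi>
  unfolding ev_def[abs_def] by (intro comm_ring_hom_eval2 comm_ring_hom_pconst)

lemma ev_simps [simp]: "ev \<phi> (const2 c) = [:c:]" "ev \<phi> varx = \<gamma>1 \<phi>" "ev \<phi> vary = \<gamma>2 \<phi>"
  by (simp_all add: ev_def eval2_const2 eval2_varx eval2_vary comm_ring_hom_pconst)

lemma coeff_ev_0: "coeff \<phi> 0 = 0 \<Longrightarrow> coeff (ev \<phi> p) 0 = at0 p"
  by (induction p rule: poly2_induct)
     (simp_all add: \<gamma>1_def \<gamma>2_def ev.hom_add ev.hom_mult at0.hom_add at0.hom_mult coeff_mult_0)

lemma coeff_ev_1:
  assumes "coeff \<phi> 0 = 0" "coeff \<phi> 1 = 0"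
  shows "coeff (ev \<phi> p) 1 = at0 (dx p) * v1 + at0 (dy p) * v2"
proof (induction p rule: poly2_induct)
  case (mult p q)
  have "coeff (a * b) 1 = coeff a 0 * coeff b 1 + coeff a 1 * coeff b 0" for a b :: "complex poly"
    by (simp add: coeff_mult)
  thus ?case using mult assms
    by (simp add: ev.hom_mult coeff_ev_0 dx_mult dy_mult at0.hom_add at0.hom_mult algebra_simps)
qed (use assms in \<open>simp_all add: \<gamma>1_def \<gamma>2_def ev.hom_add dx_add dy_add at0.hom_add algebra_simps\<close>)

text \<open>The first-order Taylor expansion along w. The derivatives may be taken at the origin
  because they are multiplied by s^N and the curve passes through the origin.\<close>

lemma ev_perturb:
  assumes "coeff \<phi> 0 = 0" "N \<ge> 1"
  shows "monom 1 (Suc N) dvd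
    ev (\<phi> + monom c N) p - ev \<phi> p - monom (c * (at0 (dx p) * w1 + at0 (dy p) * w2)) N"
proof (induction p rule: poly2_induct)
  case (add p q)
  have "ev (\<phi> + monom c N) (p + q) - ev \<phi> (p + q) - monom (c * (at0 (dx (p + q)) * w1 + at0 (dy (p + q)) * w2)) N
    = (ev (\<phi> + monom c N) p - ev \<phi> p - monom (c * (at0 (dx p) * w1 + at0 (dy p) * w2)) N)
    + (ev (\<phi> + monom c N) q - ev \<phi> q - monom (c * (at0 (dx q) * w1 + at0 (dy q) * w2)) N)"
    by (simp add: ev.hom_add dx_add dy_add at0.hom_add algebra_simps flip: add_monom)
  with add show ?case by (simp only: dvd_add)
next
  case (mult p q)
  define \<psi> where "\<psi> = \<phi> + monom c N"
  define l where "l p = c * (at0 (dx p) * w1 + at0 (dy p) * w2)" for p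
  have \<psi>0: "coeff \<psi> 0 = 0" using assms by (simp add: \<psi>_def)
  have *: "monom 1 (Suc N) dvd monom a N * (ev \<chi> p - [:at0 p:])" if "coeff \<chi> 0 = 0" for a p \<chi>
  proof -
    have "monom 1 1 dvd ev \<chi> p - [:at0 p:]"
      using that by (simp add: monom_1_dvd_iff' coeff_ev_0)
    moreover have "monom 1 N dvd monom a N"
      by (simp add: monom_1_dvd_iff')
    ultimately have "monom 1 N * monom 1 1 dvd monom a N * (ev \<chi> p - [:at0 p:])"
      by (intro mult_dvd_mono)
    thus ?thesis by (simp add: mult_monom)
  qed
  have lm: "l (p * q) = l p * at0 q + at0 p * l q"
    by (simp add: l_def dx_mult dy_mult at0.hom_add at0.hom_mult algebra_simps)
  have mm: "monom (a * b) N = monom a N * [:b:]" "monom (b * a) N = [:b:] * monom a N" for a b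
    by (simp_all add: smult_monom mult.commute)
  have "ev \<psi> (p * q) - ev \<phi> (p * q) - monom (l (p * q)) N
    = (ev \<psi> p - ev \<phi> p - monom (l p) N) * ev \<psi> q + monom (l p) N * (ev \<psi> q - [:at0 q:])
    + ev \<phi> p * (ev \<psi> q - ev \<phi> q - monom (l q) N) + monom (l q) N * (ev \<phi> p - [:at0 p:])"
    unfolding lm add_monom[symmetric] mm(1)[of "l p" "at0 q"] mm(2)[of "at0 p" "l q"] ev.hom_mult
    by (simp only: algebra_simps)
  thus ?case using mult *[OF \<psi>0] *[OF assms(1)] unfolding \<psi>_def[symmetric] l_def[symmetric]
    by (simp only: dvd_add dvd_mult dvd_mult2)
qed (simp_all add: \<gamma>1_def \<gamma>2_def smult_add_right smult_monom mult.commute)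

lemma \<alpha>_linear:
  assumes "coeff \<phi> 0 = 0" "coeff \<phi> 1 = 0"
  shows "coeff (\<alpha> \<phi>) 0 = 0" "coeff (\<alpha> \<phi>) 1 = \<mu>" "coeff (\<beta> \<phi>) 0 = 0" "coeff (\<beta> \<phi>) 1 = 0"
proof -
  have "coeff (\<alpha> \<phi>) 1 = w2 * (at0 (dx Q) * v1 + at0 (dy Q) * v2) - w1 * (- at0 (dx P) * v1 - at0 (dy P) * v2)"
    using assms coeff_ev_1 by (simp add: \<alpha>_def algebra_simps)
  also have "\<dots> = \<mu> * (v1 * w2 - v2 * w1)" unfolding v by (simp add: algebra_simps)
  finally show "coeff (\<alpha> \<phi>) 1 = \<mu>" by (simp add: det1)
  have "coeff (\<beta> \<phi>) 1 = v1 * (- at0 (dx P) * v1 - at0 (dy P) * v2) - v2 * (at0 (dx Q) * v1 + at0 (dy Q) * v2)"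
    using assms coeff_ev_1 by (simp add: \<beta>_def algebra_simps)
  also have "\<dots> = 0" unfolding v by (simp add: algebra_simps)
  finally show "coeff (\<beta> \<phi>) 1 = 0" .
qed (use assms coeff_ev_0 PQ0 in \<open>simp_all add: \<alpha>_def \<beta>_def\<close>)

text \<open>Since w is an eigenvector, moving the curve by c s^N w changes the field to this order
  only in the w-component, by \<mu>' c s^N.\<close>

lemma \<alpha>_perturb:
  assumes "coeff \<phi> 0 = 0" "N \<ge> 1"
  shows "monom 1 (Suc N) dvd \<alpha> (\<phi> + monom c N) - \<alpha> \<phi>"
    and "monom 1 (Suc N) dvd \<beta> (\<phi> + monom c N) - \<beta> \<phi> - monom (c * \<mu>') N"
proof -
  define l where "l p = at0 (dx p) * w1 + at0 (dy p) * w2" for p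
  define D where "D p = ev (\<phi> + monom c N) p - ev \<phi> p - monom (c * l p) N" for p
  have D: "monom 1 (Suc N) dvd D p" for p
    using ev_perturb[OF assms] unfolding D_def l_def .
  have lQ: "l Q = \<mu>' * w1" and lP: "l P = - (\<mu>' * w2)"
    using w by (simp_all add: l_def) (metis add.commute add_uminus_conv_diff minus_diff_eq mult_minus_left diff_minus_eq_add minus_minus)
  have e: "ev (\<phi> + monom c N) p = D p + ev \<phi> p + monom (c * l p) N" for p
    by (simp add: D_def)
  have "\<alpha> (\<phi> + monom c N) - \<alpha> \<phi> = Polynomial.smult w2 (D Q) + Polynomial.smult w1 (D P)
      + monom (c * (w2 * l Q + w1 * l P)) N"
    unfolding \<alpha>_def e by (simp add: smult_add_right smult_monom algebra_simps flip: add_monom)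
  also have "w2 * l Q + w1 * l P = 0" by (simp add: lQ lP)
  finally show "monom 1 (Suc N) dvd \<alpha> (\<phi> + monom c N) - \<alpha> \<phi>"
    using D by (simp add: dvd_add dvd_smult)
  have "\<beta> (\<phi> + monom c N) - \<beta> \<phi> - monom (c * \<mu>') N
      = Polynomial.smult (- v1) (D P) + Polynomial.smult (- v2) (D Q) + monom (c * (- v1 * l P - v2 * l Q - \<mu>')) N"
    unfolding \<beta>_def e
    by (simp add: smult_add_right smult_monom algebra_simps flip: add_monom diff_monom minus_monom)
  also have "- v1 * l P - v2 * l Q - \<mu>' = \<mu>' * (v1 * w2 - v2 * w1) - \<mu>'"
    by (simp add: lQ lP algebra_simps)
  also have "\<dots> = 0" by (simp add: det1)
  finally show "monom 1 (Suc N) dvd \<beta> (\<phi> + monom c N) - \<beta> \<phi> - monom (c * \<mu>') N"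
    using D by (simp add: dvd_diff dvd_smult)
qed

text \<open>For N = 2 the straight line along the eigenvector v works. Adding c s^N to \<phi>
  changes the coefficient of s^N in the defect by c (\<mu>' - N \<mu>); the absence of resonance
  allows c to be chosen so that this coefficient vanishes.\<close>

lemma invariant_curve:
  assumes nonres: "\<And>n. n \<ge> 2 \<Longrightarrow> \<mu>' \<noteq> of_nat n * \<mu>"
  shows "N \<ge> 2 \<Longrightarrow> \<exists>\<phi>. coeff \<phi> 0 = 0 \<and> coeff \<phi> 1 = 0 \<and> monom 1 N dvd defect \<phi>"
proof (induction N rule: nat_induct_at_least)
  case base
  have "coeff (\<beta> 0) k = 0" if "k < 2" for k
    using that \<alpha>_linear[of 0] less_2_cases[OF that] by auto
  thus ?case by (intro exI[of _ 0]) (simp add: defect_def monom_1_dvd_iff')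
next
  case (Suc N)
  then obtain \<phi> where \<phi>: "coeff \<phi> 0 = 0" "coeff \<phi> 1 = 0" "monom 1 N dvd defect \<phi>" by blast
  define c where "c = coeff (defect \<phi>) N / (of_nat N * \<mu> - \<mu>')"
  define \<psi> where "\<psi> = \<phi> + monom c N"
  have "of_nat N * \<mu> - \<mu>' \<noteq> 0" using nonres[of N] Suc.hyps by auto
  hence c: "coeff (defect \<phi>) N + c * (\<mu>' - of_nat N * \<mu>) = 0"
    by (simp add: c_def field_simps)
  define A where "A = \<alpha> \<psi> - \<alpha> \<phi>"
  define B where "B = \<beta> \<psi> - \<beta> \<phi> - monom (c * \<mu>') N"
  define L where "L = \<alpha> \<phi> - [:0, \<mu>:]"
  have A: "monom 1 (Suc N) dvd A" and B: "monom 1 (Suc N) dvd B"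
    using \<alpha>_perturb[OF \<phi>(1), of N c] Suc.hyps unfolding A_def B_def \<psi>_def by simp_all
  have "coeff L k = 0" if "k < 2" for k
    using \<alpha>_linear[OF \<phi>(1,2)] less_2_cases[OF that] by (auto simp: L_def)
  hence "monom 1 2 dvd L" by (simp add: monom_1_dvd_iff')
  moreover have "monom 1 (N - 1) dvd monom (of_nat N * c) (N - 1)" by (simp add: monom_1_dvd_iff')
  ultimately have "monom 1 (N - 1) * monom 1 2 dvd monom (of_nat N * c) (N - 1) * L" by (intro mult_dvd_mono)
  hence L: "monom 1 (Suc N) dvd monom (of_nat N * c) (N - 1) * L"
    using Suc.hyps by (simp add: mult_monom)
  have mu: "monom (of_nat N * c) (N - 1) * [:0, \<mu>:] = monom (of_nat N * c * \<mu>) N"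
  proof -
    have "[:0, \<mu>:] = monom \<mu> 1" by (simp add: monom_altdef)
    thus ?thesis using Suc.hyps by (simp add: mult_monom)
  qed
  have "defect \<psi> = defect \<phi> + monom (c * (\<mu>' - of_nat N * \<mu>)) N
      + (B - pderiv \<psi> * A - monom (of_nat N * c) (N - 1) * L)"
  proof -
    have "pderiv \<psi> = pderiv \<phi> + monom (of_nat N * c) (N - 1)"
      by (simp add: \<psi>_def pderiv_add pderiv_monom)
    moreover have "monom (c * (\<mu>' - of_nat N * \<mu>)) N = monom (c * \<mu>') N - monom (of_nat N * c) (N - 1) * [:0, \<mu>:]"
      unfolding mu by (simp add: diff_monom algebra_simps)
    ultimately show ?thesis
      unfolding defect_def A_def B_def L_def by (simp add: algebra_simps)
  qed
  moreover have "monom 1 (Suc N) dvd B - pderiv \<psi> * A - monom (of_nat N * c) (N - 1) * L"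
    using A B L by (intro dvd_diff) auto
  moreover have "monom 1 (Suc N) dvd defect \<phi> + monom (c * (\<mu>' - of_nat N * \<mu>)) N"
    unfolding monom_1_dvd_iff'
  proof (intro allI impI)
    fix k assume "k < Suc N"
    thus "coeff (defect \<phi> + monom (c * (\<mu>' - of_nat N * \<mu>)) N) k = 0"
      using c \<phi>(3) by (cases "k = N") (auto simp: monom_1_dvd_iff')
  qed
  ultimately have "monom 1 (Suc N) dvd defect \<psi>" by (simp add: dvd_add)
  moreover have "coeff \<psi> 0 = 0" "coeff \<psi> 1 = 0" using \<phi> Suc.hyps by (auto simp: \<psi>_def)
  ultimately show ?case by blast
qed

text \<open>On an invariant curve the vector field would restrict to \<alpha> d/ds. In general the
  discrepancy is the defect times the derivative in direction w.\<close>

lemma pderiv_ev: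
  "\<alpha> \<phi> * pderiv (ev \<phi> p) = ev \<phi> (Q * dx p - P * dy p)
     - defect \<phi> * (Polynomial.smult w1 (ev \<phi> (dx p)) + Polynomial.smult w2 (ev \<phi> (dy p)))"
proof -
  have d: "pderiv (ev \<phi> p) = ev \<phi> (dx p) * pderiv (\<gamma>1 \<phi>) + ev \<phi> (dy p) * pderiv (\<gamma>2 \<phi>)"
    unfolding ev_def
    by (rule chain_rule_general) (simp_all add: comm_ring_hom_pconst pderiv_add pderiv_mult mult.commute pderiv_pCons)
  define a b c e where "a = ev \<phi> Q" and "b = ev \<phi> P" and "c = ev \<phi> (dx p)" and "e = ev \<phi> (dy p)"
  have \<gamma>: "pderiv (\<gamma>1 \<phi>) = [:v1:] + [:w1:] * pderiv \<phi>" "pderiv (\<gamma>2 \<phi>) = [:v2:] + [:w2:] * pderiv \<phi>"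
    by (simp_all add: \<gamma>1_def \<gamma>2_def pderiv_add pderiv_smult pderiv_pCons)
  have s: "Polynomial.smult x q = [:x:] * q" for x and q :: "complex poly" by simp
  have one: "[:v1:] * [:w2:] - [:v2:] * [:w1:] = 1"
    using det1 by (simp add: one_pCons algebra_simps)
  have al: "\<alpha> \<phi> = [:w2:] * a + [:w1:] * b" and be: "\<beta> \<phi> = - [:v1:] * b - [:v2:] * a"
    by (simp_all add: \<alpha>_def \<beta>_def a_def b_def)
  have xy: "(w * a + u * b) * v + (- v * b - z * a) * u = (v * w - z * u) * a"
    "(w * a + u * b) * z + (- v * b - z * a) * w = - ((v * w - z * u) * b)" for u v w z a b :: "complex poly"
    by (simp_all add: algebra_simps)
  have x: "\<alpha> \<phi> * [:v1:] + \<beta> \<phi> * [:w1:] = ([:v1:] * [:w2:] - [:v2:] * [:w1:]) * a"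
    unfolding al be by (rule xy(1))
  have y: "\<alpha> \<phi> * [:v2:] + \<beta> \<phi> * [:w2:] = - (([:v1:] * [:w2:] - [:v2:] * [:w1:]) * b)"
    unfolding al be by (rule xy(2))
  have "\<alpha> \<phi> * pderiv (ev \<phi> p) = (\<alpha> \<phi> * [:v1:] + \<beta> \<phi> * [:w1:]) * c + (\<alpha> \<phi> * [:v2:] + \<beta> \<phi> * [:w2:]) * e
      - defect \<phi> * ([:w1:] * c + [:w2:] * e)"
    unfolding d \<gamma> c_def[symmetric] e_def[symmetric] defect_def by (simp only: algebra_simps)
  also have "\<dots> = a * c - b * e - defect \<phi> * ([:w1:] * c + [:w2:] * e)"
    unfolding x y one by (simp add: algebra_simps)
  finally show ?thesis
    by (simp add: a_def b_def c_def e_def ev.hom_minus ev.hom_mult)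
qed

text \<open>Composition with a polynomial having a simple zero at 0 preserves the order at
  0.\<close>

lemma pcompose_order:
  assumes "r \<noteq> 0" "coeff \<gamma> 0 = 0" "coeff \<gamma> 1 \<noteq> (0::complex)"
  shows "\<not> monom 1 (Suc (order 0 r)) dvd pcompose r \<gamma>"
proof
  assume dvd: "monom 1 (Suc (order 0 r)) dvd pcompose r \<gamma>"
  obtain q where q: "r = [:-0, 1:] ^ order 0 r * q" "\<not> [:-0, 1:] dvd q" using order_decomp[OF assms(1)] by blast
  have "[:0, 1:] dvd \<gamma>" using assms(2) by (simp add: poly_eq_0_iff_dvd[of _ 0, simplified, symmetric] poly_0_coeff_0)
  then obtain u where u: "\<gamma> = [:0, 1:] * u" ..
  have pow: "pcompose (a ^ n) \<gamma> = pcompose a \<gamma> ^ n" for a n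
    by (induction n) (simp_all add: pcompose_mult)
  have "pcompose r \<gamma> = \<gamma> ^ order 0 r * pcompose q \<gamma>"
    by (subst q(1)) (simp add: pcompose_mult pow pcompose_pCons)
  also have "\<dots> = [:0, 1:] ^ order 0 r * (u ^ order 0 r * pcompose q \<gamma>)"
    unfolding u by (simp only: power_mult_distrib mult.assoc)
  finally have "[:0, 1:] ^ order 0 r * [:0, 1:] dvd [:0, 1:] ^ order 0 r * (u ^ order 0 r * pcompose q \<gamma>)"
    using dvd by (simp add: monom_altdef mult.commute)
  hence "[:0, 1:] ^ order 0 r = (0 :: complex poly) \<or> [:0, 1:] dvd u ^ order 0 r * pcompose q \<gamma>"
    by (rule dvd_mult_cancel_left[THEN iffD1])
  moreover have "[:0, 1:] ^ order 0 r \<noteq> (0 :: complex poly)" by simp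
  ultimately have "[:0, 1:] dvd u ^ order 0 r * pcompose q \<gamma>" by blast
  hence "poly (u ^ order 0 r * pcompose q \<gamma>) 0 = 0" by (simp only: poly_eq_0_iff_dvd minus_zero)
  moreover have "poly u 0 \<noteq> 0" using assms(3) by (simp add: u poly_0_coeff_0)
  moreover have "poly (pcompose q \<gamma>) 0 \<noteq> 0"
    using q(2) poly_eq_0_iff_dvd[of q 0] assms(2) by (simp add: poly_pcompose poly_0_coeff_0)
  ultimately show False by simp
qed

text \<open>
  Along the invariant curve the vector field is \<open>(\<mu> s + \<dots>) \<partial>/\<partial>s\<close>, so a function with cofactor
  \<open>k\<close> that does not vanish on the curve vanishes there to an order \<open>n\<close> with \<open>k(0) = n \<mu>\<close>.
\<close>

lemma cofactor_eigenvalue: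
  assumes nonres: "\<And>n. n \<ge> 2 \<Longrightarrow> \<mu>' \<noteq> of_nat n * \<mu>"
    and cop: "coprime g h" and gh0: "at0 g = 0" "at0 h = 0"
    and k: "Q * dx g - P * dy g = k * g" "Q * dx h - P * dy h = k * h"
  shows "\<exists>n\<ge>1. at0 k = of_nat n * \<mu>"
proof -
  obtain r where r: "r \<noteq> 0" "[:r:] \<in> idl g h" using coprime_eliminate_y[OF cop] .
  obtain s where s: "s \<noteq> 0" "swp [:s:] \<in> idl g h" using coprime_eliminate_x[OF cop] .
  \<comment> \<open>One component of the curve has a nonzero linear term; along the curve r(x) or
    s(y), respectively, vanishes to order exactly \<open>K\<close>. So g or h vanishes there to
    order at most \<open>K\<close>.\<close>
  define K where "K = (if v1 \<noteq> 0 then order 0 r else order 0 s)"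
  \<comment> \<open>With a defect divisible by s^(K + 2), the coefficients of s^n with n at most
    \<open>K\<close>, compared below, do not see it.\<close>
  obtain \<phi> where \<phi>: "coeff \<phi> 0 = 0" "coeff \<phi> 1 = 0" "monom 1 (K + 2) dvd defect \<phi>"
    using invariant_curve[OF nonres, of "K + 2"] by auto
  have "\<exists>p\<in>idl g h. \<not> monom 1 (Suc K) dvd ev \<phi> p"
  proof (cases "v1 = 0")
    case False
    have "ev \<phi> [:r:] = pcompose r (\<gamma>1 \<phi>)"
      by (simp add: ev_def eval2_const_y comm_ring_hom_pconst eval_poly_pconst)
    moreover have "\<not> monom 1 (Suc K) dvd pcompose r (\<gamma>1 \<phi>)"
      using False pcompose_order[OF r(1), of "\<gamma>1 \<phi>"] \<phi> by (simp add: K_def \<gamma>1_def)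
    ultimately show ?thesis using r by metis
  next
    case True
    hence "v2 \<noteq> 0" using det1 by auto
    have "ev \<phi> (swp [:s:]) = pcompose s (\<gamma>2 \<phi>)"
      using eval2_pconst_subst2_swp[of varx vary s "\<gamma>1 \<phi>" "\<gamma>2 \<phi>"]
      by (simp add: ev_def eval2_vary comm_ring_hom_pconst)
    moreover have "\<not> monom 1 (Suc K) dvd pcompose s (\<gamma>2 \<phi>)"
      using True \<open>v2 \<noteq> 0\<close> pcompose_order[OF s(1), of "\<gamma>2 \<phi>"] \<phi> by (simp add: K_def \<gamma>2_def)
    ultimately show ?thesis using s by metis
  qed
  then obtain U V where "\<not> monom 1 (Suc K) dvd ev \<phi> (U * g + V * h)" by (auto simp: idl_def)
  hence "\<not> monom 1 (Suc K) dvd ev \<phi> g \<or> \<not> monom 1 (Suc K) dvd ev \<phi> h"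
    by (auto simp: ev.hom_add ev.hom_mult)
  then obtain f where f: "\<not> monom 1 (Suc K) dvd ev \<phi> f" "at0 f = 0" "Q * dx f - P * dy f = k * f"
    using gh0 k by blast
  define G where "G = ev \<phi> f"
  obtain j where j: "coeff G j \<noteq> 0" "j \<le> K" using f(1) by (auto simp: monom_1_dvd_iff' G_def)
  define n where "n = (LEAST j. coeff G j \<noteq> 0)"
  have n: "coeff G n \<noteq> 0" unfolding n_def by (rule LeastI[of _ j]) (rule j)
  have "n \<le> K" using j Least_le[of "\<lambda>j. coeff G j \<noteq> 0" j] unfolding n_def by simp
  have "coeff G i = 0" if "i < n" for i using that not_less_Least unfolding n_def by blast
  hence "monom 1 n dvd G" by (simp add: monom_1_dvd_iff')
  then obtain G1 where G1: "G = monom 1 n * G1" ..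
  have "coeff G 0 = 0" using coeff_ev_0[OF \<phi>(1), of f] f by (simp add: G_def)
  with n have "n \<noteq> 0" by metis
  have "monom 1 1 dvd \<alpha> \<phi>" using \<alpha>_linear[OF \<phi>(1,2)] by (simp add: monom_1_dvd_iff')
  then obtain \<alpha>1 where \<alpha>1: "\<alpha> \<phi> = monom 1 1 * \<alpha>1" ..
  have \<alpha>10: "coeff \<alpha>1 0 = \<mu>" using \<alpha>_linear(2)[OF \<phi>(1,2)] by (simp add: \<alpha>1 coeff_monom_mult)
  have G10: "coeff G1 0 = coeff G n" by (simp add: G1 coeff_monom_mult)
  have "\<alpha> \<phi> * pderiv G = monom 1 n * (\<alpha>1 * (of_nat n * G1 + monom 1 1 * pderiv G1))"
  proof -
    have *: "monom 1 n = monom 1 1 * monom (1::complex) (n - 1)" "monom (of_nat n) (n - 1) = of_nat n * monom (1::complex) (n - 1)"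
      using \<open>n \<noteq> 0\<close> by (simp_all add: mult_monom of_nat_poly smult_monom)
    have "pderiv G = monom 1 n * pderiv G1 + of_nat n * monom 1 (n - 1) * G1"
      by (simp add: G1 pderiv_mult pderiv_monom *(2)[unfolded One_nat_def])
    thus ?thesis unfolding \<alpha>1 *(1) by (simp only: algebra_simps)
  qed
  hence "coeff (\<alpha> \<phi> * pderiv G) n = \<mu> * (of_nat n * coeff G n)"
    by (simp add: coeff_monom_mult coeff_mult_0 \<alpha>10 G10 of_nat_poly)
  moreover have "coeff (\<alpha> \<phi> * pderiv G) n = at0 k * coeff G n"
  proof -
    define R where "R = defect \<phi> * (Polynomial.smult w1 (ev \<phi> (dx f)) + Polynomial.smult w2 (ev \<phi> (dy f)))"
    have "monom 1 (K + 2) dvd R" using \<phi>(3) by (simp add: R_def)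
    hence "coeff R n = 0" using \<open>n \<le> K\<close> unfolding monom_1_dvd_iff' by simp
    moreover have "\<alpha> \<phi> * pderiv G = monom 1 n * (ev \<phi> k * G1) - R"
      using pderiv_ev[of \<phi> f] by (simp add: G_def[symmetric] f(3) ev.hom_mult R_def[symmetric])
        (simp add: G1 mult_ac)
    ultimately show ?thesis
      by (simp add: coeff_monom_mult coeff_mult_0 G10 coeff_ev_0[OF \<phi>(1)])
  qed
  ultimately have "at0 k = of_nat n * \<mu>" using n by simp
  thus ?thesis using \<open>n \<noteq> 0\<close> by (intro exI[of _ n]) simp
qed

end

section \<open>Eigenvalues and eigenvectors of the linear part\<close>

lemma det_2:
  fixes A :: "'a::comm_ring_1 mat"
  assumes "A \<in> carrier_mat 2 2"
  shows "det A = A $$ (0, 0) * A $$ (1, 1) - A $$ (0, 1) * A $$ (1, 0)"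
proof -
  have d1: "det B = B $$ (0, 0)" if "B \<in> carrier_mat 1 1" for B :: "'a mat"
    using det_upper_triangular[of B 1] that by (auto simp: upper_triangular_def diag_mat_def)
  have "det A = (\<Sum>i<2. A $$ (i, 0) * cofactor A i 0)"
    using laplace_expansion_column[OF assms, of 0] by simp
  also have "\<dots> = A $$ (0, 0) * det (mat_delete A 0 0) - A $$ (1, 0) * det (mat_delete A 1 0)"
    by (simp add: cofactor_def numeral_2_eq_2)
  also have "det (mat_delete A 0 0) = A $$ (1, 1)"
    using assms by (subst d1) (auto simp: mat_delete_def)
  also have "det (mat_delete A 1 0) = A $$ (0, 1)"
    using assms by (subst d1) (auto simp: mat_delete_def)
  finally show ?thesis by (simp add: mult.commute)
qed

lemma char_poly_linear_part:
  assumes "jet_order (P, Q) = 1"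
  defines "a \<equiv> at0 (dx Q)" and "b \<equiv> at0 (dy Q)" and "c \<equiv> - at0 (dx P)" and "d \<equiv> - at0 (dy P)"
  shows "char_poly (linear_part (P, Q)) = [:a * d - b * c, - (a + d), 1:]"
proof -
  have e: "eval2 id p 0 0 = at0 p" for p
  proof -
    have h: "comm_ring_hom (\<lambda>a. a :: complex)" by standard simp_all
    interpret e: comm_ring_hom "\<lambda>p. eval2 (\<lambda>a. a :: complex) p 0 0"
      by (intro comm_ring_hom_eval2 h)
    show ?thesis unfolding id_def
      by (induction p rule: poly2_induct)
         (simp_all add: eval2_const2 eval2_varx eval2_vary h e.hom_add e.hom_mult at0.hom_add at0.hom_mult)
  qed
  have 1: "at0 (dx (hom_part 1 p)) = at0 (dx p)" "at0 (dy (hom_part 1 p)) = at0 (dy p)" for p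
    by (simp_all add: at0_def dx_def dy_def coeff_map_poly coeff_pderiv coeff_hom_part)
  have m: "linear_part (P, Q) = mat_of_rows_list 2 [[a, b], [c, d]]"
    by (rule eq_matI)
       (auto simp: linear_part_def first_jet_def assms(1) mat_of_rows_list_def less_2_cases_iff e e[unfolded id_def] 1 1[unfolded One_nat_def] a_def b_def c_def d_def
          at0.hom_uminus simp flip: One_nat_def)
  show ?thesis unfolding m char_poly_def
    by (subst det_2) (auto simp: char_poly_matrix_def mat_of_rows_list_def algebra_simps)
qed

lemma eigenvector_2:
  fixes a b c d \<mu> :: complex
  assumes "(a - \<mu>) * (d - \<mu>) = b * c"
  obtains x y where "(x, y) \<noteq> (0, 0)" "a * x + b * y = \<mu> * x" "c * x + d * y = \<mu> * y"
proof -
  consider "b \<noteq> 0 \<or> a \<noteq> \<mu>" | "c \<noteq> 0 \<or> d \<noteq> \<mu>" | "a = \<mu>" "b = 0" "c = 0" "d = \<mu>" by blast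
  thus thesis
  proof cases
    case 1
    thus thesis using assms by (intro that[of "- b" "a - \<mu>"]) (auto simp: algebra_simps)
  next
    case 2
    thus thesis using assms by (intro that[of "d - \<mu>" "- c"]) (auto simp: algebra_simps)
  next
    case 3
    thus thesis by (intro that[of 1 0]) auto
  qed
qed

lemma indeterminate_imp_not_simple:
  assumes nz: "\<omega> \<noteq> (0, 0)" and cop: "coprime g (h :: poly2)" and fi: "first_integral \<omega> g h"
    and gh0: "at0 g = 0" "at0 h = 0"
  shows "\<not> simple \<omega>"
proof
  assume simple: "simple \<omega>"
  obtain P Q where \<omega>: "\<omega> = (P, Q)" by force
  define a b c d where "a = at0 (dx Q)" and "b = at0 (dy Q)" and "c = - at0 (dx P)" and "d = - at0 (dy P)"
  have jo: "jet_order (P, Q) = 1" using simple by (simp add: simple_def \<omega>)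
  obtain \<mu> \<mu>' where "char_poly (linear_part (P, Q)) = [:- \<mu>, 1:] * [:- \<mu>', 1:]"
    and dis: "\<mu> * \<mu>' \<noteq> 0 \<and> \<not> (\<exists>r::rat. r > 0 \<and> \<mu> / \<mu>' = of_rat r) \<or> \<mu> * \<mu>' = 0 \<and> \<mu>\<^sup>2 + \<mu>'\<^sup>2 \<noteq> 0"
    using simple by (auto simp: simple_def \<omega>)
  hence tr: "a * d - b * c = \<mu> * \<mu>'" "a + d = \<mu> + \<mu>'"
    using char_poly_linear_part[OF jo] by (simp_all add: a_def b_def c_def d_def) (simp add: algebra_simps eq_neg_iff_add_eq_0)
  \<comment> \<open>This condition on the eigenvalues, which includes the case of one zero
    eigenvalue, yields that they are distinct, that neither separatrix meets a resonance, and the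
    final contradiction.\<close>
  have ratio: "of_nat i * \<mu> \<noteq> of_nat j * \<mu>'" if "i \<ge> 1" "j \<ge> 1" for i j
  proof
    assume eq: "of_nat i * \<mu> = of_nat j * \<mu>'"
    show False
    proof (cases "\<mu> * \<mu>' = 0")
      case True
      thus False using eq dis that by auto
    next
      case False
      hence "\<mu> / \<mu>' = of_nat j / of_nat i" using eq that by (simp add: field_simps)
      also have "\<dots> = of_rat (of_nat j / of_nat i)" by (simp add: of_rat_divide)
      finally have "\<mu> / \<mu>' = of_rat (of_nat j / of_nat i)" .
      moreover have "(of_nat j / of_nat i :: rat) > 0" using that by simp
      ultimately show False using dis False by blast
    qed
  qed
  have nonres: "\<mu>' \<noteq> of_nat n * \<mu>" "\<mu> \<noteq> of_nat n * \<mu>'" if "n \<ge> 1" for n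
    using ratio[of n 1] ratio[of 1 n] that by auto
  hence ne: "\<mu> \<noteq> \<mu>'" using nonres[of 1] by auto
  have ch: "(a - \<mu>) * (d - \<mu>) = b * c" "(a - \<mu>') * (d - \<mu>') = b * c"
  proof -
    have "(a - x) * (d - x) - b * c = (a * d - b * c) - x * (a + d) + x * x" for x
      by (simp add: algebra_simps)
    from this[of \<mu>] this[of \<mu>'] show "(a - \<mu>) * (d - \<mu>) = b * c" "(a - \<mu>') * (d - \<mu>') = b * c"
      unfolding tr by (simp_all add: algebra_simps)
  qed
  obtain v1 v2 where v: "(v1, v2) \<noteq> (0, 0)" "a * v1 + b * v2 = \<mu> * v1" "c * v1 + d * v2 = \<mu> * v2"
    using eigenvector_2[OF ch(1)] .
  obtain w1' w2' where w': "(w1', w2') \<noteq> (0, 0)" "a * w1' + b * w2' = \<mu>' * w1'" "c * w1' + d * w2' = \<mu>' * w2'"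
    using eigenvector_2[OF ch(2)] .
  define D where "D = v1 * w2' - v2 * w1'"
  have "D \<noteq> 0"
  proof
    assume "D = 0"
    hence D: "v1 * w2' = v2 * w1'" by (simp add: D_def)
    have "(\<mu> - \<mu>') * (v1 * w1') = (\<mu> * v1) * w1' - (\<mu>' * w1') * v1" by (simp add: algebra_simps)
    also have "\<dots> = b * (v2 * w1' - v1 * w2')" unfolding v(2)[symmetric] w'(2)[symmetric] by (simp add: algebra_simps)
    finally have 1: "v1 * w1' = 0" using D ne by simp
    have "(\<mu> - \<mu>') * (v2 * w2') = (\<mu> * v2) * w2' - (\<mu>' * w2') * v2" by (simp add: algebra_simps)
    also have "\<dots> = c * (v1 * w2' - v2 * w1')" unfolding v(3)[symmetric] w'(3)[symmetric] by (simp add: algebra_simps)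
    finally have 2: "v2 * w2' = 0" using D ne by simp
    from 1 2 D v(1) w'(1) show False by (cases "v1 = 0") auto
  qed
  define w1 w2 where "w1 = w1' / D" and "w2 = w2' / D"
  have det: "v1 * w2 - v2 * w1 = 1"
  proof -
    have "v1 * w2 - v2 * w1 = (v1 * w2' - v2 * w1') / D" by (simp add: w1_def w2_def diff_divide_distrib)
    thus ?thesis using \<open>D \<noteq> 0\<close> unfolding D_def[symmetric] by simp
  qed
  have w: "a * w1 + b * w2 = \<mu>' * w1" "c * w1 + d * w2 = \<mu>' * w2"
    using w'(2,3) \<open>D \<noteq> 0\<close> by (simp_all add: w1_def w2_def field_simps)
  have PQ0: "at0 P = 0" "at0 Q = 0"
    using jet_order_props(1,2)[of P Q] nz jo by (auto simp: \<omega> ord_ge_def at0_def)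
  obtain k where k: "Q * dx g - P * dy g = k * g" "Q * dx h - P * dy h = k * h"
    using cofactor[OF cop fi[unfolded \<omega>] gh0] .
  interpret E1: eigenbasis P Q v1 v2 w1 w2 \<mu> \<mu>'
    using PQ0 v w det unfolding a_def b_def c_def d_def by unfold_locales simp_all
  \<comment> \<open>For the second separatrix the roles are exchanged; the sign keeps the
    determinant equal to 1.\<close>
  interpret E2: eigenbasis P Q "- w1" "- w2" v1 v2 \<mu>' \<mu>
    using PQ0 v w det unfolding a_def b_def c_def d_def
    by unfold_locales (simp_all add: algebra_simps)
  obtain n where n: "n \<ge> 1" "at0 k = of_nat n * \<mu>"
    using E1.cofactor_eigenvalue[OF _ cop gh0 k] nonres by auto
  obtain n' where n': "n' \<ge> 1" "at0 k = of_nat n' * \<mu>'"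
    using E2.cofactor_eigenvalue[OF _ cop gh0 k] nonres by auto
  show False using ratio[OF n(1) n'(1)] n n' by simp
qed

lemma indeterminate_imp_ordinary:
  assumes "\<omega> \<noteq> (0, 0)" "coprime g (h :: poly2)" "first_integral \<omega> g h" "at0 g = 0" "at0 h = 0"
  shows "ordinary \<omega>"
  using indeterminate_imp_singular[OF assms] indeterminate_imp_not_simple[OF assms]
  by (simp add: ordinary_def)

subsection \<open>Indeterminacy points are the dicritical points\<close>

lemma degree_eq_if_wronskian_eq_0:
  fixes p q :: "complex poly"
  assumes "q * pderiv p = p * pderiv q" "p \<noteq> 0" "q \<noteq> 0"
  shows "degree p = degree q"
proof (cases "pderiv p = 0 \<or> pderiv q = 0")
  case True
  hence "pderiv p = 0 \<and> pderiv q = 0" using assms by auto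
  thus ?thesis by (simp add: pderiv_eq_0_iff)
next
  case False
  hence deg: "degree p > 0" "degree q > 0" by (auto simp: pderiv_eq_0_iff)
  have lc: "lead_coeff (pderiv r) = of_nat (degree r) * lead_coeff r" if "degree r > 0" for r :: "complex poly"
    using that by (simp add: degree_pderiv coeff_pderiv of_nat_diff)
  have "lead_coeff (q * pderiv p) = lead_coeff (p * pderiv q)" using assms by simp
  hence "lead_coeff q * (of_nat (degree p) * lead_coeff p) = lead_coeff p * (of_nat (degree q) * lead_coeff q)"
    unfolding lead_coeff_mult lc[OF deg(1)] lc[OF deg(2)] .
  hence "of_nat (degree p) = (of_nat (degree q) :: complex)"
    using assms by simp
  thus ?thesis by simp
qed

text \<open>Subtracting from q the multiple of p that cancels the leading term keeps the Wronskian
  zero but changes the degree, so by the preceding lemma the difference is 0.\<close>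

lemma wronskian_eq_0_imp_dependent:
  fixes p q :: "complex poly"
  assumes "q * pderiv p = p * pderiv q"
  obtains a b where "(a, b) \<noteq> (0, 0)" "Polynomial.smult a p + Polynomial.smult b q = 0"
proof (cases "p = 0 \<or> q = 0")
  case True
  thus thesis using that[of 1 0] that[of 0 1] by auto
next
  case False
  define c where "c = lead_coeff q / lead_coeff p"
  define q' where "q' = q - Polynomial.smult c p"
  have w: "q' * pderiv p = p * pderiv q'"
    using assms by (simp add: q'_def pderiv_diff pderiv_smult algebra_simps)
  have deg: "degree p = degree q" using degree_eq_if_wronskian_eq_0[OF assms] False by simp
  have "q' = 0"
  proof (rule ccontr)
    assume nz: "q' \<noteq> 0"
    hence "degree q' = degree q" using degree_eq_if_wronskian_eq_0[OF w] False deg by simp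
    moreover have "coeff q' (degree q) = 0" using False by (simp add: q'_def c_def flip: deg)
    ultimately show False using nz by (metis leading_coeff_0_iff)
  qed
  thus thesis using that[of "- c" 1] by (simp add: q'_def)
qed

definition dicritical_origin :: "form \<Rightarrow> bool" where
  "dicritical_origin \<omega> \<longleftrightarrow> (\<exists>ds. (\<forall>k\<le>length ds. ordinary (fold strict_transform (take k ds) \<omega>)) \<and>
     terminal_dicritical (fold strict_transform ds \<omega>))"

lemma dicritical_singularity_iff: "dicritical_singularity \<omega> p \<longleftrightarrow> dicritical_origin (translate p \<omega>)"
  by (auto simp: dicritical_singularity_def dicritical_origin_def singular_configuration_def form_at_def)

lemma dicritical_origin_blowup:
  assumes "ordinary \<omega>" "dicritical_origin (strict_transform d \<omega>)"
  shows "dicritical_origin \<omega>"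
proof -
  obtain ds where ds: "\<forall>k\<le>length ds. ordinary (fold strict_transform (take k ds) (strict_transform d \<omega>))"
      "terminal_dicritical (fold strict_transform ds (strict_transform d \<omega>))"
    using assms(2) unfolding dicritical_origin_def by blast
  have "ordinary (fold strict_transform (take k (d # ds)) \<omega>)" if "k \<le> length (d # ds)" for k
    using that ds assms(1) by (cases k) auto
  thus ?thesis using ds(2) unfolding dicritical_origin_def by (intro exI[of _ "d # ds"]) auto
qed

lemma coeff_restr_blow:
  assumes "blow p = varx ^ m * q"
  shows "coeff (restr q) j = (if j \<le> m then coeff (coeff p j) (m - j) else 0)"
proof -
  have "coeff (coeff (varx ^ m * q) j) m = coeff (coeff (blow p) j) m" using assms by simp
  thus ?thesis by (simp add: coeff_varx_power_mult coeff_coeff_blow coeff_restr)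
qed

lemma degree_restr_blow:
  assumes "blow p = varx ^ m * q" shows "degree (restr q) \<le> m"
  using coeff_restr_blow[OF assms] by (intro degree_le) auto

lemma coprime_linear:
  assumes "coprime g (h :: poly2)" "b \<noteq> 0" shows "coprime g (const2 a * g + const2 b * h)"
proof (rule coprimeI)
  fix d assume d: "d dvd g" "d dvd const2 a * g + const2 b * h"
  hence "d dvd (const2 a * g + const2 b * h) - const2 a * g" by (intro dvd_diff dvd_mult)
  hence "d dvd const2 (inverse b) * (const2 b * h)" by simp
  hence "d dvd h" using assms(2) by (simp add: mult.assoc[symmetric] const2.hom_one flip: const2.hom_mult)
  with d assms(1) show "is_unit d" by (metis coprime_common_divisor)
qed

lemma idl_linear:
  assumes "b \<noteq> 0" shows "idl g (const2 a * g + const2 b * h) = idl g h"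
proof
  show "idl g (const2 a * g + const2 b * h) \<subseteq> idl g h"
  proof
    fix p assume "p \<in> idl g (const2 a * g + const2 b * h)"
    then obtain U V where "p = U * g + V * (const2 a * g + const2 b * h)" by (auto simp: idl_def)
    hence "p = (U + V * const2 a) * g + (V * const2 b) * h" by (simp add: algebra_simps)
    thus "p \<in> idl g h" using idlI by metis
  qed
  show "idl g h \<subseteq> idl g (const2 a * g + const2 b * h)"
  proof
    fix p assume "p \<in> idl g h"
    then obtain U V where p: "p = U * g + V * h" by (auto simp: idl_def)
    have inv: "const2 (inverse b) * const2 b = 1" using assms by (simp add: const2.hom_one flip: const2.hom_mult)
    have "(U - V * const2 (inverse b) * const2 a) * g + V * const2 (inverse b) * (const2 a * g + const2 b * h)
        = U * g + V * (const2 (inverse b) * const2 b) * h" by (simp add: algebra_simps)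
    hence "p = (U - V * const2 (inverse b) * const2 a) * g + V * const2 (inverse b) * (const2 a * g + const2 b * h)"
      using inv p by simp
    thus "p \<in> idl g (const2 a * g + const2 b * h)" using idlI by metis
  qed
qed

lemma idl_commute: "idl g h = idl h g"
  unfolding idl_def by (metis add.commute)

text \<open>
  The point to continue with is a zero of \<open>g\<close> on the exceptional divisor, where \<open>h/g\<close> vanishes
  identically.
\<close>

lemma next_indeterminate_aux:
  assumes nz: "\<omega> \<noteq> (0, 0)" and cop: "coprime g h" and fi: "first_integral \<omega> g h"
    and g: "blow g = varx ^ m * g3" and h: "blow h = varx ^ m * h3"
    and r: "restr g3 \<noteq> 0" "restr h3 = 0" and m: "m > 0"
  shows "\<exists>d g' h'. coprime g' h' \<and> at0 g' = 0 \<and> at0 h' = 0 \<and> first_integral (strict_transform d \<omega>) g' h'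
     \<and> (\<forall>n. colength_ge n g' h' \<longrightarrow> colength_ge (Suc n) g h)"
proof (cases "degree (restr g3) = 0")
  case False
  then obtain t where t: "poly (restr g3) t = 0"
    by (metis constant_degree fundamental_theorem_of_algebra)
  define g' where "g' = shifty t g3"
  define h' where "h' = shifty t h3"
  have bg: "blowt t g = varx ^ m * g'" and bh: "blowt t h = varx ^ m * h'"
    by (simp_all add: blowt_shifty g h g'_def h'_def shifty.hom_mult shifty.hom_power)
  have rg: "restr g' = pcompose (restr g3) [:t, 1:]" by (simp add: g'_def restr_shifty)
  have rg0: "restr g' \<noteq> 0" using r(1) by (simp add: rg pcompose_eq_0_iff)
  have dg: "degree (restr g') \<le> m"
    using degree_restr_blow[OF g] by (simp add: rg degree_pcompose)
  have 1: "at0 g' = 0" "at0 h' = 0"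
    using t r(2) by (simp_all add: at0_restr rg h'_def restr_shifty poly_pcompose)
  have 2: "coprime g' h'"
    by (rule coprime_blowt[OF cop bg bh]) (use rg0 in \<open>simp add: varx_dvd_iff\<close>)
  have "first_integral (strict_transform (Some t) \<omega>) (varx ^ m * g') (varx ^ m * h')"
    using first_integral_strict_transform[OF nz fi, of "Some t"] bg bh by (simp add: blowt_def)
  hence 3: "first_integral (strict_transform (Some t) \<omega>) g' h'"
    by (subst (asm) first_integral_scale) simp_all
  have 4: "colength_ge (Suc n) g h" if "colength_ge n g' h'" for n
    by (rule colength_blowt[OF bg bh rg0 dg m that])
  show ?thesis using 1 2 3 4 by blast
next
  \<comment> \<open>The part of degree m of g is then a multiple of x^m. Its only zero on the
    exceptional divisor is the direction of x = 0, which lies in the second chart.\<close>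
  case True
  have "coeff (coeff g j) (m - j) = coeff (restr g3) j" "coeff (coeff h j) (m - j) = 0" if "j \<le> m" for j
    using that coeff_restr_blow[OF g, of j] coeff_restr_blow[OF h, of j] r(2) by simp_all
  note cf = this[of 0] this[of m]
  have "ord_ge m g" "ord_ge m h"
    using g h by (metis varx_power_dvd_blow_iff dvd_triv_left)+
  hence "ord_ge m (swp g)" "ord_ge m (swp h)" by (simp_all add: ord_ge_swp)
  then obtain g4 h4 where bg: "blowt 0 (swp g) = varx ^ m * g4" and bh: "blowt 0 (swp h) = varx ^ m * h4"
    by (auto simp: varx_power_dvd_blow_iff[symmetric] blowt_shifty elim!: dvdE)
  have bg': "blow (swp g) = varx ^ m * g4" and bh': "blow (swp h) = varx ^ m * h4"
    using bg bh by (simp_all add: blowt_shifty)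
  have "coeff (restr g4) m = coeff (restr g3) 0"
    using coeff_restr_blow[OF bg', of m] cf by (simp add: coeff_swp)
  also have "\<dots> \<noteq> 0" using True r(1) by (metis leading_coeff_0_iff)
  finally have rg0: "restr g4 \<noteq> 0" by auto
  have "coeff (restr g3) m = 0" using True m by (simp add: coeff_eq_0)
  hence 1: "at0 g4 = 0" "at0 h4 = 0"
    using coeff_restr_blow[OF bg', of 0] coeff_restr_blow[OF bh', of 0] cf
    by (simp_all add: at0_restr poly_0_coeff_0 coeff_swp)
  have "coprime g4 h4"
    by (rule coprime_blowt[OF _ bg bh]) (use rg0 cop in \<open>simp_all add: varx_dvd_iff swp_coprime\<close>)
  hence 2: "coprime (swp g4) (swp h4)" by (simp add: swp_coprime)
  have "first_integral (strict_transform None \<omega>) (vary ^ m * swp g4) (vary ^ m * swp h4)"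
    using first_integral_strict_transform[OF nz fi, of None]
    by (simp add: subst2_chart_None bg bh swp.hom_mult swp.hom_power)
  hence 3: "first_integral (strict_transform None \<omega>) (swp g4) (swp h4)"
    by (subst (asm) first_integral_scale) simp_all
  have 4: "colength_ge (Suc n) g h" if "colength_ge n (swp g4) (swp h4)" for n
  proof -
    have "colength_ge n g4 h4" using colength_ge_swp[OF that] by simp
    hence "colength_ge (Suc n) (swp g) (swp h)"
      by (rule colength_blowt[OF bg bh rg0 degree_restr_blow[OF bg'] m])
    thus ?thesis using colength_ge_swp by fastforce
  qed
  show ?thesis using 1 2 3 4 by (metis at0_swp)
qed

text \<open>As the point is not terminal dicritical, the exceptional divisor is invariant: after
  division by the power of x the second coefficient vanishes on it and the first does not. Hence
  g1/h1 is constant there, and some combination of g1 and h1 vanishes on it identically. The same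
  combination of g and h replaces one of them, without changing the ideal.\<close>

lemma next_indeterminate:
  assumes nz: "\<omega> \<noteq> (0, 0)" and cop: "coprime g h" and fi: "first_integral \<omega> g h"
    and gh0: "at0 g = 0" "at0 h = 0" and sing: "singular \<omega>" and nt: "\<not> terminal_dicritical \<omega>"
  shows "\<exists>d g' h'. coprime g' h' \<and> at0 g' = 0 \<and> at0 h' = 0 \<and> first_integral (strict_transform d \<omega>) g' h'
     \<and> (\<forall>n. colength_ge n g' h' \<longrightarrow> colength_ge (Suc n) g h)"
proof -
  obtain P Q where \<omega>: "\<omega> = (P, Q)" by force
  define \<nu> where "\<nu> = jet_order (P, Q)"
  obtain P' Q' where PQ: "blow P = varx ^ \<nu> * P'" "blow Q = varx ^ \<nu> * Q'" "restr (P' + vary * Q') \<noteq> 0"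
    using jet_order_blow[of P Q] nt nz sing unfolding \<nu>_def \<omega> by metis
  have "g \<noteq> 0 \<or> h \<noteq> 0" using cop by auto
  hence "blow g \<noteq> 0 \<or> blow h \<noteq> 0" by simp
  then obtain m g1 h1 where gh: "blow g = varx ^ m * g1" "blow h = varx ^ m * h1" "restr g1 \<noteq> 0 \<or> restr h1 \<noteq> 0"
    using varx_decompose by blast
  have m: "m > 0"
  proof (rule ccontr)
    assume "\<not> m > 0"
    thus False using gh gh0 restr_blow[of g] restr_blow[of h] by simp
  qed
  have pb: "pullback varx (varx * vary) (P, Q) = (varx ^ \<nu> * (P' + vary * Q'), varx ^ \<nu> * (varx * Q'))"
    by (simp add: pullback_blow PQ(1,2) algebra_simps)
  have "first_integral (P' + vary * Q', varx * Q') g1 h1"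
    using first_integral_pullback[OF fi[unfolded \<omega>], of varx "varx * vary"] unfolding blow_def[symmetric] pb gh(1,2)
    by (simp add: first_integral_scale_form first_integral_scale)
  hence "restr (varx * Q' * wronx g1 h1) = restr ((P' + vary * Q') * wrony g1 h1)"
    by (simp add: first_integral_def)
  hence "restr (wrony g1 h1) = 0" using PQ(3) by (simp add: restr.hom_mult)
  hence "restr h1 * pderiv (restr g1) = restr g1 * pderiv (restr h1)"
    by (simp add: wrony_def restr.hom_minus restr.hom_mult pderiv_restr)
  then obtain a b where ab: "(a, b) \<noteq> (0, 0)" "Polynomial.smult a (restr g1) + Polynomial.smult b (restr h1) = 0"
    by (rule wronskian_eq_0_imp_dependent)
  show ?thesis
  proof (cases "b = 0")
    case False
    define h2 where "h2 = const2 a * g + const2 b * h"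
    have "blow h2 = varx ^ m * (const2 a * g1 + const2 b * h1)"
      using gh by (simp add: h2_def blow.hom_add blow.hom_mult) (simp add: blow_def algebra_simps)
    moreover have "restr (const2 a * g1 + const2 b * h1) = 0"
      using ab(2) by (simp add: restr.hom_add restr.hom_mult)
    moreover have "restr g1 \<noteq> 0" using ab(2) gh(3) False by auto
    moreover have "first_integral \<omega> g h2"
      using first_integral_linear[OF fi, of 1 0 a b] by (simp add: h2_def const2.hom_zero const2.hom_one)
    moreover have "coprime g h2" unfolding h2_def by (rule coprime_linear[OF cop False])
    ultimately have "\<exists>d g' h'. coprime g' h' \<and> at0 g' = 0 \<and> at0 h' = 0 \<and> first_integral (strict_transform d \<omega>) g' h'
     \<and> (\<forall>n. colength_ge n g' h' \<longrightarrow> colength_ge (Suc n) g h2)"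
      using next_indeterminate_aux[OF nz _ _ gh(1)] m by blast
    moreover have "colength_ge (Suc n) g h2 = colength_ge (Suc n) g h" for n
      unfolding h2_def by (rule colength_ge_cong[OF idl_linear[OF False]])
    ultimately show ?thesis by simp
  next
    case True
    hence "restr g1 = 0" using ab by simp
    hence "\<exists>d g' h'. coprime g' h' \<and> at0 g' = 0 \<and> at0 h' = 0 \<and> first_integral (strict_transform d \<omega>) g' h'
     \<and> (\<forall>n. colength_ge n g' h' \<longrightarrow> colength_ge (Suc n) h g)"
      using next_indeterminate_aux[OF nz _ _ gh(2,1)] gh(3) m cop fi coprime_commute first_integral_commute by blast
    moreover have "colength_ge (Suc n) h g = colength_ge (Suc n) g h" for n
      by (rule colength_ge_cong[OF idl_commute])
    ultimately show ?thesis by simp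
  qed
qed

text \<open>Otherwise no point of the chain of indeterminacy points is terminal dicritical, so the
  chain never stops. As the colength drops at each blowup, it would be at least every n.\<close>

lemma dicritical_origin_if_indeterminate:
  assumes "\<omega> \<noteq> (0, 0)" "coprime g h" "first_integral \<omega> g h" "at0 g = 0" "at0 h = 0"
  shows "dicritical_origin \<omega>"
proof (rule ccontr)
  assume nd: "\<not> dicritical_origin \<omega>"
  have "colength_ge n g h" for n
    using assms nd
  proof (induction n arbitrary: \<omega> g h)
    case (Suc n)
    have ord: "ordinary \<omega>" using indeterminate_imp_ordinary[OF Suc.prems(1-5)] .
    have "\<not> terminal_dicritical \<omega>"
    proof
      assume "terminal_dicritical \<omega>"
      hence "dicritical_origin \<omega>" using ord unfolding dicritical_origin_def by (intro exI[of _ "[]"]) simp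
      thus False using Suc.prems by simp
    qed
    then obtain d g' h' where *: "coprime g' h'" "at0 g' = 0" "at0 h' = 0"
        "first_integral (strict_transform d \<omega>) g' h'" "colength_ge n g' h' \<longrightarrow> colength_ge (Suc n) g h"
      using next_indeterminate[OF Suc.prems(1-5)] ord unfolding ordinary_def by blast
    have "\<not> dicritical_origin (strict_transform d \<omega>)"
      using dicritical_origin_blowup[OF ord] Suc.prems by blast
    with * Suc.IH strict_transform_nonzero[OF Suc.prems(1)] show ?case by blast
  qed simp
  thus False using colength_bounded[OF assms(2)] by blast
qed

section \<open>Transfer to arbitrary points of the plane\<close>

definition at_pt :: "complex \<times> complex \<Rightarrow> poly2 \<Rightarrow> complex" where
  "at_pt p f = at0 (subst2 (varx + const2 (fst p)) (vary + const2 (snd p)) f)"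

lemma subst2_translate_inverse:
  "subst2 (varx + const2 (- a)) (vary + const2 (- b)) (subst2 (varx + const2 a) (vary + const2 b) f) = f"
proof -
  have "const2 (- a) + const2 a = 0" for a by (simp flip: const2.hom_add add: const2.hom_zero)
  thus ?thesis by (simp add: subst2_subst2 subst2_hom add.assoc)
qed

lemma translate_eq:
  "translate p (P, Q) = (subst2 (varx + const2 (fst p)) (vary + const2 (snd p)) P,
     subst2 (varx + const2 (fst p)) (vary + const2 (snd p)) Q)"
  by (simp add: translate_def pullback_eq dx_add dy_add)

lemma subst2_translate_eq_0: "subst2 (varx + const2 a) (vary + const2 b) f = 0 \<longleftrightarrow> f = 0"
  using subst2_translate_inverse[of a b f] by auto

lemma coprime_translate:
  assumes "coprime g h"
  shows "coprime (subst2 (varx + const2 a) (vary + const2 b) g) (subst2 (varx + const2 a) (vary + const2 b) h)"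
proof (rule coprimeI)
  let ?s = "subst2 (varx + const2 a) (vary + const2 b)" and ?i = "subst2 (varx + const2 (- a)) (vary + const2 (- b))"
  fix d assume "d dvd ?s g" "d dvd ?s h"
  hence "?i d dvd ?i (?s g)" "?i d dvd ?i (?s h)" by (auto simp: subst2.hom_mult elim!: dvdE)
  hence "is_unit (?i d)" using assms unfolding subst2_translate_inverse by (metis coprime_common_divisor)
  hence "?s (?i d) dvd ?s 1" by (metis dvdE dvdI subst2.hom_mult)
  thus "is_unit d" using subst2_translate_inverse[of "- a" "- b" d] by (simp add: subst2.hom_one)
qed

lemma dicritical_singularity_if_indeterminate:
  assumes "\<omega> \<noteq> (0, 0)" "coprime g h" "first_integral \<omega> g h" "at_pt p g = 0" "at_pt p h = 0"
  shows "dicritical_singularity \<omega> p"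
proof -
  obtain P Q where \<omega>: "\<omega> = (P, Q)" by force
  have "translate p \<omega> \<noteq> (0, 0)" using assms(1) by (simp add: \<omega> translate_eq subst2_translate_eq_0)
  thus ?thesis unfolding dicritical_singularity_iff
    using dicritical_origin_if_indeterminate[OF _ coprime_translate[OF assms(2)]] assms(4,5)
      first_integral_pullback[OF assms(3)] unfolding at_pt_def translate_def by blast
qed

lemma not_dicritical_singularity:
  assumes "\<omega> \<noteq> (0, 0)" "nonconstant g h" "first_integral \<omega> g h" "at_pt p g \<noteq> 0 \<or> at_pt p h \<noteq> 0"
  shows "\<not> dicritical_singularity \<omega> p"
proof -
  obtain P Q where \<omega>: "\<omega> = (P, Q)" by force
  let ?s = "subst2 (varx + const2 (fst p)) (vary + const2 (snd p))"
  have nz: "translate p \<omega> \<noteq> (0, 0)" using assms(1) by (simp add: \<omega> translate_eq subst2_translate_eq_0)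
  have nc: "nonconstant (?s g) (?s h)"
    using assms(2) by (simp add: nonconstant_def wron_subst2 dx_add dy_add subst2_translate_eq_0)
  have fi: "first_integral (translate p \<omega>) (?s g) (?s h)"
    unfolding translate_def by (rule first_integral_pullback[OF assms(3)])
  show ?thesis unfolding dicritical_singularity_iff dicritical_origin_def
    using fold_strict_transform_not_terminal[OF fi nz nc] assms(4) unfolding at_pt_def by blast
qed

subsection \<open>The field of rational functions\<close>

lemma fract_deriv_mult:
  fixes D :: "'a::idom \<Rightarrow> 'a"
  assumes D: "\<And>u v. D (u * v) = D u * v + u * D v"
  shows "fract_deriv D (x * y) = fract_deriv D x * y + x * fract_deriv D y"
proof -
  obtain a b c d where x: "x = Fract a b" "b \<noteq> 0" and y: "y = Fract c d" "d \<noteq> 0"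
    by (metis Fract_cases)
  show ?thesis using x(2) y(2)
    by (simp add: x(1) y(1) fract_deriv_Fract[of D, OF D] eq_fract D algebra_simps)
qed

lemma fract_deriv_add:
  fixes D :: "'a::idom \<Rightarrow> 'a"
  assumes D: "\<And>u v. D (u * v) = D u * v + u * D v" and add: "\<And>u v. D (u + v) = D u + D v"
  shows "fract_deriv D (x + y) = fract_deriv D x + fract_deriv D y"
proof -
  obtain a b c d where x: "x = Fract a b" "b \<noteq> 0" and y: "y = Fract c d" "d \<noteq> 0"
    by (metis Fract_cases)
  show ?thesis using x(2) y(2)
    by (simp add: x(1) y(1) fract_deriv_Fract[of D, OF D] eq_fract D add algebra_simps)
qed

lemma fract_deriv_to_fract:
  fixes D :: "'a::idom \<Rightarrow> 'a"
  assumes D: "\<And>u v. D (u * v) = D u * v + u * D v"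
  shows "fract_deriv D (to_fract p) = to_fract (D p)"
proof -
  have "D 1 = 0" using D[of 1 1] by (metis add_cancel_left_right mult_1 mult_1_right)
  thus ?thesis by (simp add: to_fract_def fract_deriv_Fract[of D, OF D])
qed

locale derivation =
  fixes D :: "'a::field \<Rightarrow> 'a"
  assumes mult: "D (x * y) = D x * y + x * D y" and add: "D (x + y) = D x + D y"
begin

lemma one [simp]: "D 1 = 0"
  using mult[of 1 1] by (metis add_cancel_left_right mult_1 mult_1_right)

lemma inverse: "x \<noteq> 0 \<Longrightarrow> D (1 / x) = - D x / x ^ 2"
  using mult[of x "1 / x"] by (simp add: field_simps power2_eq_square eq_neg_iff_add_eq_0 flip: add_divide_distrib)

lemma power: "x \<noteq> 0 \<Longrightarrow> D (x ^ n) = of_nat n * x ^ n / x * D x"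
  by (induction n) (simp_all add: mult field_simps)

end

lemma derivation_fract_dx: "derivation fract_dx"
  unfolding fract_dx_def by standard (intro fract_deriv_mult fract_deriv_add dx_mult dx_add)+

lemma derivation_fract_dy: "derivation fract_dy"
  unfolding fract_dy_def by standard (intro fract_deriv_mult fract_deriv_add dy_mult dy_add)+

lemma fract_dx_to_fract: "fract_dx (to_fract p) = to_fract (dx p)"
  and fract_dy_to_fract: "fract_dy (to_fract p) = to_fract (dy p)"
  unfolding fract_dx_def fract_dy_def by (intro fract_deriv_to_fract dx_mult dy_mult)+

interpretation Dx: derivation fract_dx by (rule derivation_fract_dx)
interpretation Dy: derivation fract_dy by (rule derivation_fract_dy)

interpretation to_fract: comm_ring_hom "to_fract :: poly2 \<Rightarrow> poly2 fract"
  by standard simp_all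

definition constK :: "complex \<Rightarrow> poly2 fract" where "constK c = to_fract (const2 c)"

lemma comm_ring_hom_constK: "comm_ring_hom constK"
  by standard (simp_all add: constK_def const2.hom_add const2.hom_mult const2.hom_zero const2.hom_one)

definition KX :: "poly2 fract" where "KX = to_fract varx"
definition KY :: "poly2 fract" where "KY = to_fract vary"

lemma KX_KY_nonzero [simp]: "KX \<noteq> 0" "KY \<noteq> 0"
  by (simp_all add: KX_def KY_def)

lemma to_fract_eval2: "to_fract (eval2 const2 p u v) = eval2 constK p (to_fract u) (to_fract v)"
  by (rule eval2_comp[OF comm_ring_hom_const2 to_fract.comm_ring_hom_axioms constK_def[symmetric] comm_ring_hom_constK])

lemma to_fract_eq_eval2: "to_fract p = eval2 constK p KX KY"
  using to_fract_eval2[of p varx vary] subst2_id[of p] by (simp add: subst2_def KX_def KY_def)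

lemma deriv_eval2:
  assumes "derivation D" "\<And>c. D (constK c) = 0"
  shows "D (eval2 constK p \<xi> \<eta>) = eval2 constK (dx p) \<xi> \<eta> * D \<xi> + eval2 constK (dy p) \<xi> \<eta> * D \<eta>"
proof -
  interpret derivation D by fact
  show ?thesis using assms(2) by (intro chain_rule_general comm_ring_hom_constK add mult)
qed

text \<open>
  The chart \<open>x = \<xi>\<close>, \<open>y = \<eta>\<close>, in which \<open>A dx + B dy\<close> becomes \<open>P dx + Q dy\<close> up to the factor \<open>S\<close>;
  the coordinate \<open>\<xi>\<close> depends on the first variable only.
\<close>

locale chart =
  fixes A B P Q :: poly2 and S \<xi> \<eta> :: "poly2 fract"
  assumes P: "to_fract P = S * (eval2 constK A \<xi> \<eta> * fract_dx \<xi> + eval2 constK B \<xi> \<eta> * fract_dx \<eta>)"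
    and Q: "to_fract Q = S * eval2 constK B \<xi> \<eta> * fract_dy \<eta>"
    and S: "S \<noteq> 0" and \<xi>: "fract_dy \<xi> = 0" "fract_dx \<xi> \<noteq> 0" and \<eta>: "fract_dy \<eta> \<noteq> 0"
    and inj: "eval2 constK p \<xi> \<eta> = 0 \<Longrightarrow> p = 0" and B: "B \<noteq> 0"
begin

lemma Q_nonzero: "Q \<noteq> 0"
proof
  assume "Q = 0"
  hence "eval2 constK B \<xi> \<eta> = 0" using Q S \<eta> by auto
  thus False using inj B by blast
qed

interpretation e: comm_ring_hom "\<lambda>p. eval2 constK p \<xi> \<eta>"
  by (intro comm_ring_hom_eval2 comm_ring_hom_constK)

lemma wron:
  assumes "derivation D" "\<And>c. D (constK c) = 0"
  shows "eval2 constK h \<xi> \<eta> * D (eval2 constK g \<xi> \<eta>) - eval2 constK g \<xi> \<eta> * D (eval2 constK h \<xi> \<eta>)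
    = eval2 constK (wronx g h) \<xi> \<eta> * D \<xi> + eval2 constK (wrony g h) \<xi> \<eta> * D \<eta>"
  unfolding deriv_eval2[OF assms] wronx_def wrony_def e.hom_minus e.hom_mult by (simp add: algebra_simps)

lemma Dconst: "fract_dx (constK c) = 0" "fract_dy (constK c) = 0"
  by (simp_all add: constK_def fract_dx_to_fract fract_dy_to_fract)

text \<open>The relation says that G/H is g/h in the new coordinates; it is written without division
  so that a denominator may be 0. By \<open>quotient_rule_welldef\<close> the Wronskians of both
  fractions agree up to the squares of the denominators.\<close>

lemma
  assumes rel: "to_fract G * eval2 constK h \<xi> \<eta> = to_fract H * eval2 constK g \<xi> \<eta>"
  shows first_integral_chart: "first_integral (A, B) g h \<Longrightarrow> (g, h) \<noteq> (0, 0) \<Longrightarrow> first_integral (P, Q) G H"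
    and nonconstant_rep: "nonconstant g h \<Longrightarrow> (G, H) \<noteq> (0, 0) \<Longrightarrow> nonconstant G H"
proof -
  define gK hK GK HK where "gK = eval2 constK g \<xi> \<eta>" and "hK = eval2 constK h \<xi> \<eta>"
    and "GK = to_fract G" and "HK = to_fract H"
  define wx wy where "wx = eval2 constK (wronx g h) \<xi> \<eta>" and "wy = eval2 constK (wrony g h) \<xi> \<eta>"
  note w = wron[OF derivation_fract_dx Dconst(1), of h g] wron[OF derivation_fract_dy Dconst(2), of h g]
  note w = w[folded wx_def wy_def gK_def hK_def]
  have W: "to_fract (wronx G H) = HK * fract_dx GK - GK * fract_dx HK"
    "to_fract (wrony G H) = HK * fract_dy GK - GK * fract_dy HK"
    by (simp_all add: wronx_def wrony_def GK_def HK_def fract_dx_to_fract fract_dy_to_fract)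
  have rel': "GK * hK = gK * HK" using rel by (simp add: gK_def hK_def GK_def HK_def mult.commute)
  have "to_fract (wronx G H) * (hK * hK) = (wx * fract_dx \<xi> + wy * fract_dx \<eta>) * (HK * HK)"
    using quotient_rule_welldef[of fract_dx, OF Dx.mult rel'] unfolding W w(1)[symmetric]
    by (simp only: mult.commute[of HK "fract_dx GK"] mult.commute[of hK "fract_dx gK"])
  note rx = this
  have ry: "to_fract (wrony G H) * (hK * hK) = wy * fract_dy \<eta> * (HK * HK)"
    using quotient_rule_welldef[of fract_dy, OF Dy.mult rel'] w(2) \<xi> unfolding W
    by (simp add: mult.commute[of HK "fract_dy GK"] mult.commute[of hK "fract_dy gK"])
  {
    assume fi: "first_integral (A, B) g h" and nz: "(g, h) \<noteq> (0, 0)"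
    have "eval2 constK (B * wronx g h) \<xi> \<eta> = eval2 constK (A * wrony g h) \<xi> \<eta>"
      using fi by (simp add: first_integral_def)
    hence AB: "eval2 constK B \<xi> \<eta> * wx = eval2 constK A \<xi> \<eta> * wy" by (simp add: e.hom_mult wx_def wy_def)
    show "first_integral (P, Q) G H"
    proof (cases "h = 0")
      case True
      hence "hK = 0" by (simp add: hK_def)
      moreover have "gK \<noteq> 0" using nz True inj by (auto simp: gK_def)
      ultimately have "H = 0" using rel' by (simp add: HK_def)
      thus ?thesis by (simp add: first_integral_def wronx_def wrony_def dx_def dy_def)
    next
      case False
      hence hK: "hK \<noteq> 0" using inj by (auto simp: hK_def)
      have "to_fract (Q * wronx G H) * (hK * hK) = to_fract Q * (to_fract (wronx G H) * (hK * hK))"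
        by (simp add: mult.assoc)
      also have "\<dots> = S * fract_dy \<eta> * (HK * HK) * ((eval2 constK B \<xi> \<eta> * wx) * fract_dx \<xi> + eval2 constK B \<xi> \<eta> * wy * fract_dx \<eta>)"
        unfolding rx Q by (simp only: algebra_simps)
      also have "\<dots> = to_fract P * (to_fract (wrony G H) * (hK * hK))"
        unfolding ry P AB by (simp only: algebra_simps)
      also have "\<dots> = to_fract (P * wrony G H) * (hK * hK)" by (simp add: mult.assoc)
      finally have "to_fract (Q * wronx G H) = to_fract (P * wrony G H)"
        using hK by (simp only: mult_cancel_right mult_eq_0_iff simp_thms)
      thus ?thesis by (simp only: to_fract_eq_iff first_integral_def fst_conv snd_conv)
    qed
  }
  {
    assume nc: "nonconstant g h" and nz: "(G, H) \<noteq> (0, 0)"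
    show "nonconstant G H"
    proof (rule ccontr)
      assume "\<not> nonconstant G H"
      hence 0: "to_fract (wronx G H) = 0" "to_fract (wrony G H) = 0" by (simp_all add: nonconstant_def)
      have "wx * fract_dx \<xi> + wy * fract_dx \<eta> = 0 \<and> wy * fract_dy \<eta> = 0"
      proof (cases "H = 0")
        case False
        hence "HK \<noteq> 0" by (simp add: HK_def)
        thus ?thesis using rx ry unfolding 0 by simp
      next
        case True
        hence "GK \<noteq> 0" "HK = 0" using nz by (simp_all add: GK_def HK_def)
        hence "hK = 0" using rel' by simp
        hence "h = 0" using inj by (simp add: hK_def)
        thus ?thesis by (simp add: wx_def wy_def wronx_def wrony_def dx_def dy_def)
      qed
      hence "wy = 0" "wx = 0" using \<xi> \<eta> by auto
      thus False using nc inj unfolding nonconstant_def wx_def wy_def by blast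
    qed
  }
qed

end

subsection \<open>The output of the extension algorithm in a chart\<close>

lemma eval_poly_comp:
  assumes "comm_ring_hom h" "comm_ring_hom k"
  shows "k (eval_poly h p x) = eval_poly (\<lambda>c. k (h c)) p (k x)"
proof -
  interpret h: comm_ring_hom h by fact
  interpret k: comm_ring_hom k by fact
  have kh: "comm_ring_hom (\<lambda>c. k (h c))"
    by standard (simp_all add: h.hom_add h.hom_mult k.hom_add k.hom_mult h.hom_zero h.hom_one k.hom_zero k.hom_one)
  show ?thesis
    by (induction p)
       (simp_all add: eval_poly_pCons'[OF assms(1)] eval_poly_pCons'[OF kh] k.hom_add k.hom_mult,
        simp add: eval_poly_def k.hom_zero)
qed

lemma eval4_comp:
  assumes "comm_ring_hom h" "comm_ring_hom k"
  shows "k (eval4 h p x0 x1 y0 y1) = eval4 (\<lambda>c. k (h c)) p (k x0) (k x1) (k y0) (k y1)"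
  unfolding eval4_def by (simp only: eval_poly_comp[OF _ assms(2)] comm_ring_hom_eval_poly assms(1))

lemma eval4_vars:
  assumes "comm_ring_hom h"
  shows "eval4 h X0 x0 x1 y0 y1 = x0" "eval4 h X1 x0 x1 y0 y1 = x1"
    "eval4 h Y0 x0 x1 y0 y1 = y0" "eval4 h Y1 x0 x1 y0 y1 = y1" "eval4 h (const4 c) x0 x1 y0 y1 = h c"
proof -
  interpret h: comm_ring_hom h by fact
  have z: "eval_poly k 0 x = 0" if "comm_ring_hom k" for k :: "'q::comm_ring_1 \<Rightarrow> 'a" and x
    by (simp add: eval_poly_def)
  have one: "eval_poly k 1 x = 1" if "comm_ring_hom k" for k :: "'q::comm_ring_1 \<Rightarrow> 'a" and x
  proof -
    interpret comm_ring_hom "\<lambda>p. eval_poly k p x" using that by (rule comm_ring_hom_eval_poly)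
    show ?thesis by (rule hom_one)
  qed
  note s = eval_poly_const eval_poly_pCons' comm_ring_hom_eval_poly assms z one h.hom_zero h.hom_one
  show "eval4 h X0 x0 x1 y0 y1 = x0" "eval4 h X1 x0 x1 y0 y1 = x1"
    "eval4 h Y0 x0 x1 y0 y1 = y0" "eval4 h Y1 x0 x1 y0 y1 = y1" "eval4 h (const4 c) x0 x1 y0 y1 = h c"
    by (simp_all add: eval4_def X0_def X1_def Y0_def Y1_def const4_def s)
qed

text \<open>The defining equation lies in the field of fractions, where evaluation makes no sense.
  So denominators are cleared for \<open>A\<close>, and \<open>T\<close> makes all exponents
  nonnegative, before the resulting identity of polynomials is evaluated.\<close>

lemma homogenizes_eval4:
  fixes h :: "complex \<Rightarrow> 'r::field"
  assumes h: "comm_ring_hom h" and nz: "x0 \<noteq> 0" "y0 \<noteq> 0" and hom: "homogenizes \<delta> A A' \<alpha>1 \<alpha>2"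
  shows "eval4 h A' x0 x1 y0 y1 = x0 powi \<alpha>1 * y0 powi \<alpha>2 * eval2 h A (x1 / x0) (x0 ^ \<delta> * y1 / y0)"
proof -
  interpret const4: comm_ring_hom const4 by (rule comm_ring_hom_const4)
  have hf: "comm_ring_hom (\<lambda>c. to_fract (const4 c))" by standard (simp_all add: hom_distribs)
  interpret E: comm_ring_hom "\<lambda>G. eval4 h G x0 x1 y0 y1" using h by (rule comm_ring_hom_eval4)
  define xF yF where "xF = to_fract X1 / to_fract X0" and "yF = to_fract X0 ^ \<delta> * to_fract Y1 / to_fract Y0"
  define xK yK where "xK = x1 / x0" and "yK = x0 ^ \<delta> * y1 / y0"
  interpret F: comm_ring_hom "\<lambda>p. eval2 (\<lambda>c. to_fract (const4 c)) p xF yF" using hf by (rule comm_ring_hom_eval2)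
  interpret K: comm_ring_hom "\<lambda>p. eval2 h p xK yK" using h by (rule comm_ring_hom_eval2)
  let ?F = "\<lambda>p. eval2 (\<lambda>c. to_fract (const4 c)) p xF yF"
  let ?K = "\<lambda>p. eval2 h p xK yK"
  let ?E = "\<lambda>G. eval4 h G x0 x1 y0 y1"
  note vars = eval4_vars[OF h]
  have cl: "\<exists>N M G. ?F p * to_fract X0 ^ N * to_fract Y0 ^ M = to_fract G \<and> ?E G = ?K p * x0 ^ N * y0 ^ M" for p
  proof (induction p rule: poly2_induct)
    case (const c)
    show ?case by (intro exI[of _ 0] exI[of _ "const4 c"]) (simp add: eval2_const2 hf h vars)
  next
    case varx
    show ?case using nz
      by (intro exI[of _ 1] exI[of _ 0] exI[of _ X1]) (simp add: eval2_varx hf h vars xF_def xK_def)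
  next
    case vary
    show ?case using nz
      by (intro exI[of _ 0] exI[of _ 1] exI[of _ "X0 ^ \<delta> * Y1"])
         (simp add: eval2_vary hf h vars E.hom_mult E.hom_power yF_def yK_def)
  next
    case (add p q)
    then obtain N M G N' M' G' where
      1: "?F p * to_fract X0 ^ N * to_fract Y0 ^ M = to_fract G" "?E G = ?K p * x0 ^ N * y0 ^ M" and
      2: "?F q * to_fract X0 ^ N' * to_fract Y0 ^ M' = to_fract G'" "?E G' = ?K q * x0 ^ N' * y0 ^ M'"
      by blast
    have "?F (p + q) * to_fract X0 ^ (N + N') * to_fract Y0 ^ (M + M')
        = (?F p * to_fract X0 ^ N * to_fract Y0 ^ M) * (to_fract X0 ^ N' * to_fract Y0 ^ M') +
          (?F q * to_fract X0 ^ N' * to_fract Y0 ^ M') * (to_fract X0 ^ N * to_fract Y0 ^ M)"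
      by (simp add: power_add F.hom_add algebra_simps)
    also have "\<dots> = to_fract (G * (X0 ^ N' * Y0 ^ M') + G' * (X0 ^ N * Y0 ^ M))"
      unfolding 1(1) 2(1) by simp
    finally show ?case using 1(2) 2(2)
      by (intro exI[of _ "N + N'"] exI[of _ "M + M'"] exI[of _ "G * (X0 ^ N' * Y0 ^ M') + G' * (X0 ^ N * Y0 ^ M)"])
         (simp add: E.hom_add E.hom_mult E.hom_power vars K.hom_add power_add algebra_simps)
  next
    case (mult p q)
    then obtain N M G N' M' G' where
      1: "?F p * to_fract X0 ^ N * to_fract Y0 ^ M = to_fract G" "?E G = ?K p * x0 ^ N * y0 ^ M" and
      2: "?F q * to_fract X0 ^ N' * to_fract Y0 ^ M' = to_fract G'" "?E G' = ?K q * x0 ^ N' * y0 ^ M'"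
      by blast
    have "?F (p * q) * to_fract X0 ^ (N + N') * to_fract Y0 ^ (M + M')
        = (?F p * to_fract X0 ^ N * to_fract Y0 ^ M) * (?F q * to_fract X0 ^ N' * to_fract Y0 ^ M')"
      by (simp add: power_add F.hom_mult mult_ac)
    also have "\<dots> = to_fract (G * G')" unfolding 1(1) 2(1) by simp
    finally show ?case using 1(2) 2(2)
      by (intro exI[of _ "N + N'"] exI[of _ "M + M'"] exI[of _ "G * G'"])
         (simp add: E.hom_mult K.hom_mult power_add mult_ac)
  qed
  obtain N M G where G: "?F A * to_fract X0 ^ N * to_fract Y0 ^ M = to_fract G" "?E G = ?K A * x0 ^ N * y0 ^ M"
    using cl[of A] by blast
  define T where "T = max \<bar>\<alpha>1\<bar> \<bar>\<alpha>2\<bar>"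
  have T: "T \<ge> 0" "T + \<alpha>1 \<ge> 0" "T + \<alpha>2 \<ge> 0" unfolding T_def by auto
  have pw: "x ^ nat k = x powi k" if "k \<ge> 0" for x :: "'z::field" and k
    using that by (simp add: power_int_def)
  have "?F A = to_fract A' / (to_fract X0 powi \<alpha>1 * to_fract Y0 powi \<alpha>2)"
    using hom by (simp add: homogenizes_def xF_def yF_def)
  with G(1) have "to_fract A' * to_fract X0 ^ N * to_fract Y0 ^ M
      = to_fract G * to_fract X0 powi \<alpha>1 * to_fract Y0 powi \<alpha>2"
    by (simp add: field_simps)
  hence "to_fract A' * to_fract X0 ^ N * to_fract Y0 ^ M * (to_fract X0 powi T * to_fract Y0 powi T)
      = to_fract G * (to_fract X0 powi T * to_fract X0 powi \<alpha>1) * (to_fract Y0 powi T * to_fract Y0 powi \<alpha>2)"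
    by (simp only: mult_ac)
  hence "to_fract (A' * X0 ^ N * Y0 ^ M * (X0 ^ nat T * Y0 ^ nat T))
      = to_fract (G * X0 ^ nat (T + \<alpha>1) * Y0 ^ nat (T + \<alpha>2))"
    using T by (simp add: pw power_int_add)
  hence "A' * X0 ^ N * Y0 ^ M * (X0 ^ nat T * Y0 ^ nat T) = G * X0 ^ nat (T + \<alpha>1) * Y0 ^ nat (T + \<alpha>2)"
    by (simp only: to_fract_eq_iff)
  hence "?E (A' * X0 ^ N * Y0 ^ M * (X0 ^ nat T * Y0 ^ nat T)) = ?E (G * X0 ^ nat (T + \<alpha>1) * Y0 ^ nat (T + \<alpha>2))"
    by simp
  hence "?E A' * x0 ^ N * y0 ^ M * (x0 powi T * y0 powi T)
      = ?K A * x0 ^ N * y0 ^ M * (x0 powi T * x0 powi \<alpha>1) * (y0 powi T * y0 powi \<alpha>2)"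
    using T nz by (simp add: E.hom_mult E.hom_power vars G(2) pw power_int_add)
  hence "?E A' * (x0 ^ N * y0 ^ M * x0 powi T * y0 powi T)
      = (x0 powi \<alpha>1 * y0 powi \<alpha>2 * ?K A) * (x0 ^ N * y0 ^ M * x0 powi T * y0 powi T)"
    by (simp only: mult_ac)
  hence "?E A' = x0 powi \<alpha>1 * y0 powi \<alpha>2 * ?K A" using nz by (subst (asm) mult_cancel_right) simp
  thus ?thesis by (simp add: xK_def yK_def)
qed

text \<open>Steps 2 to 5 only multiply A and B by monomials in \<open>X0\<close> and
  \<open>Y0\<close>. The corrections e and e' are common to both, so the exponents differ by m1 and
  m2.\<close>

lemma extension_steps_props:
  assumes "extension_steps \<delta> m1 m2 A B = (A0, A1, B0, B1)"
  obtains i i' j j' where "A1 = X0 ^ i * Y0 ^ j * A" "B1 = X0 ^ i' * Y0 ^ j' * B"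
    "int i' - int i = m1" "int j' - int j = m2"
    "X0 * A0 = of_nat \<delta> * Y1 * B1 - X1 * A1" "Y0 * B0 = - Y1 * B1"
proof -
  define A'' where "A'' = Y0 ^ nat (- m2) * (X0 ^ nat (- m1) * A)"
  define B'' where "B'' = Y0 ^ nat m2 * (X0 ^ nat m1 * B)"
  define e :: nat where "e = (if Y0 dvd B'' then 0 else 1)"
  define e' :: nat where "e' = (if X0 dvd of_nat \<delta> * Y1 * (Y0 ^ e * B'') - X1 * (Y0 ^ e * A'') then 0 else 1)"
  have m: "(if m1 > 0 then (A, X0 ^ nat m1 * B) else (X0 ^ nat (- m1) * A, B)) = (X0 ^ nat (- m1) * A, X0 ^ nat m1 * B)"
    "(if m2 > 0 then (A', Y0 ^ nat m2 * B') else (Y0 ^ nat (- m2) * A', B')) = (Y0 ^ nat (- m2) * A', Y0 ^ nat m2 * B')" for A' B'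
    by simp_all
  have out: "A1 = X0 ^ e' * (Y0 ^ e * A'')" "B1 = X0 ^ e' * (Y0 ^ e * B'')"
    "A0 = (of_nat \<delta> * Y1 * B1 - X1 * A1) div X0" "B0 = (- Y1 * B1) div Y0"
    using assms unfolding extension_steps_def m prod.case A''_def[symmetric] B''_def[symmetric] Let_def
      e_def[symmetric] e'_def[symmetric] by auto
  have "Y0 dvd Y0 ^ e * B''" by (simp add: e_def)
  hence "Y0 dvd - Y1 * B1" by (simp add: out(2))
  hence 1: "Y0 * B0 = - Y1 * B1" by (simp add: out(4))
  have "X0 dvd X0 ^ e' * (of_nat \<delta> * Y1 * (Y0 ^ e * B'') - X1 * (Y0 ^ e * A''))" by (simp add: e'_def)
  also have "X0 ^ e' * (of_nat \<delta> * Y1 * (Y0 ^ e * B'') - X1 * (Y0 ^ e * A'')) = of_nat \<delta> * Y1 * B1 - X1 * A1"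
    by (simp add: out(1,2) algebra_simps)
  finally have 2: "X0 * A0 = of_nat \<delta> * Y1 * B1 - X1 * A1" by (simp add: out(3))
  show thesis
    by (rule that[of "e' + nat (- m1)" "e + nat (- m2)" "e' + nat m1" "e + nat m2"])
       (use 1 2 in \<open>simp_all add: out(1,2) A''_def B''_def power_add mult_ac\<close>)
qed

text \<open>Up to a common factor, the output consists of the coefficients of dX0, dX1, dY0, dY1 in
  the pull-back of A dx + B dy under x = X1/X0, y = X0^\<delta> Y1/Y0.\<close>

lemma extension_eval4:
  fixes x0 x1 y0 y1 :: "poly2 fract"
  assumes cop: "coprime A B" and B: "B \<noteq> 0" and ext: "extension \<delta> (A, B) = (A0, A1, B0, B1)"
    and nz: "x0 \<noteq> 0" "y0 \<noteq> 0"
  defines "\<xi> \<equiv> x1 / x0" and "\<eta> \<equiv> x0 ^ \<delta> * y1 / y0"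
  obtains S where "S \<noteq> 0"
    "eval4 constK B1 x0 x1 y0 y1 = S * eval2 constK B \<xi> \<eta> * x0 ^ \<delta> / y0"
    "eval4 constK A0 x0 x1 y0 y1
       = S * (of_nat \<delta> * y1 * x0 ^ \<delta> / (x0 * y0) * eval2 constK B \<xi> \<eta> - x1 / x0 ^ 2 * eval2 constK A \<xi> \<eta>)"
    "eval4 constK B0 x0 x1 y0 y1 = - S * y1 * eval2 constK B \<xi> \<eta> * x0 ^ \<delta> / y0 ^ 2"
proof -
  interpret E: comm_ring_hom "\<lambda>G. eval4 constK G x0 x1 y0 y1"
    by (intro comm_ring_hom_eval4 comm_ring_hom_constK)
  let ?E = "\<lambda>G. eval4 constK G x0 x1 y0 y1"
  note vars = eval4_vars[OF comm_ring_hom_constK]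
  obtain A' \<alpha>1 \<alpha>2 B' \<beta>1 \<beta>2 where
    A': "if A = 0 then A' = 0 else homogenizes \<delta> A A' \<alpha>1 \<alpha>2" and B': "homogenizes \<delta> B B' \<beta>1 \<beta>2" and
    out: "extension_steps \<delta> (\<alpha>1 - \<beta>1 + 1 + int \<delta>) (\<alpha>2 - \<beta>2 - 1) A' B' = (A0, A1, B0, B1)"
  proof -
    have "is_extension_output \<delta> (A, B) (A0, A1, B0, B1)"
      using is_extension_output_extension[OF cop, of \<delta>] ext by simp
    thus thesis using that B unfolding is_extension_output_def prod.case by (smt (verit))
  qed
  obtain i i' j j' where st: "A1 = X0 ^ i * Y0 ^ j * A'" "B1 = X0 ^ i' * Y0 ^ j' * B'"
    "int i' - int i = \<alpha>1 - \<beta>1 + 1 + int \<delta>" "int j' - int j = \<alpha>2 - \<beta>2 - 1"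
    "X0 * A0 = of_nat \<delta> * Y1 * B1 - X1 * A1" "Y0 * B0 = - Y1 * B1"
    using extension_steps_props[OF out] .
  define a b where "a = eval2 constK A \<xi> \<eta>" and "b = eval2 constK B \<xi> \<eta>"
  \<comment> \<open>Read off from \<open>B1\<close>; the values of m1 and m2 are such that the same
    factor comes out for \<open>A1\<close>.\<close>
  define S where "S = x0 powi (int i' + \<beta>1 - int \<delta>) * y0 powi (int j' + \<beta>2 + 1)"
  have S: "S \<noteq> 0" using nz by (simp add: S_def)
  have EB: "?E B1 = S * b * x0 ^ \<delta> / y0"
    using nz unfolding st(2) E.hom_mult E.hom_power vars
      homogenizes_eval4[OF comm_ring_hom_constK nz B'] b_def \<xi>_def \<eta>_def S_def
    by (simp add: power_int_add power_int_diff field_simps)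
  have EA: "?E A1 = S * a / x0"
  proof (cases "A = 0")
    case True
    interpret e: comm_ring_hom "\<lambda>p. eval2 constK p \<xi> \<eta>"
      by (intro comm_ring_hom_eval2 comm_ring_hom_constK)
    show ?thesis using True A' by (simp add: st(1) a_def E.hom_zero e.hom_zero)
  next
    case False
    hence A'': "homogenizes \<delta> A A' \<alpha>1 \<alpha>2" using A' by simp
    have \<alpha>: "\<alpha>1 = int i' + \<beta>1 - int \<delta> - 1 - int i" "\<alpha>2 = int j' + \<beta>2 + 1 - int j" using st(3,4) by linarith+
    show ?thesis
      using nz unfolding st(1) E.hom_mult E.hom_power vars
        homogenizes_eval4[OF comm_ring_hom_constK nz A''] a_def \<xi>_def \<eta>_def S_def \<alpha>
      by (simp add: power_int_add power_int_diff field_simps)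
  qed
  have "x0 * ?E A0 = of_nat \<delta> * y1 * ?E B1 - x1 * ?E A1"
    using arg_cong[OF st(5), of ?E] by (simp add: E.hom_mult E.hom_minus E.hom_of_nat vars)
  hence "?E A0 = (of_nat \<delta> * y1 * ?E B1 - x1 * ?E A1) / x0" using nz by (simp add: field_simps)
  also have "\<dots> = S * (of_nat \<delta> * y1 * x0 ^ \<delta> / (x0 * y0) * b - x1 / x0 ^ 2 * a)"
    unfolding EA EB using nz by (simp add: field_simps power2_eq_square)
  finally have EA0: "?E A0 = S * (of_nat \<delta> * y1 * x0 ^ \<delta> / (x0 * y0) * b - x1 / x0 ^ 2 * a)" .
  have "y0 * ?E B0 = - y1 * ?E B1"
    using arg_cong[OF st(6), of ?E] by (simp add: E.hom_mult E.hom_uminus vars)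
  hence "?E B0 = - y1 * ?E B1 / y0" using nz by (simp add: field_simps)
  also have "\<dots> = - S * y1 * b * x0 ^ \<delta> / y0 ^ 2"
    unfolding EB using nz by (simp add: field_simps power2_eq_square)
  finally have EB0: "?E B0 = - S * y1 * b * x0 ^ \<delta> / y0 ^ 2" .
  show thesis using that[OF S] EB EA0 EB0 unfolding a_def b_def by blast
qed

lemma to_fract_eval4: "to_fract (eval4 const2 G x0 x1 y0 y1) = eval4 constK G (to_fract x0) (to_fract x1) (to_fract y0) (to_fract y1)"
  using eval4_comp[OF comm_ring_hom_const2 to_fract.comm_ring_hom_axioms] by (simp add: constK_def[abs_def])

subsection \<open>Homogenization\<close>

text \<open>For n at least the degree this is x^n p(1/x). Unlike in \<open>reflect_poly\<close>, n
  is prescribed, so that two polynomials can be reflected with the same exponent.\<close>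

definition reflect :: "nat \<Rightarrow> 'a::comm_monoid_add poly \<Rightarrow> 'a poly" where
  "reflect n p = (\<Sum>i\<le>n. monom (coeff p (n - i)) i)"

lemma coeff_reflect: "coeff (reflect n p) i = (if i \<le> n then coeff p (n - i) else 0)"
  by (simp add: reflect_def coeff_sum)

lemma degree_reflect: "degree (reflect n p) \<le> n"
  by (intro degree_le) (simp add: coeff_reflect)

lemma reflect_reflect: "degree p \<le> n \<Longrightarrow> reflect n (reflect n p) = p"
  by (intro poly_eqI) (auto simp: coeff_reflect coeff_eq_0)

lemma reflect_eq_0: "degree p \<le> n \<Longrightarrow> reflect n p = 0 \<Longrightarrow> p = 0"
  using reflect_reflect[of p n] by (simp add: reflect_def)

lemma reflect_eq_reflect_poly:
  fixes p :: "'a::idom poly"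
  assumes "degree p \<le> n" shows "reflect n p = monom 1 (n - degree p) * reflect_poly p"
  using assms by (intro poly_eqI) (auto simp: coeff_reflect coeff_monom_mult coeff_reflect_poly coeff_eq_0)

lemma reflect_mult:
  fixes p q :: "'a::idom poly"
  assumes "degree p \<le> m" "degree q \<le> n"
  shows "reflect (m + n) (p * q) = reflect m p * reflect n q"
proof (cases "p = 0 \<or> q = 0")
  case True
  thus ?thesis by (auto simp: reflect_def)
next
  case False
  hence deg: "degree (p * q) = degree p + degree q" by (simp add: degree_mult_eq)
  hence "monom (1::'a) (m + n - degree (p * q)) = monom 1 (m - degree p) * monom 1 (n - degree q)"
    using assms by (simp add: mult_monom)
  thus ?thesis using assms deg by (simp add: reflect_eq_reflect_poly reflect_poly_mult mult_ac)
qed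

text \<open>A common divisor d reflects to a common divisor of G and H, that is, to a unit. As G or
  H attains the degree n, d is not divisible by the variable, so its reflection keeps the degree and
  d is constant.\<close>

lemma coprime_reflect:
  fixes G H :: poly2
  assumes cop: "coprime G H" and deg: "degree G \<le> n" "degree H \<le> n" "coeff G n \<noteq> 0 \<or> coeff H n \<noteq> 0"
  shows "coprime (reflect n G) (reflect n H)"
proof (rule coprimeI)
  fix d assume d: "d dvd reflect n G" "d dvd reflect n H"
  have d0: "coeff d 0 \<noteq> 0"
  proof
    assume "coeff d 0 = 0"
    hence "coeff (reflect n G) 0 = 0" "coeff (reflect n H) 0 = 0"
      using d by (auto simp: coeff_mult_0 elim!: dvdE)
    thus False using deg(3) by (simp add: coeff_reflect)
  qed
  have dvd: "reflect (degree d) d dvd p" if p: "d dvd reflect n p" "degree p \<le> n" for p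
  proof (cases "p = 0")
    case False
    obtain q where q: "reflect n p = d * q" using p(1) ..
    hence "d \<noteq> 0" "q \<noteq> 0" using False p(2) reflect_eq_0 by fastforce+
    hence "degree d + degree q \<le> n" using degree_reflect[of n p] by (simp add: q degree_mult_eq)
    then obtain k where k: "n = degree d + k" "degree q \<le> k" by (metis add.assoc le_Suc_ex le_add1)
    have "p = reflect n (d * q)" using reflect_reflect[OF p(2)] q by simp
    also have "\<dots> = reflect (degree d) d * reflect k q" unfolding k(1) by (rule reflect_mult) (use k in auto)
    finally show ?thesis by simp
  qed simp
  have u: "is_unit (reflect (degree d) d)"
    using dvd[OF d(1) deg(1)] dvd[OF d(2) deg(2)] cop by (metis coprime_common_divisor)
  have "degree d = 0"
  proof -
    have "coeff (reflect (degree d) d) (degree d) \<noteq> 0" using d0 by (simp add: coeff_reflect)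
    hence "degree d \<le> degree (reflect (degree d) d)" by (rule le_degree)
    also have "\<dots> = 0" using u by (auto simp: is_unit_poly_iff)
    finally show ?thesis by simp
  qed
  then obtain c where "d = [:c:]" by (auto elim: degree_eq_zeroE)
  hence "reflect (degree d) d = d" by (simp add: reflect_def monom_0)
  with u show "is_unit d" by simp
qed

lemma eval_poly_sum:
  assumes "comm_ring_hom h" "degree q \<le> n"
  shows "eval_poly h q x = (\<Sum>i\<le>n. h (coeff q i) * x ^ i)"
  using assms(2)
proof (induction q arbitrary: n)
  case 0
  interpret comm_ring_hom h by fact
  show ?case by (simp add: eval_poly_def)
next
  case (pCons a q)
  interpret comm_ring_hom h by fact
  show ?case
  proof (cases n)
    case 0
    hence "q = 0" using pCons.prems by (auto simp: degree_pCons_eq_if split: if_splits)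
    thus ?thesis using 0 by (simp add: eval_poly_const[OF assms(1)])
  next
    case (Suc m)
    have "degree q \<le> m" using pCons.prems Suc by (auto simp: degree_pCons_eq_if split: if_splits)
    from pCons.IH[OF this] show ?thesis
      by (simp add: eval_poly_pCons'[OF assms(1)] Suc sum.atMost_Suc_shift sum_distrib_left mult_ac
          del: sum.atMost_Suc)
  qed
qed

lemma eval_poly_reflect:
  fixes x :: "'r::field"
  assumes h: "comm_ring_hom h" and "degree q \<le> n" "x \<noteq> 0"
  shows "eval_poly h (reflect n q) x = x ^ n * eval_poly h q (1 / x)"
proof -
  have "eval_poly h (reflect n q) x = (\<Sum>i\<le>n. h (coeff q (n - i)) * x ^ i)"
    by (simp add: eval_poly_sum[OF h degree_reflect] coeff_reflect)
  also have "\<dots> = (\<Sum>i\<le>n. h (coeff q i) * x ^ (n - i))"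
    by (rule sum.reindex_bij_witness[of _ "\<lambda>i. n - i" "\<lambda>i. n - i"]) auto
  also have "\<dots> = (\<Sum>i\<le>n. x ^ n * (h (coeff q i) * (1 / x) ^ i))"
    using assms(3) by (intro sum.cong) (simp_all add: power_diff power_divide)
  also have "\<dots> = x ^ n * eval_poly h q (1 / x)"
    by (simp add: eval_poly_sum[OF h assms(2)] sum_distrib_left)
  finally show ?thesis .
qed

lemma eval2_reflect:
  fixes y :: "'r::field"
  assumes "comm_ring_hom h" "degree G \<le> n" "y \<noteq> 0"
  shows "eval2 h (reflect n G) x y = y ^ n * eval2 h G x (1 / y)"
  unfolding eval2_def by (rule eval_poly_reflect[OF comm_ring_hom_eval_poly[OF assms(1)] assms(2,3)])

text \<open>\<open>homogenize \<delta> N p\<close> is \<open>x\<^sup>N p (1/x, x\<^sup>\<delta> y)\<close>, provided that \<open>fits \<delta> N p\<close>.\<close>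

definition fits :: "nat \<Rightarrow> nat \<Rightarrow> poly2 \<Rightarrow> bool" where
  "fits \<delta> N p \<longleftrightarrow> (\<forall>j. degree (coeff p j) \<le> N + \<delta> * j)"

definition homogenize :: "nat \<Rightarrow> nat \<Rightarrow> poly2 \<Rightarrow> poly2" where
  "homogenize \<delta> N p = (\<Sum>j\<le>degree p. monom (reflect (N + \<delta> * j) (coeff p j)) j)"

lemma coeff_homogenize: "coeff (homogenize \<delta> N p) j = reflect (N + \<delta> * j) (coeff p j)"
  by (auto simp: homogenize_def coeff_sum reflect_def coeff_eq_0)

lemma homogenize_eq_0: "fits \<delta> N p \<Longrightarrow> homogenize \<delta> N p = 0 \<Longrightarrow> p = 0"
  by (metis coeff_homogenize fits_def reflect_eq_0 coeff_0 poly_eqI)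

text \<open>A bound for the x-degree of all coefficients serves every \<delta>, so N can stay fixed
  while \<delta> grows.\<close>

lemma fits_exists: "\<exists>N. \<forall>\<delta>. fits \<delta> N p \<and> fits \<delta> N q"
proof -
  have *: "degree (coeff p j) \<le> (\<Sum>j\<le>degree p. degree (coeff p j))" for p :: poly2 and j
    by (cases "j \<le> degree p") (auto simp: coeff_eq_0 intro: member_le_sum)
  show ?thesis unfolding fits_def
    by (rule exI[of _ "(\<Sum>j\<le>degree p. degree (coeff p j)) + (\<Sum>j\<le>degree q. degree (coeff q j))"])
       (use * in \<open>auto intro: trans_le_add1 trans_le_add2\<close>)
qed

text \<open>Replacing y by x y in x^N p(1/x, x^\<delta> y) raises \<delta> by one; no power of x is
  divided off.\<close>

lemma blow_homogenize:
  assumes "fits \<delta> N p" shows "blow (homogenize \<delta> N p) = homogenize (Suc \<delta>) N p"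
proof (intro poly_eqI)
  fix j i
  have "coeff (coeff p j) k = 0" if "k > N + \<delta> * j" for k
    using assms that unfolding fits_def by (intro coeff_eq_0) (metis le_less_trans)
  thus "coeff (coeff (blow (homogenize \<delta> N p)) j) i = coeff (coeff (homogenize (Suc \<delta>) N p) j) i"
    by (auto simp: coeff_coeff_blow coeff_homogenize coeff_reflect intro!: arg_cong[of _ _ "coeff (coeff p j)"])
qed

lemma eval2_homogenize:
  fixes x :: "'r::field"
  assumes h: "comm_ring_hom h" and "fits \<delta> N p" "x \<noteq> 0"
  shows "eval2 h (homogenize \<delta> N p) x y = x ^ N * eval2 h p (1 / x) (x ^ \<delta> * y)"
proof -
  have hx: "comm_ring_hom (\<lambda>q. eval_poly h q x)" for x using h by (rule comm_ring_hom_eval_poly)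
  have deg: "degree (homogenize \<delta> N p) \<le> degree p"
    by (intro degree_le) (simp add: coeff_homogenize coeff_eq_0 reflect_def)
  have "eval2 h (homogenize \<delta> N p) x y = (\<Sum>j\<le>degree p. eval_poly h (reflect (N + \<delta> * j) (coeff p j)) x * y ^ j)"
    by (simp add: eval2_def eval_poly_sum[OF hx deg] coeff_homogenize)
  also have "\<dots> = (\<Sum>j\<le>degree p. x ^ N * (eval_poly h (coeff p j) (1 / x) * (x ^ \<delta> * y) ^ j))"
  proof (intro sum.cong refl)
    fix j
    have pow: "x ^ (N + \<delta> * j) = x ^ N * (x ^ \<delta>) ^ j" by (simp add: power_add power_mult)
    have deg: "degree (coeff p j) \<le> N + \<delta> * j" using assms(2) by (simp add: fits_def)
    show "eval_poly h (reflect (N + \<delta> * j) (coeff p j)) x * y ^ j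
        = x ^ N * (eval_poly h (coeff p j) (1 / x) * (x ^ \<delta> * y) ^ j)"
      unfolding eval_poly_reflect[OF h deg assms(3)] pow by (simp add: power_mult_distrib mult_ac)
  qed
  also have "\<dots> = x ^ N * eval2 h p (1 / x) (x ^ \<delta> * y)"
    by (simp add: eval2_def eval_poly_sum[OF hx order_refl] sum_distrib_left)
  finally show ?thesis .
qed

lemma to_fract_homogenize:
  "fits \<delta> N p \<Longrightarrow> to_fract (homogenize \<delta> N p) = KX ^ N * eval2 constK p (1 / KX) (KX ^ \<delta> * KY)"
  unfolding to_fract_eq_eval2 by (rule eval2_homogenize[OF comm_ring_hom_constK]) simp_all

lemma to_fract_reflect:
  "degree G \<le> n \<Longrightarrow> to_fract (reflect n G) = KY ^ n * eval2 constK G KX (1 / KY)"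
  unfolding to_fract_eq_eval2 by (rule eval2_reflect[OF comm_ring_hom_constK]) simp_all

subsection \<open>The two charts at infinity\<close>

lemma deriv_KX_KY [simp]: "fract_dx KX = 1" "fract_dy KX = 0" "fract_dx KY = 0" "fract_dy KY = 1"
  by (simp_all add: KX_def KY_def fract_dx_to_fract fract_dy_to_fract)

lemma deriv_chart:
  "fract_dx (1 / KX) = - 1 / KX ^ 2" "fract_dy (1 / KX) = 0"
  "fract_dx (KX ^ \<delta> * KY) = of_nat \<delta> * KX ^ \<delta> / KX * KY" "fract_dy (KX ^ \<delta> * KY) = KX ^ \<delta>"
  "fract_dx (KX ^ \<delta> * (1 / KY)) = of_nat \<delta> * KX ^ \<delta> / KX * (1 / KY)"
  "fract_dy (KX ^ \<delta> * (1 / KY)) = - (KX ^ \<delta> / KY ^ 2)"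
  by (simp_all only: Dx.mult Dy.mult Dx.power Dy.power Dx.inverse Dy.inverse KX_KY_nonzero not_False_eq_True deriv_KX_KY)
     simp_all

lemma omega10_chart:
  assumes "coprime A B" "B \<noteq> 0"
  obtains S where "chart A B (fst (omega10 \<delta> (A, B))) (snd (omega10 \<delta> (A, B))) S (1 / KX) (KX ^ \<delta> * KY)"
proof -
  obtain A0 A1 B0 B1 where ext: "extension \<delta> (A, B) = (A0, A1, B0, B1)" by (metis prod_cases4)
  obtain S where S: "S \<noteq> 0"
    "eval4 constK B1 KX 1 1 KY = S * eval2 constK B (1 / KX) (KX ^ \<delta> * KY / 1) * KX ^ \<delta> / 1"
    "eval4 constK A0 KX 1 1 KY
       = S * (of_nat \<delta> * KY * KX ^ \<delta> / (KX * 1) * eval2 constK B (1 / KX) (KX ^ \<delta> * KY / 1)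
            - 1 / KX ^ 2 * eval2 constK A (1 / KX) (KX ^ \<delta> * KY / 1))"
    using extension_eval4[OF assms ext, of KX 1 1 KY] by auto
  have "chart A B (fst (omega10 \<delta> (A, B))) (snd (omega10 \<delta> (A, B))) S (1 / KX) (KX ^ \<delta> * KY)"
  proof
    show "to_fract (fst (omega10 \<delta> (A, B))) = S * (eval2 constK A (1 / KX) (KX ^ \<delta> * KY) * fract_dx (1 / KX)
        + eval2 constK B (1 / KX) (KX ^ \<delta> * KY) * fract_dx (KX ^ \<delta> * KY))"
      unfolding deriv_chart
      using S(3) by (simp add: omega10_def ext to_fract_eval4 algebra_simps flip: KX_def KY_def)
    show "to_fract (snd (omega10 \<delta> (A, B))) = S * eval2 constK B (1 / KX) (KX ^ \<delta> * KY) * fract_dy (KX ^ \<delta> * KY)"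
      unfolding deriv_chart
      using S(2) by (simp add: omega10_def ext to_fract_eval4 flip: KX_def KY_def)
    show "p = 0" if "eval2 constK p (1 / KX) (KX ^ \<delta> * KY) = 0" for p
    proof -
      obtain N where N: "fits \<delta> N p" using fits_exists by blast
      have "to_fract (homogenize \<delta> N p) = 0" using that by (simp add: to_fract_homogenize[OF N])
      thus ?thesis using homogenize_eq_0[OF N] by simp
    qed
  qed (use S assms in \<open>simp_all only: deriv_chart, simp_all\<close>)
  thus thesis by (rule that)
qed

lemma omega11_chart:
  assumes "coprime A B" "B \<noteq> 0"
  obtains S where "chart A B (fst (omega11 \<delta> (A, B))) (snd (omega11 \<delta> (A, B))) S (1 / KX) (KX ^ \<delta> * (1 / KY))"
proof -
  obtain A0 A1 B0 B1 where ext: "extension \<delta> (A, B) = (A0, A1, B0, B1)" by (metis prod_cases4)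
  obtain S where S: "S \<noteq> 0"
    "eval4 constK B0 KX 1 KY 1 = - S * 1 * eval2 constK B (1 / KX) (KX ^ \<delta> * 1 / KY) * KX ^ \<delta> / KY ^ 2"
    "eval4 constK A0 KX 1 KY 1
       = S * (of_nat \<delta> * 1 * KX ^ \<delta> / (KX * KY) * eval2 constK B (1 / KX) (KX ^ \<delta> * 1 / KY)
            - 1 / KX ^ 2 * eval2 constK A (1 / KX) (KX ^ \<delta> * 1 / KY))"
    using extension_eval4[OF assms ext, of KX KY 1 1] by auto
  have "chart A B (fst (omega11 \<delta> (A, B))) (snd (omega11 \<delta> (A, B))) S (1 / KX) (KX ^ \<delta> * (1 / KY))"
  proof
    show "to_fract (fst (omega11 \<delta> (A, B))) = S * (eval2 constK A (1 / KX) (KX ^ \<delta> * (1 / KY)) * fract_dx (1 / KX)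
        + eval2 constK B (1 / KX) (KX ^ \<delta> * (1 / KY)) * fract_dx (KX ^ \<delta> * (1 / KY)))"
      unfolding deriv_chart
      using S(3) by (simp add: omega11_def ext to_fract_eval4 algebra_simps flip: KX_def KY_def)
    show "to_fract (snd (omega11 \<delta> (A, B))) = S * eval2 constK B (1 / KX) (KX ^ \<delta> * (1 / KY)) * fract_dy (KX ^ \<delta> * (1 / KY))"
      unfolding deriv_chart
      using S(2) by (simp add: omega11_def ext to_fract_eval4 flip: KX_def KY_def)
    show "p = 0" if "eval2 constK p (1 / KX) (KX ^ \<delta> * (1 / KY)) = 0" for p
    proof -
      obtain N where N: "fits \<delta> N p" using fits_exists by blast
      have "to_fract (reflect (degree (homogenize \<delta> N p)) (homogenize \<delta> N p)) = 0"
        using that eval2_homogenize[OF comm_ring_hom_constK N KX_KY_nonzero(1), of "1 / KY"]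
        by (simp add: to_fract_reflect)
      hence "homogenize \<delta> N p = 0" using reflect_eq_0[OF order_refl] by simp
      thus ?thesis using homogenize_eq_0[OF N] by simp
    qed
  qed (use S assms in \<open>simp_all only: deriv_chart, simp_all\<close>)
  thus thesis by (rule that)
qed

subsection \<open>Dicritical points at infinity\<close>

text \<open>By coprimality g and h divide their y-derivatives, so they are free of y for reasons of
  degree. The Wronskian in x then settles the claim.\<close>

lemma constant_if_wron_eq_0:
  assumes cop: "coprime g (h :: poly2)" and "h \<noteq> 0" "wronx g h = 0" "wrony g h = 0"
  obtains c where "g = const2 c * h"
proof -
  have dvd: "dy p = 0" if "p dvd dy p" for p
  proof (rule ccontr)
    assume "dy p \<noteq> 0"
    hence "degree p \<le> degree (dy p)" using that by (intro dvd_imp_degree_le)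
    moreover have "degree p \<noteq> 0" using \<open>dy p \<noteq> 0\<close> by (auto simp: dy_def pderiv_eq_0_iff)
    ultimately show False by (simp add: dy_def degree_pderiv)
  qed
  have eq: "h * dy g = g * dy h" "h * dx g = g * dx h" using assms by (simp_all add: wronx_def wrony_def)
  have "h dvd g * dy h" "g dvd h * dy g" by (simp_all add: eq(1)[symmetric]) (simp add: eq(1))
  hence "h dvd dy h" "g dvd dy g"
    using cop by (simp_all add: coprime_dvd_mult_right_iff coprime_commute)
  hence "degree g = 0" "degree h = 0" using dvd unfolding dy_def by (auto simp: pderiv_eq_0_iff)
  then obtain g0 h0 where gh: "g = [:g0:]" "h = [:h0:]" by (auto elim!: degree_eq_zeroE)
  have dxc: "dx [:p:] = [:pderiv p:]" for p
    by (rule poly_eqI) (simp add: dx_def coeff_map_poly coeff_pCons split: nat.splits)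
  hence "h0 * pderiv g0 = g0 * pderiv h0" using eq(2) unfolding gh dxc by (simp add: mult.commute)
  then obtain a b where ab: "(a, b) \<noteq> (0, 0)" "Polynomial.smult a g0 + Polynomial.smult b h0 = 0"
    by (rule wronskian_eq_0_imp_dependent)
  have a: "a \<noteq> 0" using ab assms(2) gh by auto
  have "Polynomial.smult a g0 = Polynomial.smult (- b) h0"
    using ab(2) by (simp add: eq_neg_iff_add_eq_0)
  hence "Polynomial.smult (inverse a) (Polynomial.smult a g0) = Polynomial.smult (inverse a) (Polynomial.smult (- b) h0)"
    by (rule arg_cong)
  hence "g0 = Polynomial.smult (- b / a) h0" using a by (simp add: divide_inverse mult.commute)
  thus thesis using that[of "- b / a"] by (simp add: gh const2_def)
qed

lemma rational_first_integral_coprime: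
  assumes "rational_first_integral a b f"
  obtains g h where "coprime g h" "first_integral (form_of_vf a b) g h" "nonconstant g h"
proof -
  obtain g' h' where f': "f = Fract g' h'" "h' \<noteq> 0" by (metis Fract_cases)
  define d where "d = gcd g' h'"
  have d: "d \<noteq> 0" using f' by (simp add: d_def)
  define g h where "g = g' div d" and "h = h' div d"
  have gh: "g' = d * g" "h' = d * h" by (simp_all add: d_def g_def h_def)
  have h: "h \<noteq> 0" using f' gh by auto
  have f: "f = Fract g h" using f' d h by (simp add: gh eq_fract)
  have cop: "coprime g h" unfolding g_def h_def d_def using f' by (intro div_gcd_coprime) simp
  have fx: "fract_dx f = Fract (wronx g h) (h * h)" "fract_dy f = Fract (wrony g h) (h * h)"
    using h by (simp_all add: f fract_dx_Fract fract_dy_Fract wronx_def wrony_def mult.commute)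
  have "to_fract a * fract_dx f + to_fract b * fract_dy f = 0"
    using assms by (simp add: rational_first_integral_def)
  hence "(to_fract a * fract_dx f + to_fract b * fract_dy f) * to_fract (h * h) = 0" by (simp only: mult_zero_left)
  hence "to_fract a * (fract_dx f * to_fract (h * h)) + to_fract b * (fract_dy f * to_fract (h * h)) = 0"
    by (simp only: distrib_right mult.assoc)
  moreover have "Fract w (h * h) * to_fract (h * h) = to_fract w" for w
    using h by (simp add: to_fract_def eq_fract)
  ultimately have "to_fract (a * wronx g h + b * wrony g h) = 0" by (simp add: fx)
  hence "a * wronx g h + b * wrony g h = 0" by (simp only: to_fract_eq_0_iff)
  hence "first_integral (form_of_vf a b) g h"
    by (simp add: first_integral_def form_of_vf_def neg_eq_iff_add_eq_0)
  moreover have "nonconstant g h"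
  proof (rule ccontr)
    assume "\<not> nonconstant g h"
    then obtain c where "g = const2 c * h"
      using constant_if_wron_eq_0[OF cop h] by (auto simp: nonconstant_def)
    hence "f = to_fract (const2 c)" using h by (simp add: f to_fract_def eq_fract)
    thus False using assms by (simp add: rational_first_integral_def)
  qed
  ultimately show thesis using that cop by blast
qed

lemma at_pt_0: "at_pt (0, t) p = poly (restr p) t"
proof -
  have "at_pt (0, t) p = at0 (shifty t p)" by (simp add: at_pt_def shifty_def const2.hom_zero)
  thus ?thesis by (simp add: at0_restr restr_shifty poly_pcompose)
qed

lemma restr_reflect: "restr (reflect n p) = reflect n (restr p)"
  by (rule poly_eqI) (simp add: coeff_restr coeff_reflect)

section \<open>The first integral in the two charts for growing \<delta>\<close>

context
  fixes A B g h :: poly2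
  assumes AB: "coprime A B" "B \<noteq> 0"
    and gh: "coprime g h" "first_integral (A, B) g h" "nonconstant g h"
begin

lemma gh_nonzero: "(g, h) \<noteq> (0, 0)"
  using gh(1) by auto

lemma omega10_rep:
  assumes "fits \<delta> N g" "fits \<delta> N h" "G * homogenize \<delta> N h = H * homogenize \<delta> N g" "(G, H) \<noteq> (0, 0)"
  shows "omega10 \<delta> (A, B) \<noteq> (0, 0)" "snd (omega10 \<delta> (A, B)) \<noteq> 0"
    "first_integral (omega10 \<delta> (A, B)) G H" "nonconstant G H"
proof -
  obtain S where "chart A B (fst (omega10 \<delta> (A, B))) (snd (omega10 \<delta> (A, B))) S (1 / KX) (KX ^ \<delta> * KY)"
    using omega10_chart[OF AB] .
  then interpret chart A B "fst (omega10 \<delta> (A, B))" "snd (omega10 \<delta> (A, B))" S "1 / KX" "KX ^ \<delta> * KY" .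
  have "to_fract (G * homogenize \<delta> N h) = to_fract (H * homogenize \<delta> N g)" using assms(3) by simp
  hence rel: "to_fract G * eval2 constK h (1 / KX) (KX ^ \<delta> * KY) = to_fract H * eval2 constK g (1 / KX) (KX ^ \<delta> * KY)"
    by (simp add: to_fract_homogenize assms(1,2) mult.left_commute)
  show "snd (omega10 \<delta> (A, B)) \<noteq> 0" by (rule Q_nonzero)
  thus "omega10 \<delta> (A, B) \<noteq> (0, 0)" by (metis snd_conv)
  show "first_integral (omega10 \<delta> (A, B)) G H"
    using first_integral_chart[OF rel gh(2) gh_nonzero] by simp
  show "nonconstant G H" using nonconstant_rep[OF rel gh(3) assms(4)] .
qed

lemma omega11_rep:
  assumes "fits \<delta> N g" "fits \<delta> N h" "G * homogenize \<delta> N h = H * homogenize \<delta> N g" "(G, H) \<noteq> (0, 0)"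
    and n: "degree G \<le> n" "degree H \<le> n"
  shows "omega11 \<delta> (A, B) \<noteq> (0, 0)"
    "first_integral (omega11 \<delta> (A, B)) (reflect n G) (reflect n H)" "nonconstant (reflect n G) (reflect n H)"
proof -
  obtain S where "chart A B (fst (omega11 \<delta> (A, B))) (snd (omega11 \<delta> (A, B))) S (1 / KX) (KX ^ \<delta> * (1 / KY))"
    using omega11_chart[OF AB] .
  then interpret chart A B "fst (omega11 \<delta> (A, B))" "snd (omega11 \<delta> (A, B))" S "1 / KX" "KX ^ \<delta> * (1 / KY)" .
  interpret e: comm_ring_hom "\<lambda>p. eval2 constK p KX (1 / KY)"
    by (intro comm_ring_hom_eval2 comm_ring_hom_constK)
  have "eval2 constK (G * homogenize \<delta> N h) KX (1 / KY) = eval2 constK (H * homogenize \<delta> N g) KX (1 / KY)"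
    using assms(3) by simp
  hence "eval2 constK G KX (1 / KY) * eval2 constK h (1 / KX) (KX ^ \<delta> * (1 / KY))
      = eval2 constK H KX (1 / KY) * eval2 constK g (1 / KX) (KX ^ \<delta> * (1 / KY))"
    unfolding e.hom_mult eval2_homogenize[OF comm_ring_hom_constK assms(1) KX_KY_nonzero(1)]
      eval2_homogenize[OF comm_ring_hom_constK assms(2) KX_KY_nonzero(1)]
    by (simp add: mult.left_commute)
  hence rel: "to_fract (reflect n G) * eval2 constK h (1 / KX) (KX ^ \<delta> * (1 / KY))
      = to_fract (reflect n H) * eval2 constK g (1 / KX) (KX ^ \<delta> * (1 / KY))"
    unfolding to_fract_reflect[OF n(1)] to_fract_reflect[OF n(2)] by (simp only: mult.assoc)
  have nz: "(reflect n G, reflect n H) \<noteq> (0, 0)" using assms(4) n reflect_eq_0 by blast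
  show "omega11 \<delta> (A, B) \<noteq> (0, 0)" using Q_nonzero by (metis snd_conv)
  show "first_integral (omega11 \<delta> (A, B)) (reflect n G) (reflect n H)"
    using first_integral_chart[OF rel gh(2) gh_nonzero] by simp
  show "nonconstant (reflect n G) (reflect n H)" using nonconstant_rep[OF rel gh(3) nz] .
qed

text \<open>If N bounds the x-degrees of all coefficients, then \<delta> = N makes room for those of
  y^j with j positive. The exponent d only has to serve g(x, 0) and h(x, 0), not both zero by
  coprimality, and their coefficients of x^d are the values at the origin.\<close>

lemma not_dicritical_for_large_delta: "\<exists>\<delta>. \<not> dicritical_singularity (omega10 \<delta> (A, B)) (0, 0)"
proof -
  define d where "d = max (degree (coeff g 0)) (degree (coeff h 0))"
  obtain N where "fits 0 N g" "fits 0 N h" using fits_exists by blast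
  hence "degree (coeff p j) \<le> N + 0 * j" if "p = g \<or> p = h" for p j
    using that unfolding fits_def by blast
  hence "degree (coeff p j) \<le> d + N * j" if "p = g \<or> p = h" for p j
    using that unfolding d_def by (cases j) (auto intro: trans_le_add2 order_trans[of _ N])
  hence fits: "fits N d g" "fits N d h" by (simp_all add: fits_def)
  have gh0: "coeff g 0 \<noteq> 0 \<or> coeff h 0 \<noteq> 0"
  proof (rule ccontr)
    assume "\<not> (coeff g 0 \<noteq> 0 \<or> coeff h 0 \<noteq> 0)"
    hence "vary dvd g" "vary dvd h"
      by (auto simp: vary_def poly_eq_0_iff_dvd[of _ 0, simplified, symmetric] poly_0_coeff_0)
    hence "is_unit vary" using gh(1) coprime_common_divisor by blast
    thus False by (simp add: vary_def is_unit_poly_iff)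
  qed
  have "coeff (coeff g 0) d \<noteq> 0 \<or> coeff (coeff h 0) d \<noteq> 0"
  proof (cases "degree (coeff h 0) \<le> degree (coeff g 0) \<and> coeff g 0 \<noteq> 0")
    case True
    hence "d = degree (coeff g 0)" by (simp add: d_def)
    thus ?thesis using True by simp
  next
    case False
    hence "d = degree (coeff h 0)" "coeff h 0 \<noteq> 0"
      using gh0 by (auto simp: d_def max_def)
    thus ?thesis by simp
  qed
  hence "at0 (homogenize N d g) \<noteq> 0 \<or> at0 (homogenize N d h) \<noteq> 0"
    by (simp add: at0_def coeff_homogenize coeff_reflect)
  hence at: "at_pt (0, 0) (homogenize N d g) \<noteq> 0 \<or> at_pt (0, 0) (homogenize N d h) \<noteq> 0"
    by (simp add: at_pt_0 at0_restr)
  have nz: "(homogenize N d g, homogenize N d h) \<noteq> (0, 0)" using gh_nonzero fits homogenize_eq_0 by blast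
  note rep = omega10_rep[OF fits _ nz, OF mult.commute]
  show ?thesis using not_dicritical_singularity[OF rep(1,4,3) at] by blast
qed

text \<open>
  From \<open>\<delta>\<^sub>1\<close> on the first integral is defined at the origin of the first chart, and hence constant
  on the line \<open>x = 0\<close> of the next one, which is the exceptional divisor of a blowup.
\<close>

lemma rep_constant_on_line:
  assumes fits: "\<And>\<delta>. fits \<delta> N g" "\<And>\<delta>. fits \<delta> N h"
    and nd: "\<not> dicritical_singularity (omega10 \<delta>1 (A, B)) (0, 0)" and "\<delta> > \<delta>1"
  shows "\<exists>G H c1 c2. coprime G H \<and> G * homogenize \<delta> N h = H * homogenize \<delta> N g \<and>
    restr G = [:c1:] \<and> restr H = [:c2:] \<and> (c1 \<noteq> 0 \<or> c2 \<noteq> 0)"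
proof -
  \<comment> \<open>\<open>I\<close>: the first integral is defined at the origin. \<open>J\<close>:
    it is defined and constant on the line x = 0. A blowup leads from \<open>I\<close> to
    \<open>J\<close> for the next \<delta>.\<close>
  define I where "I \<delta> \<longleftrightarrow> (\<exists>G H. coprime G H \<and> G * homogenize \<delta> N h = H * homogenize \<delta> N g \<and>
    (at0 G \<noteq> 0 \<or> at0 H \<noteq> 0))" for \<delta>
  define J where "J \<delta> \<longleftrightarrow> (\<exists>G H c1 c2. coprime G H \<and> G * homogenize \<delta> N h = H * homogenize \<delta> N g \<and>
    restr G = [:c1:] \<and> restr H = [:c2:] \<and> (c1 \<noteq> 0 \<or> c2 \<noteq> 0))" for \<delta>
  have JI: "I \<delta>" if "J \<delta>" for \<delta>
  proof -
    obtain G H c1 c2 where *: "coprime G H" "G * homogenize \<delta> N h = H * homogenize \<delta> N g"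
      "restr G = [:c1:]" "restr H = [:c2:]" "c1 \<noteq> 0 \<or> c2 \<noteq> 0"
      using \<open>J \<delta>\<close> unfolding J_def by blast
    moreover have "at0 G \<noteq> 0 \<or> at0 H \<noteq> 0" using * by (simp add: at0_restr)
    ultimately show ?thesis unfolding I_def by blast
  qed
  have IJ: "J (Suc \<delta>)" if "I \<delta>" for \<delta>
  proof -
    obtain G H where GH: "coprime G H" "G * homogenize \<delta> N h = H * homogenize \<delta> N g" "at0 G \<noteq> 0 \<or> at0 H \<noteq> 0"
      using \<open>I \<delta>\<close> unfolding I_def by blast
    \<comment> \<open>Here m = 0: a pair that does not vanish at the origin acquires no common
      factor x.\<close>
    have "coprime (blow G) (blow H)"
      by (rule coprime_blowt[OF GH(1), where t = 0 and m = 0]) (use GH(3) in \<open>auto simp: blowt_shifty varx_dvd_iff restr_blow\<close>)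
    moreover have "blow G * homogenize (Suc \<delta>) N h = blow H * homogenize (Suc \<delta>) N g"
      using arg_cong[OF GH(2), of blow] by (simp add: blow.hom_mult blow_homogenize fits)
    moreover note restr_blow[of G] restr_blow[of H]
    ultimately show ?thesis unfolding J_def using GH(3) by metis
  qed
  have I1: "I \<delta>1"
  proof -
    define e where "e = gcd (homogenize \<delta>1 N g) (homogenize \<delta>1 N h)"
    define G where "G = homogenize \<delta>1 N g div e"
    define H where "H = homogenize \<delta>1 N h div e"
    have hn: "homogenize \<delta>1 N g = e * G" "homogenize \<delta>1 N h = e * H" by (simp_all add: e_def G_def H_def)
    have nz: "homogenize \<delta>1 N g \<noteq> 0 \<or> homogenize \<delta>1 N h \<noteq> 0"
      using gh_nonzero fits homogenize_eq_0 by blast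
    have cop: "coprime G H" unfolding G_def H_def e_def using nz by (rule div_gcd_coprime)
    have rel: "G * homogenize \<delta>1 N h = H * homogenize \<delta>1 N g" unfolding hn by (simp add: mult_ac)
    have GH: "(G, H) \<noteq> (0, 0)" using cop by auto
    have "at_pt (0, 0) G \<noteq> 0 \<or> at_pt (0, 0) H \<noteq> 0"
      using dicritical_singularity_if_indeterminate[OF _ cop] omega10_rep[OF fits rel GH] nd by blast
    thus ?thesis unfolding I_def using cop rel by (auto simp: at_pt_0 at0_restr)
  qed
  have "I \<delta>" if "\<delta> \<ge> \<delta>1" for \<delta>
    using that
  proof (induction \<delta> rule: dec_induct)
    case base
    show ?case by (rule I1)
  next
    case (step \<delta>)
    show ?case by (rule JI[OF IJ[OF step.IH]])
  qed
  moreover obtain \<delta>' where "\<delta> = Suc \<delta>'" "\<delta>' \<ge> \<delta>1" using \<open>\<delta> > \<delta>1\<close> by (cases \<delta>) auto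
  ultimately have "J \<delta>" using IJ by blast
  thus ?thesis unfolding J_def .
qed

lemma dicritical_on_line:
  assumes "\<not> dicritical_singularity (omega10 \<delta>1 (A, B)) (0, 0)" and "\<delta> > \<delta>1"
  shows "dicritical_singularity (omega11 \<delta> (A, B)) (0, t) \<longleftrightarrow> t = 0"
    and "\<not> dicritical_singularity (omega10 \<delta> (A, B)) (0, t)"
proof -
  obtain N where fits: "\<And>\<delta>. fits \<delta> N g" "\<And>\<delta>. fits \<delta> N h" using fits_exists by blast
  obtain G H c1 c2 where cop: "coprime G H" and rel: "G * homogenize \<delta> N h = H * homogenize \<delta> N g"
    and c: "restr G = [:c1:]" "restr H = [:c2:]" "c1 \<noteq> 0 \<or> c2 \<noteq> 0"
    using rep_constant_on_line[OF fits assms] by blast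
  have GH: "(G, H) \<noteq> (0, 0)" using cop by auto
  note rep10 = omega10_rep[OF fits rel GH]
  show "\<not> dicritical_singularity (omega10 \<delta> (A, B)) (0, t)"
    using not_dicritical_singularity[OF rep10(1,4,3), of "(0, t)"] c by (simp add: at_pt_0)
  \<comment> \<open>The exact maximum is needed: a larger n would give both reflections the common
    factor y.\<close>
  define n where "n = max (degree G) (degree H)"
  have n: "degree G \<le> n" "degree H \<le> n" by (simp_all add: n_def)
  note rep11 = omega11_rep[OF fits rel GH n]
  \<comment> \<open>For n = 0 the first integral would not depend on y; as the coefficient of dy is
    nonzero, it would then be constant.\<close>
  have "n \<noteq> 0"
  proof
    assume "n = 0"
    hence "dy G = 0" "dy H = 0" using n by (simp_all add: dy_def pderiv_eq_0_iff)
    hence "wrony G H = 0" by (simp add: wrony_def)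
    thus False using rep10(2-4) by (simp add: first_integral_def nonconstant_def)
  qed
  \<comment> \<open>The constants on the line are reflected to multiples of y^n, so the pair
    vanishes on the line at y = 0 and nowhere else.\<close>
  have at: "at_pt (0, t) (reflect n G) = c1 * t ^ n" "at_pt (0, t) (reflect n H) = c2 * t ^ n" for t
  proof -
    have "reflect n [:c:] = monom c n" for c :: complex
      by (rule poly_eqI) (auto simp: coeff_reflect coeff_pCons split: nat.splits)
    thus "at_pt (0, t) (reflect n G) = c1 * t ^ n" "at_pt (0, t) (reflect n H) = c2 * t ^ n"
      by (simp_all add: at_pt_0 restr_reflect c poly_monom)
  qed
  have "coeff G n \<noteq> 0 \<or> coeff H n \<noteq> 0"
    using GH \<open>n \<noteq> 0\<close> unfolding n_def max_def by (auto split: if_splits)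
  hence cop': "coprime (reflect n G) (reflect n H)" using coprime_reflect[OF cop n] by blast
  show "dicritical_singularity (omega11 \<delta> (A, B)) (0, t) \<longleftrightarrow> t = 0"
  proof
    assume "t = 0"
    thus "dicritical_singularity (omega11 \<delta> (A, B)) (0, t)"
      using dicritical_singularity_if_indeterminate[OF rep11(1) cop' rep11(2)] at \<open>n \<noteq> 0\<close> by simp
  next
    assume "dicritical_singularity (omega11 \<delta> (A, B)) (0, t)"
    thus "t = 0"
      using not_dicritical_singularity[OF rep11(1,3,2), of "(0, t)"] at[of t] c(3) by auto
  qed
qed

end

theorem corollary4p4:
  fixes a b :: poly2
  assumes "coprime a b"
    and "algebraically_integrable a b"
    and "\<not> (\<exists>c. c \<noteq> 0 \<and> a = 0 \<and> b = const2 c)"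
  shows "\<exists>\<delta>\<^sub>1.
    (\<not> dicritical_singularity (omega10 \<delta>\<^sub>1 (form_of_vf a b)) (0, 0) \<and>
     (\<forall>\<delta><\<delta>\<^sub>1. dicritical_singularity (omega10 \<delta> (form_of_vf a b)) (0, 0))) \<and>
    (\<forall>\<delta>>\<delta>\<^sub>1.
      (\<forall>t. dicritical_singularity (omega11 \<delta> (form_of_vf a b)) (0, t) \<longleftrightarrow> t = 0) \<and>
      (\<forall>t. \<not> dicritical_singularity (omega10 \<delta> (form_of_vf a b)) (0, t)))"
proof -
  \<comment> \<open>If a = 0, then b is a unit by coprimality, that is, a nonzero constant, and the
    field is one of those excluded.\<close>
  have a: "- a \<noteq> 0"
  proof
    assume "- a = 0"
    hence a: "a = 0" by simp
    have "is_unit b" using assms(1) unfolding a coprime_0_left_iff .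
    then obtain b0 where b0: "b = [:b0:]" "is_unit b0" unfolding is_unit_poly_iff by blast
    then obtain c where "b0 = [:c:]" "is_unit c" unfolding is_unit_poly_iff by blast
    with a b0 show False using assms(3) by (auto simp: const2_def)
  qed
  have cop: "coprime b (- a)" using assms(1) by (simp add: coprime_commute)
  obtain g h where gh: "coprime g h" "first_integral (b, - a) g h" "nonconstant g h"
    using assms(2) rational_first_integral_coprime unfolding algebraically_integrable_def form_of_vf_def by metis
  define \<delta>\<^sub>1 where "\<delta>\<^sub>1 = (LEAST \<delta>. \<not> dicritical_singularity (omega10 \<delta> (b, - a)) (0, 0))"
  have nd: "\<not> dicritical_singularity (omega10 \<delta>\<^sub>1 (b, - a)) (0, 0)"
    unfolding \<delta>\<^sub>1_def using not_dicritical_for_large_delta[OF cop a gh] by (rule LeastI_ex)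
  have "dicritical_singularity (omega10 \<delta> (b, - a)) (0, 0)" if "\<delta> < \<delta>\<^sub>1" for \<delta>
    using not_less_Least that unfolding \<delta>\<^sub>1_def by blast
  thus ?thesis unfolding form_of_vf_def using nd dicritical_on_line[OF cop a gh nd] by blast
qed

end
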